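(* Fix $\delta\in(0,\tfrac12)$, set $a=\tfrac12+\delta$, and let $T\in(0,\infty)$. For given initial data $f_0$, there is at most one mild solution $f$ of the full Boltzmann equation $$(\partial_t+v\cdot\nabla_x)f=Q^+(f,f)-Q^-(f,f),\qquad f(0)=f_0,$$ on the interval $[0,T]$ such that all of the following estimates hold: $$\langle v\rangle^{a}Q^+(f,f)\in L^1_{t\in[0,T]}L^2_{x,v},$$ $$\rho_f\in L^2_{t\in[0,T]}L^\infty_x\cap L^2_{t\in[0,T]}L^4_x,$$ $$\langle v\rangle^{a}f\in L^\infty_{t\in[0,T]}L^2_{x,v}\cap L^\infty_{t\in[0,T]}L^4_xL^2_v .$$ (No non-negativity of $f$ or $f_0$ is assumed.)
   Context: Here $x,v\in\mathbb{R}^2$ and $\langle v\rangle=(1+|v|^2)^{1/2}$. The free transport group is $T(t)=e^{-tv\cdot\nabla_x}$, i.e. $(T(t)g)(x,v)=g(x-tv,v)$ (not to be confused with the time $T$). The spatial density is $\rho_g(x)=\int_{\mathbb{R}^2}g(x,v)\,dv$. The collision operators (constant collision kernel, $d=2$) are $$Q^+(f,g)(x,v)=\int_{\mathbb{S}^1}d\omega\int_{\mathbb{R}^2}du\,f(x,v^* )g(x,u^* ),\qquad Q^-(f,g)(x,v)=2\pi f(x,v)\rho_g(x),$$ with $u^*=u+(\omega\cdot(v-u))\omega$ and $v^*=v-(\omega\cdot(v-u))\omega$. A mild solution is a function satisfying Duhamel's formula $f(t)=T(t)f_0+\int_0^tT(t-s)\{Q^+(f,f)(s)-Q^-(f,f)(s)\}\,ds$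 for each $t\in[0,T]$ and almost every $(x,v)$, with absolutely convergent time integrals of $Q^\pm$. In mixed norms such as $L^\infty_tL^4_xL^2_v$, the innermost norm is the rightmost one. *)

theory Defs
  imports "HOL-Analysis.Analysis" "HOL-Probability.Essential_Supremum"
begin

type_synonym R2 = "real ^ 2"

definition japanese :: "R2 \<Rightarrow> real"
  where "japanese v = sqrt (1 + (norm v)\<^sup>2)"

definition transport :: "real \<Rightarrow> (R2 \<Rightarrow> R2 \<Rightarrow> real) \<Rightarrow> R2 \<Rightarrow> R2 \<Rightarrow> real"
  where "transport t g x v = g (x - t *\<^sub>R v) v"

definition spatial_density :: "(R2 \<Rightarrow> R2 \<Rightarrow> real) \<Rightarrow> R2 \<Rightarrow> real"
  where "spatial_density g x = (LINT v|lebesgue. g x v)"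

definition post_v :: "R2 \<Rightarrow> R2 \<Rightarrow> R2 \<Rightarrow> R2"
  where "post_v \<omega> v u = v - (\<omega> \<bullet> (v - u)) *\<^sub>R \<omega>"

definition post_u :: "R2 \<Rightarrow> R2 \<Rightarrow> R2 \<Rightarrow> R2"
  where "post_u \<omega> v u = u + (\<omega> \<bullet> (v - u)) *\<^sub>R \<omega>"

text \<open>
  Integration over the unit circle with respect to arc length is integration over the angle
  \<open>\<theta>\<close> in \<open>[0, 2\<pi>]\<close>.
\<close>

definition circle_pt :: "real \<Rightarrow> R2"
  where "circle_pt \<theta> = vector [cos \<theta>, sin \<theta>]"

definition Qplus :: "(R2 \<Rightarrow> R2 \<Rightarrow> real) \<Rightarrow> (R2 \<Rightarrow> R2 \<Rightarrow> real) \<Rightarrow> R2 \<Rightarrow> R2 \<Rightarrow> real"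
  where "Qplus f g x v =
    (LINT \<theta>|lebesgue_on {0..2 * pi}. LINT u|lebesgue.
       f x (post_v (circle_pt \<theta>) v u) * g x (post_u (circle_pt \<theta>) v u))"

definition Qminus :: "(R2 \<Rightarrow> R2 \<Rightarrow> real) \<Rightarrow> (R2 \<Rightarrow> R2 \<Rightarrow> real) \<Rightarrow> R2 \<Rightarrow> R2 \<Rightarrow> real"
  where "Qminus f g x v = 2 * pi * f x v * spatial_density g x"

text \<open>
  The Bochner integral of a non-integrable function is \<open>0\<close> by convention, so a mild solution is
  required explicitly to have an absolutely convergent density and gain integral almost everywhere;
  otherwise \<open>spatial_density\<close>, \<open>Qplus\<close> and \<open>Qminus\<close> would not have their intended meaning. (For
  measurable \<open>f\<close> the convergence of the gain integral follows from that of the density.)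
  No sign condition is imposed, and the initial condition is the Duhamel formula at \<open>t = 0\<close>.
\<close>

definition mild_solution :: "real \<Rightarrow> (R2 \<Rightarrow> R2 \<Rightarrow> real) \<Rightarrow> (real \<Rightarrow> R2 \<Rightarrow> R2 \<Rightarrow> real) \<Rightarrow> bool"
  where "mild_solution T f0 f \<longleftrightarrow>
    (\<lambda>(t, x, v). f t x v) \<in> borel_measurable (lebesgue_on ({0..T} \<times> (UNIV :: (R2 \<times> R2) set))) \<and>
    (AE (t, x) in lebesgue_on ({0..T} \<times> (UNIV :: R2 set)). integrable lebesgue (f t x)) \<and>
    (AE (t, x, v) in lebesgue_on ({0..T} \<times> (UNIV :: (R2 \<times> R2) set)).
       integrable (lebesgue_on ({0..2 * pi} \<times> (UNIV :: R2 set)))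
         (\<lambda>(\<theta>, u). f t x (post_v (circle_pt \<theta>) v u) * f t x (post_u (circle_pt \<theta>) v u))) \<and>
    (\<forall>t\<in>{0..T}. AE (x, v) in lebesgue.
       integrable (lebesgue_on {0..t}) (\<lambda>s. transport (t - s) (Qplus (f s) (f s)) x v) \<and>
       integrable (lebesgue_on {0..t}) (\<lambda>s. transport (t - s) (Qminus (f s) (f s)) x v) \<and>
       f t x v = transport t f0 x v +
         (LINT s|lebesgue_on {0..t}.
            transport (t - s) (\<lambda>y w. Qplus (f s) (f s) y w - Qminus (f s) (f s) y w) x v))"

text \<open>
  Lebesgue norms of extended nonnegative functions, with values in \<open>[0, \<infinity>]\<close>, so that they can be
  nested to form mixed norms. \<open>ennpowr\<close> is only used with positive exponents. For \<open>L\<^sup>\<infinity>\<close> the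
  library's \<open>esssup\<close> is used; it is \<open>\<infinity>\<close> on non-measurable functions.
\<close>

definition ennpowr :: "ennreal \<Rightarrow> real \<Rightarrow> ennreal"
  where "ennpowr c p = (if c = \<infinity> then \<infinity> else ennreal (enn2real c powr p))"

definition Lp :: "real \<Rightarrow> 'a measure \<Rightarrow> ('a \<Rightarrow> ennreal) \<Rightarrow> ennreal"
  where "Lp p M h = ennpowr (\<integral>\<^sup>+ z. ennpowr (h z) p \<partial>M) (1 / p)"

definition Linf :: "'a measure \<Rightarrow> ('a \<Rightarrow> ennreal) \<Rightarrow> ennreal"
  where "Linf M h = esssup M h"

definition Qplus_bound :: "real \<Rightarrow> real \<Rightarrow> (real \<Rightarrow> R2 \<Rightarrow> R2 \<Rightarrow> real) \<Rightarrow> bool"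
  where "Qplus_bound a T f \<longleftrightarrow>
    Lp 1 (lebesgue_on {0..T}) (\<lambda>t. Lp 2 lebesgue
      (\<lambda>(x, v). ennreal \<bar>japanese v powr a * Qplus (f t) (f t) x v\<bar>)) < \<infinity>"

definition density_bounds :: "real \<Rightarrow> (real \<Rightarrow> R2 \<Rightarrow> R2 \<Rightarrow> real) \<Rightarrow> bool"
  where "density_bounds T f \<longleftrightarrow>
    Lp 2 (lebesgue_on {0..T}) (\<lambda>t. Linf lebesgue (\<lambda>x. ennreal \<bar>spatial_density (f t) x\<bar>)) < \<infinity> \<and>
    Lp 2 (lebesgue_on {0..T}) (\<lambda>t. Lp 4 lebesgue (\<lambda>x. ennreal \<bar>spatial_density (f t) x\<bar>)) < \<infinity>"

definition solution_bounds :: "real \<Rightarrow> real \<Rightarrow> (real \<Rightarrow> R2 \<Rightarrow> R2 \<Rightarrow> real) \<Rightarrow> bool"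
  where "solution_bounds a T f \<longleftrightarrow>
    Linf (lebesgue_on {0..T}) (\<lambda>t. Lp 2 lebesgue
      (\<lambda>(x, v). ennreal \<bar>japanese v powr a * f t x v\<bar>)) < \<infinity> \<and>
    Linf (lebesgue_on {0..T}) (\<lambda>t. Lp 4 lebesgue (\<lambda>x. Lp 2 lebesgue
      (\<lambda>v. ennreal \<bar>japanese v powr a * f t x v\<bar>))) < \<infinity>"

end

theory Submission
  imports Defs
begin

text \<open>
  By Duhamel's formula, the difference \<open>w = f - g\<close> is dominated by a freely transported function \<open>T(t) A\<close>,
  where \<open>\<langle>v\<rangle>\<^sup>a A \<in> L\<^sup>2\<close> is the time integral of the absolute value of the difference of the collision terms,
  pulled back along characteristics. Pairing \<open>\<langle>v\<rangle>\<^sup>a A\<close> with itself turns its squared norm into a trilinear form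
  in \<open>T(t) A\<close>, \<open>T(t) A\<close> and \<open>|f| + |g|\<close>, which on a time interval of length \<open>\<tau>\<close> is at most
  \<open>M \<surd>\<tau>\<close> times the squared norm. So \<open>A\<close> vanishes if \<open>\<tau>\<close> is small; as \<open>M\<close> depends only on the assumed
  bounds, finitely many such steps cover \<open>[0, T]\<close>.

  The gain term uses both copies of \<open>T(t) A\<close> in the non-endpoint Strichartz space \<open>L\<^sup>2\<^sub>t L\<^sup>8\<^sup>/\<^sup>3\<^sub>x L\<^sup>8\<^sup>/\<^sup>5\<^sub>v\<close>, and
  \<open>|f| + |g|\<close> in the weighted \<open>L\<^sup>\<infinity>\<^sub>t L\<^sup>4\<^sub>x L\<^sup>2\<^sub>v\<close>. The loss term uses the velocity averaging
  bound \<open>L\<^sup>2\<^sub>t L\<^sup>4\<^sub>x\<close> for the density, which needs the weight \<open>a > 1/2\<close>. All estimates concern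
  nonnegative functions and only use Hoelder's inequality, Tonelli's theorem and linear substitutions.
\<close>

section \<open>Powers and Hoelder inequalities for extended nonnegative functions\<close>

text \<open>Dominating the difference by a single transported function is what makes homogeneous
  estimates for \<open>T(t)\<close> sufficient: both copies of the difference become
  \<open>T(t) A\<close>, and the form is quadratic in \<open>A\<close>. Absorbing half of a squared
  norm proves nothing unless that norm is finite; finiteness comes from the assumed bound on the
  gain term and, for the loss term, from the density in L^2_t L^\<infinity>_x and the weighted L^2
  bound. The solutions are not small, so smallness must come from time alone. The scale-invariant
  time exponent of the Strichartz space is 4, and using 2 leaves the integrable kernel |t -
  s|^(-1/2), hence a factor sqrt \<tau>; in the two loss terms the factor comes from Cauchy-Schwarz
  in time and from the bound of |f| + |g| uniform in time. The exponents are tied together by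
  counting. In x, 3/8 + 3/8 + 1/4 = 1. In v, the collision form needs reciprocal exponents of sum 2,
  while 5/8 + 5/8 + 1/2 falls short by 1/4; the missing 1/4 is paid by \<langle>v\<rangle>^(-a) in
  L^4, which requires 4a > 2. The averaging bound meets the same threshold as convergence of the
  integral of R^(-2a) at infinity.\<close>

lemma ennpowr_zero [simp]: "ennpowr 0 p = 0"
  by (simp add: ennpowr_def)

lemma ennpowr_top [simp]: "ennpowr top p = top"
  by (simp add: ennpowr_def)

lemma ennpowr_ennreal: "0 \<le> x \<Longrightarrow> ennpowr (ennreal x) p = ennreal (x powr p)"
  by (simp add: ennpowr_def)

lemma ennpowr_one_right [simp]: "ennpowr c 1 = c"
  by (cases c) (auto simp: ennpowr_def)

lemma ennpowr_one_left [simp]: "ennpowr 1 p = 1"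
  by (simp add: ennpowr_def)

lemma ennpowr_mult: "0 < p \<Longrightarrow> ennpowr (c * d) p = ennpowr c p * ennpowr d p"
proof (cases c; cases d)
  fix x y :: real assume "c = ennreal x" "0 \<le> x" "d = ennreal y" "0 \<le> y"
  then show ?thesis
    by (simp add: ennpowr_ennreal powr_mult flip: ennreal_mult)
qed (auto simp: ennpowr_def ennreal_top_mult ennreal_mult_top ennreal_mult_eq_top_iff top_unique)

lemma ennpowr_ennpowr: "0 < p \<Longrightarrow> 0 < q \<Longrightarrow> ennpowr (ennpowr c p) q = ennpowr c (p * q)"
  by (cases c) (auto simp: ennpowr_ennreal powr_powr ennpowr_def)

lemma ennpowr_add: "0 < p \<Longrightarrow> 0 < q \<Longrightarrow> ennpowr c p * ennpowr c q = ennpowr c (p + q)"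
  by (cases c) (auto simp: ennpowr_ennreal powr_add ennpowr_def ennreal_top_mult simp flip: ennreal_mult)

lemma ennpowr_mono: "0 \<le> p \<Longrightarrow> c \<le> d \<Longrightarrow> ennpowr c p \<le> ennpowr d p"
  by (cases c; cases d) (auto simp: ennpowr_ennreal ennpowr_def top_unique intro!: ennreal_leI powr_mono2)

lemma ennpowr_eq_0_iff: "0 < p \<Longrightarrow> ennpowr c p = 0 \<longleftrightarrow> c = 0"
  by (cases c) (auto simp: ennpowr_ennreal ennpowr_def)

lemma ennpowr_eq_top_iff: "ennpowr c p = top \<longleftrightarrow> c = top"
  by (cases c) (auto simp: ennpowr_ennreal ennpowr_def)

lemma ennpowr_less_top_iff: "ennpowr c p < top \<longleftrightarrow> c < top"
  using ennpowr_eq_top_iff[of c p] by (simp add: less_top[symmetric])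

lemma ennpowr_2: "ennpowr c 2 = c\<^sup>2"
  using ennpowr_add[of 1 1 c] by (simp add: power2_eq_square)

lemma ennpowr_half_sq: "ennpowr (c\<^sup>2) (1/2) = c"
  using ennpowr_ennpowr[of 2 "1/2" c] by (simp add: ennpowr_2)

lemma sq_ennpowr_half: "(ennpowr c (1/2))\<^sup>2 = c"
  using ennpowr_ennpowr[of "1/2" 2 c] by (simp add: ennpowr_2)

lemma ennpowr_measurable [measurable]:
  assumes [measurable]: "f \<in> borel_measurable M"
  shows "(\<lambda>x. ennpowr (f x) p) \<in> borel_measurable M"
  unfolding ennpowr_def by measurable

text \<open>The power 1/p is a monotone inverse, so it turns an upper bound for the powers into an
  upper bound for the functions. This is what lets monotone convergence pass through the nested
  norms in \<open>strichartz\<close>.\<close>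

lemma ennpowr_SUP:
  assumes "0 < p"
  shows "ennpowr (SUP n\<in>I. f n) p = (SUP n\<in>I. ennpowr (f n) p)"
proof (rule antisym)
  let ?L = "SUP n\<in>I. ennpowr (f n) p"
  have "f n \<le> ennpowr ?L (1/p)" if "n \<in> I" for n
  proof -
    have "ennpowr (ennpowr (f n) p) (1/p) \<le> ennpowr ?L (1/p)"
      using assms that by (intro ennpowr_mono SUP_upper) auto
    then show ?thesis using assms by (simp add: ennpowr_ennpowr)
  qed
  then have "(SUP n\<in>I. f n) \<le> ennpowr ?L (1/p)"
    by (rule SUP_least)
  then have "ennpowr (SUP n\<in>I. f n) p \<le> ennpowr (ennpowr ?L (1/p)) p"
    using assms by (intro ennpowr_mono) auto
  then show "ennpowr (SUP n\<in>I. f n) p \<le> ?L"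
    using assms by (simp add: ennpowr_ennpowr)
qed (use assms in \<open>auto intro!: SUP_least ennpowr_mono SUP_upper\<close>)

text \<open>Weighted arithmetic-geometric mean inequality with three terms, obtained from the
  two-term version used twice. Infinite arguments make the right side infinite because all weights
  are positive.\<close>

lemma ennpowr_young3:
  assumes "0 < \<alpha>" "0 < \<beta>" "0 < \<gamma>" "\<alpha> + \<beta> + \<gamma> = 1"
  shows "ennpowr x \<alpha> * ennpowr y \<beta> * ennpowr z \<gamma>
    \<le> ennreal \<alpha> * x + ennreal \<beta> * y + ennreal \<gamma> * z"
proof (cases "x = 0 \<or> y = 0 \<or> z = 0")
  case False
  show ?thesis
  proof (cases "x = \<infinity> \<or> y = \<infinity> \<or> z = \<infinity>")
    case True
    then have "ennreal \<alpha> * x + ennreal \<beta> * y + ennreal \<gamma> * z = top"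
      using assms by (auto simp: ennreal_mult_top)
    then show ?thesis by (metis top_greatest)
  next
    case fin: False
    with False obtain a b c where abc: "x = ennreal a" "y = ennreal b" "z = ennreal c" "0 < a" "0 < b" "0 < c"
      by (cases x; cases y; cases z) (auto simp: less_le)
    have s: "\<alpha> + \<beta> > 0" using assms by simp
    \<comment> \<open>The first two factors are merged into their weighted geometric mean, with
      weights normalised to sum 1; \<open>w\<close> then carries the weight \<alpha> + \<beta>
      against \<open>c\<close>.\<close>
    define w where "w = a powr (\<alpha>/(\<alpha>+\<beta>)) * b powr (\<beta>/(\<alpha>+\<beta>))"
    have w: "w > 0" using abc by (simp add: w_def)
    have e1: "w powr (\<alpha>+\<beta>) = a powr \<alpha> * b powr \<beta>"
      using abc s by (simp add: w_def powr_mult powr_powr)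
    have e2: "w powr (\<alpha>+\<beta>) * c powr \<gamma> \<le> (\<alpha>+\<beta>) * w + \<gamma> * c"
      using assms abc w by (intro Youngs_inequality_0) auto
    have "w \<le> \<alpha>/(\<alpha>+\<beta>) * a + \<beta>/(\<alpha>+\<beta>) * b"
      unfolding w_def using assms abc s by (intro Youngs_inequality_0) (auto simp flip: add_divide_distrib)
    then have "(\<alpha>+\<beta>) * w \<le> (\<alpha>+\<beta>) * (\<alpha>/(\<alpha>+\<beta>) * a + \<beta>/(\<alpha>+\<beta>) * b)"
      using s by (intro mult_left_mono) auto
    then have "(\<alpha>+\<beta>) * w \<le> \<alpha> * a + \<beta> * b"
      using s by (simp add: distrib_left[of "\<alpha>+\<beta>"])
    with e2 have "a powr \<alpha> * b powr \<beta> * c powr \<gamma> \<le> \<alpha> * a + \<beta> * b + \<gamma> * c"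
      unfolding e1 by linarith
    then show ?thesis
      using abc assms by (simp add: ennpowr_ennreal ennreal_leI flip: ennreal_mult ennreal_plus)
  qed
qed auto

text \<open>Each function is divided by its integral and the pointwise inequality
  \<open>ennpowr_young3\<close> is integrated. The exponents sit outside the functions, so that
  applications only have to exhibit an integrand as a product of powers; vanishing and infinite
  integrals are separate cases.\<close>

lemma nn_integral_Holder3:
  assumes [measurable]: "f \<in> borel_measurable M" "g \<in> borel_measurable M" "h \<in> borel_measurable M"
    and e: "0 < \<alpha>" "0 < \<beta>" "0 < \<gamma>" "\<alpha> + \<beta> + \<gamma> = 1"
  shows "(\<integral>\<^sup>+x. ennpowr (f x) \<alpha> * ennpowr (g x) \<beta> * ennpowr (h x) \<gamma> \<partial>M)
    \<le> ennpowr (\<integral>\<^sup>+x. f x \<partial>M) \<alpha> * ennpowr (\<integral>\<^sup>+x. g x \<partial>M) \<beta> * ennpowr (\<integral>\<^sup>+x. h x \<partial>M) \<gamma>"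
    (is "?I \<le> ennpowr ?F \<alpha> * ennpowr ?G \<beta> * ennpowr ?H \<gamma>")
proof (cases "?F = 0 \<or> ?G = 0 \<or> ?H = 0")
  case True
  then have "AE x in M. ennpowr (f x) \<alpha> * ennpowr (g x) \<beta> * ennpowr (h x) \<gamma> = 0"
    by (auto simp: nn_integral_0_iff_AE)
  then have "?I = 0" by (subst nn_integral_0_iff_AE) auto
  then show ?thesis by simp
next
  case nz: False
  show ?thesis
  proof (cases "?F = \<infinity> \<or> ?G = \<infinity> \<or> ?H = \<infinity>")
    case True
    then have "ennpowr ?F \<alpha> * ennpowr ?G \<beta> * ennpowr ?H \<gamma> = \<infinity>"
      using nz e ennpowr_eq_0_iff ennpowr_eq_top_iff
      by (auto simp: ennreal_mult_eq_top_iff)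
    then show ?thesis by simp
  next
    case fin: False
    with nz obtain a b c where abc: "?F = ennreal a" "?G = ennreal b" "?H = ennreal c" "0 < a" "0 < b" "0 < c"
      by (cases ?F; cases ?G; cases ?H) (auto simp: less_le)
    let ?K = "ennpowr ?F \<alpha> * ennpowr ?G \<beta> * ennpowr ?H \<gamma>"
    have inv: "ennreal r * ennreal (1/r) = 1" if "r > 0" for r
      using that by (simp flip: ennreal_mult)
    have pt: "ennpowr (f x) \<alpha> * ennpowr (g x) \<beta> * ennpowr (h x) \<gamma>
      \<le> ?K * (ennreal \<alpha> * (ennreal (1/a) * f x) + ennreal \<beta> * (ennreal (1/b) * g x) + ennreal \<gamma> * (ennreal (1/c) * h x))" for x
    proof -
      have s: "ennpowr y p = ennpowr (ennreal r) p * ennpowr (ennreal (1/r) * y) p" if "r > 0" "p > 0" for y r p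
        using that inv by (simp add: mult.assoc[symmetric] flip: ennpowr_mult)
      have "ennpowr (f x) \<alpha> * ennpowr (g x) \<beta> * ennpowr (h x) \<gamma>
        = ?K * (ennpowr (ennreal (1/a) * f x) \<alpha> * ennpowr (ennreal (1/b) * g x) \<beta> * ennpowr (ennreal (1/c) * h x) \<gamma>)"
        using s[of a \<alpha> "f x"] s[of b \<beta> "g x"] s[of c \<gamma> "h x"] abc e by (simp add: ac_simps)
      also have "\<dots> \<le> ?K * (ennreal \<alpha> * (ennreal (1/a) * f x) + ennreal \<beta> * (ennreal (1/b) * g x) + ennreal \<gamma> * (ennreal (1/c) * h x))"
        using e by (intro mult_left_mono ennpowr_young3) auto
      finally show ?thesis .
    qed
    have "?I \<le> (\<integral>\<^sup>+x. ?K * (ennreal \<alpha> * (ennreal (1/a) * f x) + ennreal \<beta> * (ennreal (1/b) * g x) + ennreal \<gamma> * (ennreal (1/c) * h x)) \<partial>M)"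
      by (intro nn_integral_mono pt)
    also have "\<dots> = ?K * (ennreal \<alpha> * (ennreal (1/a) * ?F) + ennreal \<beta> * (ennreal (1/b) * ?G) + ennreal \<gamma> * (ennreal (1/c) * ?H))"
      by (simp add: nn_integral_cmult nn_integral_add)
    also have "\<dots> = ?K * (ennreal \<alpha> + ennreal \<beta> + ennreal \<gamma>)"
      using abc inv by (simp add: mult.commute)
    also have "ennreal \<alpha> + ennreal \<beta> + ennreal \<gamma> = 1"
      using e by (simp flip: ennreal_plus)
    finally show ?thesis by simp
  qed
qed

lemma nn_integral_Holder2:
  assumes [measurable]: "f \<in> borel_measurable M" "g \<in> borel_measurable M"
    and e: "0 < \<alpha>" "0 < \<beta>" "\<alpha> + \<beta> = 1"
  shows "(\<integral>\<^sup>+x. ennpowr (f x) \<alpha> * ennpowr (g x) \<beta> \<partial>M)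
    \<le> ennpowr (\<integral>\<^sup>+x. f x \<partial>M) \<alpha> * ennpowr (\<integral>\<^sup>+x. g x \<partial>M) \<beta>"
  \<comment> \<open>The second function is entered twice with half of its exponent.\<close>
  using nn_integral_Holder3[of f M g g \<alpha> "\<beta>/2" "\<beta>/2"] e
  by (simp add: mult.assoc ennpowr_add)

lemma nn_integral_Cauchy_Schwarz:
  assumes [measurable]: "f \<in> borel_measurable M" "g \<in> borel_measurable M"
  shows "(\<integral>\<^sup>+x. f x * g x \<partial>M)
    \<le> ennpowr (\<integral>\<^sup>+x. (f x)\<^sup>2 \<partial>M) (1/2) * ennpowr (\<integral>\<^sup>+x. (g x)\<^sup>2 \<partial>M) (1/2)"
  using nn_integral_Holder2[of "\<lambda>x. (f x)\<^sup>2" M "\<lambda>x. (g x)\<^sup>2" "1/2" "1/2"]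
  by (simp add: ennpowr_half_sq)

section \<open>Joint measurability, Tonelli and translations of Lebesgue measure\<close>

lemma borel_measurable_fst' [measurable (raw)]:
  fixes f :: "'c \<Rightarrow> 'a::second_countable_topology \<times> 'b::second_countable_topology"
  assumes "f \<in> borel_measurable M"
  shows "(\<lambda>x. fst (f x)) \<in> borel_measurable M"
  by (rule measurable_compose[OF assms]) (intro borel_measurable_continuous_onI continuous_intros)

lemma borel_measurable_snd' [measurable (raw)]:
  fixes f :: "'c \<Rightarrow> 'a::second_countable_topology \<times> 'b::second_countable_topology"
  assumes "f \<in> borel_measurable M"
  shows "(\<lambda>x. snd (f x)) \<in> borel_measurable M"
  by (rule measurable_compose[OF assms]) (intro borel_measurable_continuous_onI continuous_intros)

lemma lborel_Fubini:
  fixes f :: "'a::euclidean_space \<Rightarrow> 'b::euclidean_space \<Rightarrow> ennreal"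
  assumes "(\<lambda>p. f (fst p) (snd p)) \<in> borel_measurable borel"
  shows "(\<integral>\<^sup>+y. \<integral>\<^sup>+x. f x y \<partial>lborel \<partial>lborel) = (\<integral>\<^sup>+x. \<integral>\<^sup>+y. f x y \<partial>lborel \<partial>lborel)"
  by (rule lborel_pair.Fubini') (use assms in \<open>simp add: lborel_prod case_prod_unfold\<close>)

lemma nn_integral_lborel_pair:
  fixes f :: "'a::euclidean_space \<times> 'b::euclidean_space \<Rightarrow> ennreal"
  assumes "f \<in> borel_measurable borel"
  shows "(\<integral>\<^sup>+p. f p \<partial>lborel) = (\<integral>\<^sup>+x. \<integral>\<^sup>+y. f (x, y) \<partial>lborel \<partial>lborel)"
  unfolding lborel_prod[symmetric]
  by (rule lborel.nn_integral_fst[symmetric]) (use assms in \<open>simp add: lborel_prod\<close>)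

lemma nn_integral_lborel_shift:
  fixes f :: "'a::euclidean_space \<Rightarrow> ennreal"
  assumes [measurable]: "f \<in> borel_measurable borel"
  shows "(\<integral>\<^sup>+x. f (x + c) \<partial>lborel) = (\<integral>\<^sup>+x. f x \<partial>lborel)"
proof -
  have "(\<integral>\<^sup>+x. f x \<partial>lborel) = (\<integral>\<^sup>+x. f x \<partial>distr lborel borel ((+) c))"
    by (simp add: lborel_distr_plus)
  also have "\<dots> = (\<integral>\<^sup>+x. f (c + x) \<partial>lborel)"
    by (rule nn_integral_distr) auto
  finally show ?thesis by (simp add: add.commute)
qed

text \<open>For fixed velocity the flow is a translation in x, so it preserves the measure of phase
  space.\<close>

lemma nn_integral_transport:
  fixes f :: "R2 \<times> R2 \<Rightarrow> ennreal"
  assumes [measurable]: "f \<in> borel_measurable borel"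
  shows "(\<integral>\<^sup>+x. \<integral>\<^sup>+v. f (x + t *\<^sub>R v, v) \<partial>lborel \<partial>lborel) = (\<integral>\<^sup>+x. \<integral>\<^sup>+v. f (x, v) \<partial>lborel \<partial>lborel)"
proof -
  have "(\<integral>\<^sup>+x. \<integral>\<^sup>+v. f (x + t *\<^sub>R v, v) \<partial>lborel \<partial>lborel)
     = (\<integral>\<^sup>+v. \<integral>\<^sup>+x. f (x + t *\<^sub>R v, v) \<partial>lborel \<partial>lborel)"
    by (intro lborel_Fubini[symmetric]) measurable
  also have "\<dots> = (\<integral>\<^sup>+v. \<integral>\<^sup>+x. f (x, v) \<partial>lborel \<partial>lborel)"
    by (subst nn_integral_lborel_shift[of "\<lambda>x. f (x, _)"]) auto
  also have "\<dots> = (\<integral>\<^sup>+x. \<integral>\<^sup>+v. f (x, v) \<partial>lborel \<partial>lborel)"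
    by (intro lborel_Fubini) measurable
  finally show ?thesis .
qed

section \<open>Collisions and rotations of the plane\<close>

text \<open>Multiplication by the imaginary unit when the plane is identified with the complex
  numbers; \<open>rot\<close> below is then multiplication by exp(i \<theta>).\<close>

definition quarter :: "R2 \<Rightarrow> R2"
  where "quarter z = (z $ 1) *\<^sub>R axis 2 1 - (z $ 2) *\<^sub>R axis 1 1"

definition rot :: "real \<Rightarrow> R2 \<Rightarrow> R2"
  where "rot \<theta> z = cos \<theta> *\<^sub>R z + sin \<theta> *\<^sub>R quarter z"

lemma quarter_nth [simp]: "quarter z $ 1 = - (z $ 2)" "quarter z $ 2 = z $ 1"
  by (simp_all add: quarter_def axis_def)

lemma circle_pt_nth [simp]: "circle_pt \<theta> $ 1 = cos \<theta>" "circle_pt \<theta> $ 2 = sin \<theta>"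
  by (simp_all add: circle_pt_def)

text \<open>Oriented so as to eliminate squares of the cosine: together with the distributive laws
  it brings trigonometric polynomials to a normal form in which the rotation identities below become
  decidable by rewriting.\<close>

lemma cos_mult_self: "cos x * cos x = 1 - sin x * sin (x::real)"
  using sin_cos_squared_add[of x] unfolding power2_eq_square by linarith

lemma cos_mult_self': "cos x * (cos x * y) = y - sin x * (sin x * (y::real))"
  by (simp add: mult.assoc[symmetric] cos_mult_self left_diff_distrib)

lemma circle_pt_axis: "circle_pt \<theta> = cos \<theta> *\<^sub>R axis 1 1 + sin \<theta> *\<^sub>R axis 2 1"
  by (simp add: vec_eq_iff forall_2 axis_def)

lemma inner_R2: "(x :: R2) \<bullet> y = x $ 1 * y $ 1 + x $ 2 * y $ 2"
  by (simp add: inner_vec_def sum_2)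

lemma norm_R2: "norm (x :: R2) = sqrt ((x $ 1)\<^sup>2 + (x $ 2)\<^sup>2)"
  by (simp add: norm_eq_sqrt_inner inner_R2 power2_eq_square)

lemma R2_eq_iff: "(x :: R2) = y \<longleftrightarrow> x $ 1 = y $ 1 \<and> x $ 2 = y $ 2"
  by (simp add: vec_eq_iff forall_2)

lemma circle_pt_measurable [measurable]: "circle_pt \<in> borel_measurable borel"
  unfolding circle_pt_axis[abs_def] by measurable

lemma quarter_measurable [measurable]: "quarter \<in> borel_measurable borel"
  unfolding quarter_def by (intro borel_measurable_continuous_onI continuous_intros)

lemma rot_measurable [measurable]:
  assumes [measurable]: "f \<in> borel_measurable M" "g \<in> borel_measurable M"
  shows "(\<lambda>x. rot (f x) (g x)) \<in> borel_measurable M"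
  unfolding rot_def by measurable

lemma post_measurable [measurable]:
  assumes [measurable]: "f \<in> borel_measurable M" "g \<in> borel_measurable M" "h \<in> borel_measurable M"
  shows "(\<lambda>x. post_v (f x) (g x) (h x)) \<in> borel_measurable M"
    "(\<lambda>x. post_u (f x) (g x) (h x)) \<in> borel_measurable M"
  unfolding post_v_def post_u_def by measurable

lemma linear_rot: "linear (\<lambda>z. c *\<^sub>R rot \<theta> z)"
  by (rule linearI) (simp_all add: R2_eq_iff rot_def algebra_simps)

lemma norm_rot: "norm (rot \<theta> z) = norm z"
proof -
  have "(rot \<theta> z $ 1)\<^sup>2 + (rot \<theta> z $ 2)\<^sup>2
    = ((sin \<theta>)\<^sup>2 + (cos \<theta>)\<^sup>2) * ((z $ 1)\<^sup>2 + (z $ 2)\<^sup>2)"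
    by (simp add: rot_def power2_eq_square algebra_simps del: sin_cos_squared_add sin_cos_squared_add2 sin_cos_squared_add3)
  then show ?thesis by (simp add: norm_R2)
qed

lemma rot_inverse: "rot (-\<theta>) (rot \<theta> z) = z" "rot \<theta> (rot (-\<theta>) z) = z"
proof -
  show "rot (-\<theta>) (rot \<theta> z) = z" "rot \<theta> (rot (-\<theta>) z) = z"
    by (simp_all add: R2_eq_iff rot_def distrib_left distrib_right right_diff_distrib left_diff_distrib
        mult.assoc[symmetric] cos_mult_self)
qed

lemma rot_scaleR: "rot \<theta> (c *\<^sub>R z) = c *\<^sub>R rot \<theta> z"
  by (simp add: R2_eq_iff rot_def algebra_simps)

lemma det_rot: "det (matrix (\<lambda>z. c *\<^sub>R rot \<theta> z)) = c\<^sup>2"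
proof -
  have "det (matrix (\<lambda>z. c *\<^sub>R rot \<theta> z)) = c * cos \<theta> * (c * cos \<theta>) + c * sin \<theta> * (c * sin \<theta>)"
    by (simp add: det_2 matrix_def rot_def axis_def)
  also have "\<dots> = c\<^sup>2 * ((cos \<theta>)\<^sup>2 + (sin \<theta>)\<^sup>2)"
    by (simp only: power2_eq_square) algebra
  finally show ?thesis by simp
qed

text \<open>The preimage of a box is its image under the inverse map \<open>S\<close>, a linear map
  of determinant 1/c^2; hence c^2 times the image measure agrees with Lebesgue measure on boxes,
  which determines it.\<close>

lemma nn_integral_rot:
  assumes [measurable]: "f \<in> borel_measurable borel" and c: "c \<noteq> 0"
  shows "(\<integral>\<^sup>+z. f (c *\<^sub>R rot \<theta> z) \<partial>lborel) = ennreal (1 / c\<^sup>2) * (\<integral>\<^sup>+z. f z \<partial>lborel)"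
proof -
  define T where "T = (\<lambda>z. c *\<^sub>R rot \<theta> z)"
  define S where "S = (\<lambda>z. (1/c) *\<^sub>R rot (-\<theta>) z)"
  have [measurable]: "T \<in> borel_measurable borel" unfolding T_def by measurable
  have TS: "T (S z) = z" "S (T z) = z" for z
    using c by (simp_all add: T_def S_def rot_scaleR rot_inverse)
  have "lborel = density (distr lborel borel T) (\<lambda>_. ennreal (c\<^sup>2))"
  proof (rule lborel_eqI)
    fix l u :: R2 assume le: "\<And>b. b \<in> Basis \<Longrightarrow> l \<bullet> b \<le> u \<bullet> b"
    have im: "T -` box l u = S ` box l u"
      using TS by (auto simp: image_iff) (metis TS(2))
    have lin: "linear S" unfolding S_def by (rule linear_rot)
    have "measure lebesgue (S ` box l u) = \<bar>det (matrix S)\<bar> * measure lebesgue (box l u)"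
      by (rule measure_linear_image[OF lin]) simp
    also have "\<dots> = (1/c\<^sup>2) * (\<Prod>b\<in>Basis. (u - l) \<bullet> b)"
      using le by (simp add: S_def det_rot power_divide measure_lborel_box_eq)
    finally have m: "measure lebesgue (S ` box l u) = (1/c\<^sup>2) * (\<Prod>b\<in>Basis. (u - l) \<bullet> b)" .
    have "S ` box l u \<in> lmeasurable"
      by (rule measurable_linear_image[OF lin]) simp
    then have e: "emeasure lebesgue (S ` box l u) = ennreal ((1/c\<^sup>2) * (\<Prod>b\<in>Basis. (u - l) \<bullet> b))"
      by (simp add: emeasure_eq_measure2 m)
    have "T -` box l u \<in> sets borel"
      using measurable_sets[of T borel borel "box l u"] by simp
    then have "emeasure lborel (T -` box l u) = emeasure lebesgue (T -` box l u)"
      by simp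
    then show "emeasure (density (distr lborel borel T) (\<lambda>_. ennreal (c\<^sup>2))) (box l u) = ennreal (\<Prod>b\<in>Basis. (u - l) \<bullet> b)"
      using c le by (simp add: emeasure_density_const emeasure_distr im e inner_diff_left prod_nonneg flip: ennreal_mult)
  qed simp
  then have "(\<integral>\<^sup>+z. f z \<partial>lborel) = (\<integral>\<^sup>+z. f z \<partial>density (distr lborel borel T) (\<lambda>_. ennreal (c\<^sup>2)))"
    by simp
  also have "\<dots> = ennreal (c\<^sup>2) * (\<integral>\<^sup>+z. f (T z) \<partial>lborel)"
    by (simp add: nn_integral_density nn_integral_distr nn_integral_cmult)
  finally have "ennreal (1 / c\<^sup>2) * (\<integral>\<^sup>+z. f z \<partial>lborel) = ennreal (1 / c\<^sup>2) * ennreal (c\<^sup>2) * (\<integral>\<^sup>+z. f (T z) \<partial>lborel)"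
    by (simp add: mult.assoc)
  also have "ennreal (1 / c\<^sup>2) * ennreal (c\<^sup>2) = 1"
    using c by (simp flip: ennreal_mult)
  finally show ?thesis by (simp add: T_def)
qed

lemma nn_integral_rot_shift:
  assumes [measurable]: "f \<in> borel_measurable borel" and c: "c \<noteq> 0"
  shows "(\<integral>\<^sup>+z. f (v + c *\<^sub>R rot \<theta> z) \<partial>lborel) = ennreal (1 / c\<^sup>2) * (\<integral>\<^sup>+z. f z \<partial>lborel)"
  using nn_integral_rot[of "\<lambda>z. f (z + v)" c \<theta>] c nn_integral_lborel_shift[of f v]
  by (simp add: add.commute)

text \<open>The shifted window [\<alpha>, p + \<alpha>] is cut at p and its right end is moved back
  by one period; the shared end points are null.\<close>

lemma nn_integral_periodic_shift:
  fixes g :: "real \<Rightarrow> ennreal"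
  assumes [measurable]: "g \<in> borel_measurable borel"
    and per: "\<And>x. g (x + p) = g x" and \<alpha>: "0 \<le> \<alpha>" "\<alpha> \<le> p"
  shows "(\<integral>\<^sup>+x\<in>{0..p}. g (x + \<alpha>) \<partial>lborel) = (\<integral>\<^sup>+x\<in>{0..p}. g x \<partial>lborel)"
proof -
  have ae: "AE x in lborel. x \<noteq> \<alpha>" "AE x in lborel. x \<noteq> p" "AE x in lborel. x \<noteq> 0" "AE x in lborel. x \<noteq> p + \<alpha>"
    by (auto simp: AE_lborel_singleton)
  have "(\<integral>\<^sup>+x\<in>{0..p}. g (x + \<alpha>) \<partial>lborel) = (\<integral>\<^sup>+x. g x * indicator {\<alpha>..p+\<alpha>} x \<partial>lborel)"
    by (subst nn_integral_lborel_shift[of "\<lambda>x. g x * indicator {\<alpha>..p+\<alpha>} x" \<alpha>, symmetric])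
      (auto intro!: nn_integral_cong split: split_indicator)
  also have "\<dots> = (\<integral>\<^sup>+x. g x * indicator {\<alpha>..p} x + g x * indicator {p<..p+\<alpha>} x \<partial>lborel)"
    using \<alpha> by (intro nn_integral_cong) (auto split: split_indicator)
  also have "\<dots> = (\<integral>\<^sup>+x. g x * indicator {\<alpha>..p} x \<partial>lborel) + (\<integral>\<^sup>+x. g x * indicator {p<..p+\<alpha>} x \<partial>lborel)"
    by (rule nn_integral_add) auto
  also have "(\<integral>\<^sup>+x. g x * indicator {p<..p+\<alpha>} x \<partial>lborel) = (\<integral>\<^sup>+x. g x * indicator {0<..\<alpha>} x \<partial>lborel)"
    by (subst nn_integral_lborel_shift[of _ p, symmetric])
      (auto simp: per intro!: nn_integral_cong split: split_indicator)
  also have "(\<integral>\<^sup>+x. g x * indicator {\<alpha>..p} x \<partial>lborel) + (\<integral>\<^sup>+x. g x * indicator {0<..\<alpha>} x \<partial>lborel)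
      = (\<integral>\<^sup>+x. g x * indicator {\<alpha>..p} x + g x * indicator {0<..\<alpha>} x \<partial>lborel)"
    by (rule nn_integral_add[symmetric]) auto
  also have "\<dots> = (\<integral>\<^sup>+x\<in>{0..p}. g x \<partial>lborel)"
  proof (rule nn_integral_cong_AE)
    show "AE x in lborel. g x * indicator {\<alpha>..p} x + g x * indicator {0<..\<alpha>} x = g x * indicator {0..p} x"
      using ae by eventually_elim (use \<alpha> in \<open>auto split: split_indicator\<close>)
  qed
  finally show ?thesis .
qed

text \<open>The gain operator at a fixed position, on nonnegative velocity profiles with values in
  [0, \<infinity>], so that it is meaningful and monotone without any integrability.\<close>

definition nQ :: "(R2 \<Rightarrow> ennreal) \<Rightarrow> (R2 \<Rightarrow> ennreal) \<Rightarrow> R2 \<Rightarrow> ennreal"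
  where "nQ p q v = (\<integral>\<^sup>+\<theta>\<in>{0..2*pi}.
    (\<integral>\<^sup>+u. p (post_v (circle_pt \<theta>) v u) * q (post_u (circle_pt \<theta>) v u) \<partial>lborel) \<partial>lborel)"

text \<open>The components of v - u along \<omega> and along \<omega> turned by a right angle add up
  to v - u. Subtracting one component from v is therefore the same as adding the other one to
  u.\<close>

lemma post_quarter:
  "post_v (circle_pt (\<theta> + pi/2)) v u = post_u (circle_pt \<theta>) v u"
  "post_u (circle_pt (\<theta> + pi/2)) v u = post_v (circle_pt \<theta>) v u"
proof -
  show "post_v (circle_pt (\<theta> + pi/2)) v u = post_u (circle_pt \<theta>) v u"
    "post_u (circle_pt (\<theta> + pi/2)) v u = post_v (circle_pt \<theta>) v u"
    by (simp_all add: R2_eq_iff post_v_def post_u_def inner_R2 sin_add cos_add distrib_left distrib_right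
        right_diff_distrib left_diff_distrib mult.assoc[symmetric] cos_mult_self)
      (simp_all add: algebra_simps cos_mult_self cos_mult_self')
qed

lemma circle_pt_periodic: "circle_pt (\<theta> + 2 * pi) = circle_pt \<theta>"
  by (simp add: R2_eq_iff)

text \<open>The collision kernel is constant and the angle runs over a full period, so the quarter
  turn that exchanges the two outgoing velocities does not change the integral.\<close>

lemma nQ_commute:
  assumes [measurable]: "p \<in> borel_measurable borel" "q \<in> borel_measurable borel"
  shows "nQ p q v = nQ q p v"
proof -
  have "nQ p q v = (\<integral>\<^sup>+\<theta>\<in>{0..2*pi}.
    (\<integral>\<^sup>+u. p (post_v (circle_pt (\<theta> + pi/2)) v u) * q (post_u (circle_pt (\<theta> + pi/2)) v u) \<partial>lborel) \<partial>lborel)"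
    unfolding nQ_def
    by (rule nn_integral_periodic_shift[symmetric]) (auto simp: circle_pt_periodic)
  then show ?thesis by (simp add: post_quarter nQ_def mult.commute)
qed

text \<open>The angle is measured from the direction of the relative velocity \<open>z = u - v\<close>; this makes
  both outgoing velocities linear images of \<open>z\<close>.\<close>

lemma nQ_relative:
  assumes [measurable]: "p \<in> borel_measurable borel" "q \<in> borel_measurable borel"
  shows "nQ p q v = (\<integral>\<^sup>+\<theta>\<in>{0..2*pi}.
    (\<integral>\<^sup>+z. p (v + cos \<theta> *\<^sub>R rot \<theta> z) * q (v + (- sin \<theta>) *\<^sub>R rot (\<theta> + pi/2) z) \<partial>lborel) \<partial>lborel)"
proof -
  have post: "post_v (circle_pt (\<theta> + \<alpha>)) v (z + v) = v + cos \<theta> *\<^sub>R rot \<theta> z"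
    "post_u (circle_pt (\<theta> + \<alpha>)) v (z + v) = v + (- sin \<theta>) *\<^sub>R rot (\<theta> + pi/2) z"
    if z: "z $ 1 = r * cos \<alpha>" "z $ 2 = r * sin \<alpha>" for \<theta> \<alpha> r z
  proof -
    have i: "circle_pt (\<theta> + \<alpha>) \<bullet> z = r * cos \<theta>"
    proof -
      have "circle_pt (\<theta> + \<alpha>) \<bullet> z = r * (cos (\<theta> + \<alpha>) * cos \<alpha> + sin (\<theta> + \<alpha>) * sin \<alpha>)"
        by (simp add: inner_R2 z algebra_simps)
      also have "cos (\<theta> + \<alpha>) * cos \<alpha> + sin (\<theta> + \<alpha>) * sin \<alpha> = cos \<theta>"
        using cos_diff[of "\<theta> + \<alpha>" \<alpha>] by simp
      finally show ?thesis .
    qed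
    have v: "post_v (circle_pt (\<theta> + \<alpha>)) v (z + v) = v + (r * cos \<theta>) *\<^sub>R circle_pt (\<theta> + \<alpha>)"
      "post_u (circle_pt (\<theta> + \<alpha>)) v (z + v) = z + v - (r * cos \<theta>) *\<^sub>R circle_pt (\<theta> + \<alpha>)"
      by (simp_all add: post_v_def post_u_def i)
    have c: "(r * cos \<theta>) *\<^sub>R circle_pt (\<theta> + \<alpha>) = cos \<theta> *\<^sub>R rot \<theta> z"
      by (simp add: R2_eq_iff rot_def z cos_add sin_add algebra_simps)
    have d: "z - cos \<theta> *\<^sub>R rot \<theta> z = (- sin \<theta>) *\<^sub>R rot (\<theta> + pi/2) z" for z
      by (simp add: R2_eq_iff rot_def cos_add sin_add distrib_left distrib_right
        right_diff_distrib left_diff_distrib mult.assoc[symmetric] cos_mult_self)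
    show "post_v (circle_pt (\<theta> + \<alpha>)) v (z + v) = v + cos \<theta> *\<^sub>R rot \<theta> z"
      "post_u (circle_pt (\<theta> + \<alpha>)) v (z + v) = v + (- sin \<theta>) *\<^sub>R rot (\<theta> + pi/2) z"
      unfolding v c using d[of z] by (simp_all add: algebra_simps)
  qed
  let ?K = "\<lambda>\<theta> z. p (post_v (circle_pt \<theta>) v (z + v)) * q (post_u (circle_pt \<theta>) v (z + v))"
  let ?L = "\<lambda>\<theta> z. p (v + cos \<theta> *\<^sub>R rot \<theta> z) * q (v + (- sin \<theta>) *\<^sub>R rot (\<theta> + pi/2) z)"
  have "nQ p q v = (\<integral>\<^sup>+\<theta>\<in>{0..2*pi}. (\<integral>\<^sup>+z. ?K \<theta> z \<partial>lborel) \<partial>lborel)"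
    unfolding nQ_def
    by (subst nn_integral_lborel_shift[where c = v, symmetric]) auto
  also have "\<dots> = (\<integral>\<^sup>+\<theta>. (\<integral>\<^sup>+z. ?K \<theta> z * indicator {0..2*pi} \<theta> \<partial>lborel) \<partial>lborel)"
    by (simp add: nn_integral_multc)
  also have "\<dots> = (\<integral>\<^sup>+z. (\<integral>\<^sup>+\<theta>. ?K \<theta> z * indicator {0..2*pi} \<theta> \<partial>lborel) \<partial>lborel)"
    by (rule lborel_Fubini[symmetric]) measurable
  also have "\<dots> = (\<integral>\<^sup>+z. (\<integral>\<^sup>+\<theta>. ?L \<theta> z * indicator {0..2*pi} \<theta> \<partial>lborel) \<partial>lborel)"
  \<comment> \<open>The angle integral has been made the inner one because the shift that aligns
    \<theta> with z depends on z.\<close>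
  proof (rule nn_integral_cong)
    fix z :: R2
    \<comment> \<open>Polar coordinates of the relative velocity; for z = 0 the radius 0 with angle
      0 serves.\<close>
    obtain r \<alpha> where a: "0 \<le> \<alpha>" "\<alpha> \<le> 2 * pi" and z: "z $ 1 = r * cos \<alpha>" "z $ 2 = r * sin \<alpha>"
    proof (cases "z = 0")
      case True
      then show thesis using that[of 0 0] by simp
    next
      case False
      define r where "r = norm z"
      have r: "r > 0" using False by (simp add: r_def)
      have r2: "r\<^sup>2 = (z $ 1)\<^sup>2 + (z $ 2)\<^sup>2" by (simp add: r_def norm_R2)
      have "(z $ 1 / r)\<^sup>2 + (z $ 2 / r)\<^sup>2 = ((z $ 1)\<^sup>2 + (z $ 2)\<^sup>2) / r\<^sup>2"
        by (simp add: power_divide add_divide_distrib)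
      also have "\<dots> = 1" using r r2 by (simp flip: r2)
      finally obtain t where "0 \<le> t" "t < 2*pi" "z $ 1 / r = cos t" "z $ 2 / r = sin t"
        by (elim sincos_total_2pi)
      then show thesis using that[of t r] r by (simp add: field_simps)
    qed
    have "(\<integral>\<^sup>+\<theta>\<in>{0..2*pi}. ?K \<theta> z \<partial>lborel) = (\<integral>\<^sup>+\<theta>\<in>{0..2*pi}. ?K (\<theta> + \<alpha>) z \<partial>lborel)"
      by (rule nn_integral_periodic_shift[symmetric]) (use a in \<open>auto simp: circle_pt_periodic\<close>)
    also have "\<dots> = (\<integral>\<^sup>+\<theta>\<in>{0..2*pi}. ?L \<theta> z \<partial>lborel)"
      by (simp add: post[OF z])
    finally show "(\<integral>\<^sup>+\<theta>\<in>{0..2*pi}. ?K \<theta> z \<partial>lborel) = (\<integral>\<^sup>+\<theta>\<in>{0..2*pi}. ?L \<theta> z \<partial>lborel)" .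
  qed
  also have "\<dots> = (\<integral>\<^sup>+\<theta>. (\<integral>\<^sup>+z. ?L \<theta> z * indicator {0..2*pi} \<theta> \<partial>lborel) \<partial>lborel)"
    by (rule lborel_Fubini) measurable
  also have "\<dots> = (\<integral>\<^sup>+\<theta>\<in>{0..2*pi}. (\<integral>\<^sup>+z. ?L \<theta> z \<partial>lborel) \<partial>lborel)"
    by (simp add: nn_integral_multc)
  finally show ?thesis .
qed

section \<open>Velocity weights and angular integrals\<close>

text \<open>After division by x + y both arguments lie in [0, 1], where t \<le> t^a because a \<le>
  1, and they sum to 1.\<close>

lemma powr_add_le:
  fixes x y a :: real
  assumes "0 \<le> x" "0 \<le> y" "0 < a" "a \<le> 1"
  shows "(x + y) powr a \<le> x powr a + y powr a"
proof (cases "x + y = 0")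
  case False
  then have s: "x + y > 0" using assms by simp
  have *: "t \<le> t powr a" if "0 \<le> t" "t \<le> 1" for t :: real
    using that assms powr_mono'[of a 1 t] by (cases "t = 0") auto
  have "1 = x / (x + y) + y / (x + y)"
    using s by (simp flip: add_divide_distrib)
  also have "\<dots> \<le> (x / (x + y)) powr a + (y / (x + y)) powr a"
    using assms s by (intro add_mono *) auto
  also have "\<dots> = (x powr a + y powr a) / (x + y) powr a"
    using assms s by (simp add: powr_divide add_divide_distrib)
  finally show ?thesis using s by (simp add: field_simps)
qed (use assms in auto)

lemma japanese_ge_1: "1 \<le> japanese v"
  by (simp add: japanese_def)

lemma japanese_pos [simp]: "0 < japanese v"
  using japanese_ge_1[of v] by linarith

lemma norm_le_japanese: "norm v \<le> japanese v"
  by (simp add: japanese_def real_le_rsqrt)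

lemma japanese_measurable [measurable]: "japanese \<in> borel_measurable borel"
  unfolding japanese_def by measurable

lemma japanese_triangle: "japanese (x + y) \<le> japanese x + norm y"
proof -
  have "1 + (norm (x + y))\<^sup>2 \<le> 1 + (norm x + norm y)\<^sup>2"
    by (simp add: norm_triangle_ineq power_mono)
  also have "\<dots> = (japanese x)\<^sup>2 + 2 * norm x * norm y + (norm y)\<^sup>2"
    by (simp add: japanese_def power2_sum)
  also have "\<dots> \<le> (japanese x)\<^sup>2 + 2 * japanese x * norm y + (norm y)\<^sup>2"
    using norm_le_japanese[of x] by (simp add: mult_right_mono)
  also have "\<dots> = (japanese x + norm y)\<^sup>2"
    by (simp add: power2_sum)
  finally have "1 + (norm (x + y))\<^sup>2 \<le> (japanese x + norm y)\<^sup>2" .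
  moreover have "0 \<le> japanese x + norm y"
    using japanese_pos[of x] norm_ge_zero[of y] by linarith
  ultimately show ?thesis
    unfolding japanese_def[of "x + y"] by (intro real_le_lsqrt)
qed

abbreviation jw :: "real \<Rightarrow> R2 \<Rightarrow> ennreal"
  where "jw a v \<equiv> ennreal (japanese v powr a)"

lemma jw_mult: "jw a v * jw b v = jw (a + b) v"
  by (simp add: powr_add flip: ennreal_mult)

lemma jw_cancel [simp]: "jw a v * jw (-a) v = 1" "jw (-a) v * jw a v = 1"
  "jw a v * (jw (-a) v * c) = c" "jw (-a) v * (jw a v * c) = c"
  using jw_mult[where a = a and b = "-a" and v = v] jw_mult[where a = "-a" and b = a and v = v] japanese_pos[of v]
  by (simp_all add: mult.assoc[symmetric] less_imp_neq[symmetric])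

lemma jw_pow: "0 < p \<Longrightarrow> ennpowr (jw a v) p = jw (a * p) v"
  by (simp add: ennpowr_ennreal powr_powr)

text \<open>The factor \<open>|cos \<theta>|\<close> compensates the logarithmic divergence at grazing collisions that
  would result from putting all of the weight on the second particle.\<close>

lemma jw_collision:
  assumes a: "0 < a" "a \<le> 1"
  shows "jw a v \<le> 2 * jw a (v + cos \<theta> *\<^sub>R rot \<theta> z)
    + ennreal (\<bar>cos \<theta>\<bar> powr a) * jw a (v + (- sin \<theta>) *\<^sub>R rot (\<theta> + pi/2) z)"
proof -
  let ?x = "v + cos \<theta> *\<^sub>R rot \<theta> z" and ?y = "v + (- sin \<theta>) *\<^sub>R rot (\<theta> + pi/2) z"
  have d: "?x - ?y = cos \<theta> *\<^sub>R rot \<theta> z + sin \<theta> *\<^sub>R rot (\<theta> + pi/2) z" by simp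
  \<comment> \<open>The outgoing relative velocity is z turned by 2\<theta>, so it has the length of
    the incoming one. This bounds |z| by the outgoing speeds.\<close>
  have "?x - ?y = rot \<theta> (rot \<theta> z)"
    unfolding d by (simp add: R2_eq_iff rot_def cos_add sin_add algebra_simps)
  then have nz: "norm z = norm (?x - ?y)" by (simp add: norm_rot)
  have "norm (?x - ?y) \<le> norm ?x + norm ?y" by (rule norm_triangle_ineq4)
  with nz have nz': "norm z \<le> japanese ?x + japanese ?y"
    using norm_le_japanese[of ?x] norm_le_japanese[of ?y] by linarith
  have "japanese v \<le> japanese ?x + norm (- (cos \<theta> *\<^sub>R rot \<theta> z))"
    using japanese_triangle[of ?x "- (cos \<theta> *\<^sub>R rot \<theta> z)"] by simp
  also have "norm (- (cos \<theta> *\<^sub>R rot \<theta> z)) = \<bar>cos \<theta>\<bar> * norm z"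
    by (simp add: norm_rot)
  also have "\<dots> \<le> \<bar>cos \<theta>\<bar> * (japanese ?x + japanese ?y)"
    using nz' by (intro mult_left_mono) auto
  also have "\<dots> \<le> japanese ?x + \<bar>cos \<theta>\<bar> * japanese ?y"
    using japanese_pos[of ?x] mult_right_mono[of "\<bar>cos \<theta>\<bar>" 1 "japanese ?x"] by (simp add: distrib_left)
  finally have "japanese v \<le> 2 * japanese ?x + \<bar>cos \<theta>\<bar> * japanese ?y" by simp
  then have "japanese v powr a \<le> (2 * japanese ?x + \<bar>cos \<theta>\<bar> * japanese ?y) powr a"
    using a by (intro powr_mono2) (auto simp: less_imp_le)
  also have "\<dots> \<le> (2 * japanese ?x) powr a + (\<bar>cos \<theta>\<bar> * japanese ?y) powr a"
    using a by (intro powr_add_le) (auto simp: less_imp_le)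
  also have "\<dots> = 2 powr a * japanese ?x powr a + \<bar>cos \<theta>\<bar> powr a * japanese ?y powr a"
    by (simp add: powr_mult less_imp_le)
  also have "\<dots> \<le> 2 * japanese ?x powr a + \<bar>cos \<theta>\<bar> powr a * japanese ?y powr a"
    using a powr_mono[of a 1 2] by (intro add_mono mult_right_mono) auto
  finally have "jw a v \<le> ennreal (2 * japanese ?x powr a + \<bar>cos \<theta>\<bar> powr a * japanese ?y powr a)"
    by (rule ennreal_leI)
  also have "\<dots> = 2 * jw a ?x + ennreal (\<bar>cos \<theta>\<bar> powr a) * jw a ?y"
    by (simp add: ennreal_mult)
  finally show ?thesis .
qed

lemma nn_integral_powr_0:
  assumes "-1 < p" "0 \<le> c"
  shows "(\<integral>\<^sup>+x\<in>{0..c}. ennreal (x powr p) \<partial>lborel) = ennreal (c powr (p + 1) / (p + 1))"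
  using nn_integral_has_integral_lebesgue[OF _ has_integral_powr_from_0[OF assms]]
  by (simp add: ennreal_mult' ennreal_indicator mult.commute)

lemma nn_integral_powr_inf:
  assumes "p < -1" "0 < c"
  shows "(\<integral>\<^sup>+x\<in>{c..}. ennreal (x powr p) \<partial>lborel) = ennreal (c powr (p + 1) / (- p - 1))"
proof -
  have "- (c powr (p + 1)) / (p + 1) = c powr (p + 1) / (- p - 1)"
    by (metis minus_add_distrib minus_divide_left minus_divide_right diff_conv_add_uminus)
  then show ?thesis
    using nn_integral_has_integral_lebesgue[OF _ has_integral_powr_to_inf[OF assms]]
    by (simp add: ennreal_mult' ennreal_indicator mult.commute)
qed

lemma emeasure_cball_R2: "0 \<le> r \<Longrightarrow> emeasure lborel (cball (c :: R2) r) = ennreal (pi * r\<^sup>2)"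
  by (simp add: emeasure_cball unit_ball_vol_2)

text \<open>The integral of R^(-q-1) from max(1, |u|) to infinity is max(1, |u|)^(-q)/q, and max(1,
  |u|) \<le> \<langle>u\<rangle>. A polynomial weight is thus dominated by a superposition of
  indicators of balls of radius at least 1.\<close>

lemma jw_layer_cake:
  assumes "0 < q"
  shows "jw (-q) u \<le> ennreal q * (\<integral>\<^sup>+R\<in>{1..}. ennreal (R powr (-q-1)) * indicator {R. norm u \<le> R} R \<partial>lborel)"
proof -
  define m where "m = max 1 (norm u)"
  have m: "m > 0" "m \<le> japanese u" using japanese_ge_1[of u] norm_le_japanese[of u] by (auto simp: m_def)
  have "(\<integral>\<^sup>+R\<in>{1..}. ennreal (R powr (-q-1)) * indicator {R. norm u \<le> R} R \<partial>lborel)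
    = (\<integral>\<^sup>+R\<in>{m..}. ennreal (R powr (-q-1)) \<partial>lborel)"
    by (intro nn_integral_cong) (auto simp: m_def split: split_indicator)
  also have "\<dots> = ennreal (m powr (-q) / q)"
    using assms m nn_integral_powr_inf[of "-q-1" m] by simp
  also have "ennreal q * \<dots> = ennreal (m powr (-q))"
    using assms by (simp flip: ennreal_mult)
  finally have "ennreal q * (\<integral>\<^sup>+R\<in>{1..}. ennreal (R powr (-q-1)) * indicator {R. norm u \<le> R} R \<partial>lborel)
    = ennreal (m powr (-q))" .
  moreover have "japanese u powr (-q) \<le> m powr (-q)"
    using assms m by (intro powr_mono2') auto
  ultimately show ?thesis by (simp add: ennreal_leI)
qed

text \<open>Discs have area \<pi> R^2, so the layered form of the weight leaves the integral of
  R^(1-q) over R \<ge> 1, which converges for q > 2.\<close>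

lemma jw_integrable:
  assumes "2 < q"
  shows "(\<integral>\<^sup>+u. jw (-q) u \<partial>lborel) < top"
proof -
  have "(\<integral>\<^sup>+u. jw (-q) u \<partial>lborel)
    \<le> (\<integral>\<^sup>+u. ennreal q * (\<integral>\<^sup>+R\<in>{1..}. ennreal (R powr (-q-1)) * indicator {R. norm u \<le> R} R \<partial>lborel) \<partial>(lborel :: R2 measure))"
    using assms by (intro nn_integral_mono jw_layer_cake) auto
  also have "\<dots> = ennreal q * (\<integral>\<^sup>+u. (\<integral>\<^sup>+R\<in>{1..}. ennreal (R powr (-q-1)) * indicator {R. norm u \<le> R} R \<partial>lborel) \<partial>(lborel :: R2 measure))"
    by (rule nn_integral_cmult) measurable
  also have "(\<integral>\<^sup>+u. (\<integral>\<^sup>+R\<in>{1..}. ennreal (R powr (-q-1)) * indicator {R. norm u \<le> R} R \<partial>lborel) \<partial>(lborel :: R2 measure))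
     = (\<integral>\<^sup>+R. (\<integral>\<^sup>+u. ennreal (R powr (-q-1)) * indicator {R. norm u \<le> R} R * indicator {1..} R \<partial>(lborel :: R2 measure)) \<partial>lborel)"
    by (rule lborel_Fubini) measurable
  also have "\<dots> = (\<integral>\<^sup>+R\<in>{1..}. ennreal (pi * R powr (1 - q)) \<partial>lborel)"
  proof (rule nn_integral_cong)
    fix R :: real
    show "(\<integral>\<^sup>+u. ennreal (R powr (-q-1)) * indicator {R. norm u \<le> R} R * indicator {1..} R \<partial>(lborel :: R2 measure))
      = ennreal (pi * R powr (1 - q)) * indicator {1..} R"
    proof (cases "1 \<le> R")
      case True
      have "(\<integral>\<^sup>+u. ennreal (R powr (-q-1)) * indicator {R. norm u \<le> R} R * indicator {1..} R \<partial>(lborel :: R2 measure))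
        = (\<integral>\<^sup>+u. ennreal (R powr (-q-1)) * indicator (cball 0 R) u \<partial>(lborel :: R2 measure))"
        using True by (intro nn_integral_cong) (auto split: split_indicator)
      also have "\<dots> = ennreal (R powr (-q-1)) * ennreal (pi * R\<^sup>2)"
        using True by (subst nn_integral_cmult_indicator) (auto simp: emeasure_cball_R2)
      also have "\<dots> = ennreal (R powr (-q-1) * (pi * R\<^sup>2))"
        by (simp add: ennreal_mult)
      also have "R powr (-q-1) * R\<^sup>2 = R powr (1 - q)"
        using True powr_add[of R "-q-1" 2] by simp
      then have "R powr (-q-1) * (pi * R\<^sup>2) = pi * R powr (1 - q)"
        by simp
      finally show ?thesis using True by simp
    qed simp
  qed
  also have "\<dots> = ennreal pi * (\<integral>\<^sup>+R\<in>{1..}. ennreal (R powr (1 - q)) \<partial>lborel)"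
    by (simp add: ennreal_mult mult.assoc nn_integral_cmult)
  also have "\<dots> = ennreal pi * ennreal (1 / (q - 2))"
    using nn_integral_powr_inf[of "1 - q" 1] assms by simp
  finally show ?thesis
    by (rule order.strict_trans1) (simp add: ennreal_mult_less_top)
qed

section \<open>Integrability of the angular singularities where sine or cosine vanishes\<close>

lemma sin_ge_half:
  fixes x :: real
  assumes "0 \<le> x" "x \<le> pi/2"
  shows "x / 2 \<le> sin x"
\<comment> \<open>The function sin x - x/2 increases exactly up to \<pi>/3, where cos x = 1/2;
  beyond this point sin x is at least sqrt 3 / 2 > 0.8, while x/2 is at most 0.8.\<close>
proof (cases "x \<le> pi / 3")
  case True
  have "sin 0 - 0 / 2 \<le> sin x - x / 2"
  proof (rule DERIV_nonneg_imp_nondecreasing[OF assms(1), of "\<lambda>x. sin x - x / 2"])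
    fix y assume y: "0 \<le> y" "y \<le> x"
    have "cos (pi/3) \<le> cos y" using y True by (intro cos_monotone_0_pi_le) auto
    then have "0 \<le> cos y - 1 / 2" by (simp add: cos_60)
    then show "\<exists>d. ((\<lambda>x. sin x - x / 2) has_real_derivative d) (at y) \<and> 0 \<le> d"
      by (intro exI[of _ "cos y - 1/2"]) (auto intro!: derivative_eq_intros)
  qed
  then show ?thesis by simp
next
  case False
  have "sin (pi/3) \<le> sin x" using assms False by (intro sin_monotone_2pi_le) auto
  then have "sqrt 3 / 2 \<le> sin x" by (simp add: sin_60)
  moreover have "1.7 \<le> sqrt 3" by (rule real_le_rsqrt) (simp add: power2_eq_square)
  moreover have "x \<le> 1.6" using assms pi_approx by simp
  ultimately show ?thesis by simp
qed

text \<open>Common majorant of the angular factors that both parts of the collision estimate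
  produce. The exponents -1/2 and -3/4 are -2\<beta> and -2\<gamma> of
  \<open>collision_trilinear\<close> for \<beta> = 1/4, \<gamma> = 3/8; both exceed -1.\<close>

definition ang :: "real \<Rightarrow> ennreal"
  where "ang \<theta> = ennreal (\<bar>cos \<theta>\<bar> powr (-1/2) * \<bar>sin \<theta>\<bar> powr (-3/4))"

lemma ang_measurable [measurable]: "ang \<in> borel_measurable borel"
  unfolding ang_def by measurable

text \<open>On [0, 2\<pi>] the sine vanishes at 0, \<pi> and 2\<pi>, and every angle is within
  \<pi>/2 of one of them. Three translates of one majorant of the form |y|^(-3/4) therefore cover
  the interval.\<close>

lemma sin_powr_integrable: "(\<integral>\<^sup>+\<theta>\<in>{0..2*pi}. ennreal (\<bar>sin \<theta>\<bar> powr (-3/4)) \<partial>lborel) < top"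
proof -
  define g where "g = (\<lambda>y::real. ennreal (2 * \<bar>y\<bar> powr (-3/4)) * indicator {-2*pi..2*pi} y)"
  have [measurable]: "g \<in> borel_measurable borel" unfolding g_def by measurable
  have bd: "\<bar>sin y\<bar> powr (-3/4) \<le> 2 * \<bar>y\<bar> powr (-3/4)" if "\<bar>y\<bar> \<le> pi/2" for y
  proof (cases "y = 0")
    case False
    have "\<bar>y\<bar> / 2 \<le> sin \<bar>y\<bar>" using that by (intro sin_ge_half) auto
    moreover have "sin \<bar>y\<bar> \<le> \<bar>sin y\<bar>" by (cases "y \<ge> 0") auto
    ultimately have "\<bar>sin y\<bar> powr (-3/4) \<le> (\<bar>y\<bar> / 2) powr (-3/4)"
      using False by (intro powr_mono2') auto
    also have "\<dots> = 2 powr (3/4) * \<bar>y\<bar> powr (-3/4)"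
      by (simp add: powr_divide powr_minus divide_simps)
    also have "\<dots> \<le> 2 powr 1 * \<bar>y\<bar> powr (-3/4)"
      by (intro mult_right_mono powr_mono) auto
    finally show ?thesis by simp
  qed simp
  have gfin: "(\<integral>\<^sup>+y. g y \<partial>lborel) < top"
  proof -
    have pos: "(\<integral>\<^sup>+x\<in>{0..2*pi}. ennreal (x powr (-3/4)) \<partial>lborel) < top"
      by (subst nn_integral_powr_0) auto
    have "(\<integral>\<^sup>+y. g y \<partial>lborel)
      \<le> (\<integral>\<^sup>+y. 2 * (ennreal (y powr (-3/4)) * indicator {0..2*pi} y) + 2 * (ennreal ((-y) powr (-3/4)) * indicator {0..2*pi} (- y)) \<partial>lborel)"
      unfolding g_def by (intro nn_integral_mono) (auto simp: ennreal_mult split: split_indicator)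
    also have "\<dots> = (\<integral>\<^sup>+y. 2 * (ennreal (y powr (-3/4)) * indicator {0..2*pi} y) \<partial>lborel)
        + (\<integral>\<^sup>+y. 2 * (ennreal ((-y) powr (-3/4)) * indicator {0..2*pi} (- y)) \<partial>lborel)"
      by (rule nn_integral_add) measurable
    also have "(\<integral>\<^sup>+y. 2 * (ennreal ((-y) powr (-3/4)) * indicator {0..2*pi} (- y)) \<partial>lborel)
      = (\<integral>\<^sup>+y. 2 * (ennreal (y powr (-3/4)) * indicator {0..2*pi} y) \<partial>lborel)"
      by (subst nn_integral_real_affine[where c = "-1" and t = 0]) auto
    also have "(\<integral>\<^sup>+y. 2 * (ennreal (y powr (-3/4)) * indicator {0..2*pi} y) \<partial>lborel) + (\<integral>\<^sup>+y. 2 * (ennreal (y powr (-3/4)) * indicator {0..2*pi} y) \<partial>lborel) < top"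
      using pos by (simp add: nn_integral_cmult ennreal_mult_less_top)
    finally show ?thesis .
  qed
  have "(\<integral>\<^sup>+\<theta>\<in>{0..2*pi}. ennreal (\<bar>sin \<theta>\<bar> powr (-3/4)) \<partial>lborel)
    \<le> (\<integral>\<^sup>+\<theta>. (g \<theta> + g (\<theta> + (-pi))) + g (\<theta> + (-2*pi)) \<partial>lborel)"
  proof (rule nn_integral_mono)
    fix \<theta> :: real
    have le: "g \<theta> \<le> (g \<theta> + g (\<theta> + (-pi))) + g (\<theta> + (-2*pi))"
      "g (\<theta> + (-pi)) \<le> (g \<theta> + g (\<theta> + (-pi))) + g (\<theta> + (-2*pi))"
      "g (\<theta> + (-2*pi)) \<le> (g \<theta> + g (\<theta> + (-pi))) + g (\<theta> + (-2*pi))"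
      by (rule add_increasing2[OF zero_le add_increasing2[OF zero_le order.refl]]
          add_increasing2[OF zero_le add_increasing[OF zero_le order.refl]]
          add_increasing[OF zero_le order.refl])+
    show "ennreal (\<bar>sin \<theta>\<bar> powr (-3/4)) * indicator {0..2*pi} \<theta> \<le> (g \<theta> + g (\<theta> + (-pi))) + g (\<theta> + (-2*pi))"
    proof (cases "\<theta> \<in> {0..2*pi}")
      case True
      then consider "\<theta> \<le> pi/2" | "\<bar>\<theta> - pi\<bar> \<le> pi/2" | "\<bar>\<theta> - 2*pi\<bar> \<le> pi/2"
        unfolding abs_le_iff by (cases "\<theta> \<le> pi/2"; cases "\<theta> \<le> 3*pi/2") auto
      then show ?thesis
      proof cases
        case 1
        then have "ennreal (\<bar>sin \<theta>\<bar> powr (-3/4)) \<le> g \<theta>"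
          using True bd[of \<theta>] by (auto simp: g_def intro!: ennreal_leI)
        from order.trans[OF this le(1)] show ?thesis using True by simp
      next
        case 2
        have "\<bar>sin \<theta>\<bar> = \<bar>sin (\<theta> - pi)\<bar>" by (simp add: sin_diff)
        then have "ennreal (\<bar>sin \<theta>\<bar> powr (-3/4)) \<le> g (\<theta> + (-pi))"
          using True 2 bd[of "\<theta> - pi"] by (auto simp: g_def intro!: ennreal_leI)
        from order.trans[OF this le(2)] show ?thesis using True by simp
      next
        case 3
        have "\<bar>sin \<theta>\<bar> = \<bar>sin (\<theta> - 2*pi)\<bar>" by (simp add: sin_diff)
        then have "ennreal (\<bar>sin \<theta>\<bar> powr (-3/4)) \<le> g (\<theta> + (-2*pi))"
          using True 3 bd[of "\<theta> - 2*pi"] by (auto simp: g_def intro!: ennreal_leI)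
        from order.trans[OF this le(3)] show ?thesis using True by simp
      qed
    qed simp
  qed
  also have "\<dots> = (\<integral>\<^sup>+\<theta>. g \<theta> \<partial>lborel) + (\<integral>\<^sup>+\<theta>. g (\<theta> + (-pi)) \<partial>lborel) + (\<integral>\<^sup>+\<theta>. g (\<theta> + (-2*pi)) \<partial>lborel)"
    by (simp add: nn_integral_add)
  also have "\<dots> = (\<integral>\<^sup>+\<theta>. g \<theta> \<partial>lborel) + (\<integral>\<^sup>+\<theta>. g \<theta> \<partial>lborel) + (\<integral>\<^sup>+\<theta>. g \<theta> \<partial>lborel)"
    by (subst (1 2) nn_integral_lborel_shift[of g]) auto
  also have "\<dots> < top" using gfin by simp
  finally show ?thesis .
qed

text \<open>Sine and cosine cannot both be below 1/2 in modulus, so at any angle at most one factor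
  is singular and the product is bounded by a sum of separate singularities.\<close>

lemma ang_integrable: "(\<integral>\<^sup>+\<theta>\<in>{0..2*pi}. ang \<theta> \<partial>lborel) < top"
proof -
  have c: "(\<integral>\<^sup>+\<theta>\<in>{0..2*pi}. ennreal (\<bar>cos \<theta>\<bar> powr (-3/4)) \<partial>lborel) = (\<integral>\<^sup>+\<theta>\<in>{0..2*pi}. ennreal (\<bar>sin \<theta>\<bar> powr (-3/4)) \<partial>lborel)"
    using nn_integral_periodic_shift[of "\<lambda>\<theta>. ennreal (\<bar>sin \<theta>\<bar> powr (-3/4))" "2*pi" "pi/2"]
    by (simp add: sin_add)
  have bd: "ang \<theta> \<le> 2 * ennreal (\<bar>cos \<theta>\<bar> powr (-3/4)) + 2 * ennreal (\<bar>sin \<theta>\<bar> powr (-3/4))" for \<theta>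
  proof -
    have h: "x powr p \<le> 2" if "1/2 \<le> x" "-1 \<le> p" "p \<le> 0" for x p :: real
    proof -
      have "x powr p \<le> (1/2) powr p" using that by (intro powr_mono2') auto
      also have "\<dots> = 2 powr (-p)" by (simp add: powr_divide powr_minus_divide)
      also have "\<dots> \<le> 2 powr 1" using that by (intro powr_mono) auto
      finally show ?thesis by simp
    qed
    have "\<bar>cos \<theta>\<bar> powr (-1/2) * \<bar>sin \<theta>\<bar> powr (-3/4) \<le> 2 * \<bar>cos \<theta>\<bar> powr (-3/4) + 2 * \<bar>sin \<theta>\<bar> powr (-3/4)"
    proof (cases "1/2 \<le> \<bar>cos \<theta>\<bar>")
      case True
      have "\<bar>cos \<theta>\<bar> powr (-1/2) * \<bar>sin \<theta>\<bar> powr (-3/4) \<le> 2 * \<bar>sin \<theta>\<bar> powr (-3/4)"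
        using h[OF True, of "-1/2"] by (intro mult_right_mono) auto
      then show ?thesis by (simp add: add_increasing)
    next
      case False
      have "1/2 \<le> \<bar>sin \<theta>\<bar>"
      proof (rule ccontr)
        assume "\<not> ?thesis"
        then have "(\<bar>sin \<theta>\<bar>)\<^sup>2 + (\<bar>cos \<theta>\<bar>)\<^sup>2 < (1/2)\<^sup>2 + (1/2)\<^sup>2"
          using False by (intro add_strict_mono power_strict_mono) auto
        then show False by (simp add: power2_eq_square[of "1/2::real"])
      qed
      then have s: "\<bar>sin \<theta>\<bar> powr (-3/4) \<le> 2" by (intro h) auto
      have "\<bar>cos \<theta>\<bar> powr (-1/2) \<le> \<bar>cos \<theta>\<bar> powr (-3/4)"
        by (cases "cos \<theta> = 0") (auto intro!: powr_mono')
      then have "\<bar>cos \<theta>\<bar> powr (-1/2) * \<bar>sin \<theta>\<bar> powr (-3/4) \<le> \<bar>cos \<theta>\<bar> powr (-3/4) * 2"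
        using s by (intro mult_mono) auto
      then show ?thesis by (simp add: add_increasing2)
    qed
    then have "ang \<theta> \<le> ennreal (2 * \<bar>cos \<theta>\<bar> powr (-3/4) + 2 * \<bar>sin \<theta>\<bar> powr (-3/4))"
      unfolding ang_def by (rule ennreal_leI)
    then show ?thesis by (simp add: ennreal_mult)
  qed
  have "(\<integral>\<^sup>+\<theta>\<in>{0..2*pi}. ang \<theta> \<partial>lborel)
    \<le> (\<integral>\<^sup>+\<theta>. 2 * (ennreal (\<bar>cos \<theta>\<bar> powr (-3/4)) * indicator {0..2*pi} \<theta>)
        + 2 * (ennreal (\<bar>sin \<theta>\<bar> powr (-3/4)) * indicator {0..2*pi} \<theta>) \<partial>lborel)"
    using bd by (intro nn_integral_mono) (auto split: split_indicator)
  also have "\<dots> = 2 * (\<integral>\<^sup>+\<theta>\<in>{0..2*pi}. ennreal (\<bar>cos \<theta>\<bar> powr (-3/4)) \<partial>lborel)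
      + 2 * (\<integral>\<^sup>+\<theta>\<in>{0..2*pi}. ennreal (\<bar>sin \<theta>\<bar> powr (-3/4)) \<partial>lborel)"
    by (subst nn_integral_add) (auto simp: nn_integral_cmult)
  also have "\<dots> < top"
    unfolding c using sin_powr_integrable by (simp add: ennreal_mult_less_top)
  finally show ?thesis .
qed

text \<open>The excluded angles are those at which one of the linear maps from z to an outgoing
  velocity degenerates.\<close>

lemma AE_angle: "AE \<theta> in lborel. cos \<theta> \<noteq> 0 \<and> sin \<theta> \<noteq> (0::real)"
proof -
  have "countable {x :: real. sin x = 0}" "countable {x :: real. cos x = 0}"
  proof -
    have "{x :: real. sin x = 0} \<subseteq> range (\<lambda>i::int. of_int i * pi)"
      by (auto simp: sin_zero_iff_int2)
    then show "countable {x :: real. sin x = 0}" by (rule countable_subset) auto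
    have "{x :: real. cos x = 0} \<subseteq> range (\<lambda>i::int. of_int i * (pi/2))"
      by (auto simp: cos_zero_iff_int)
    then show "countable {x :: real. cos x = 0}" by (rule countable_subset) auto
  qed
  then have "{x :: real. sin x = 0} \<union> {x. cos x = 0} \<in> null_sets lborel"
    by (intro countable_imp_null_set_lborel) auto
  then show ?thesis by (rule AE_I') auto
qed

section \<open>The gain operator at a fixed point in space\<close>

text \<open>The integrand is rewritten as (pq)^\<alpha> (hp)^\<beta> (hq)^\<gamma> and Hoelder's
  inequality is applied to these products of pairs. Any two of the velocity v and the two outgoing
  velocities are independent linear coordinates, so each pair integral factorises, with factor 1,
  1/cos^2 or 1/sin^2.\<close>

lemma collision_trilinear:
  fixes p q h :: "R2 \<Rightarrow> ennreal"
  assumes [measurable]: "p \<in> borel_measurable borel" "q \<in> borel_measurable borel" "h \<in> borel_measurable borel"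
    and e: "0 < \<alpha>" "0 < \<beta>" "0 < \<gamma>" "\<alpha> + \<beta> + \<gamma> = 1"
    and c: "cos \<theta> \<noteq> 0" and s: "sin \<theta> \<noteq> 0"
  shows "(\<integral>\<^sup>+v. \<integral>\<^sup>+z. ennpowr (h v) (\<beta> + \<gamma>) * ennpowr (p (v + cos \<theta> *\<^sub>R rot \<theta> z)) (\<alpha> + \<beta>)
      * ennpowr (q (v + (- sin \<theta>) *\<^sub>R rot (\<theta> + pi/2) z)) (\<alpha> + \<gamma>) \<partial>lborel \<partial>lborel)
    \<le> ennreal (\<bar>cos \<theta>\<bar> powr (-2*\<beta>) * \<bar>sin \<theta>\<bar> powr (-2*\<gamma>))
      * (ennpowr (\<integral>\<^sup>+v. h v \<partial>lborel) (\<beta> + \<gamma>) * ennpowr (\<integral>\<^sup>+v. p v \<partial>lborel) (\<alpha> + \<beta>) * ennpowr (\<integral>\<^sup>+v. q v \<partial>lborel) (\<alpha> + \<gamma>))"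
proof -
  let ?x = "\<lambda>v z. v + cos \<theta> *\<^sub>R rot \<theta> z" and ?y = "\<lambda>v z. v + (- sin \<theta>) *\<^sub>R rot (\<theta> + pi/2) z"
  let ?h = "\<integral>\<^sup>+v. h v \<partial>lborel" and ?p = "\<integral>\<^sup>+v. p v \<partial>lborel" and ?q = "\<integral>\<^sup>+v. q v \<partial>lborel"
  have "(\<integral>\<^sup>+v. \<integral>\<^sup>+z. ennpowr (h v) (\<beta> + \<gamma>) * ennpowr (p (?x v z)) (\<alpha> + \<beta>) * ennpowr (q (?y v z)) (\<alpha> + \<gamma>) \<partial>lborel \<partial>lborel)
    = (\<integral>\<^sup>+w. ennpowr (h (fst w)) (\<beta> + \<gamma>) * ennpowr (p (?x (fst w) (snd w))) (\<alpha> + \<beta>) * ennpowr (q (?y (fst w) (snd w))) (\<alpha> + \<gamma>) \<partial>lborel)"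
    by (subst nn_integral_lborel_pair) auto
  also have "\<dots> = (\<integral>\<^sup>+w. ennpowr (p (?x (fst w) (snd w)) * q (?y (fst w) (snd w))) \<alpha>
      * ennpowr (h (fst w) * p (?x (fst w) (snd w))) \<beta> * ennpowr (h (fst w) * q (?y (fst w) (snd w))) \<gamma> \<partial>lborel)"
    using e by (intro nn_integral_cong) (simp add: ennpowr_mult ennpowr_add[symmetric] ac_simps)
  also have "\<dots> \<le> ennpowr (\<integral>\<^sup>+w. p (?x (fst w) (snd w)) * q (?y (fst w) (snd w)) \<partial>lborel) \<alpha>
      * ennpowr (\<integral>\<^sup>+w. h (fst w) * p (?x (fst w) (snd w)) \<partial>lborel) \<beta>
      * ennpowr (\<integral>\<^sup>+w. h (fst w) * q (?y (fst w) (snd w)) \<partial>lborel) \<gamma>"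
    using e by (intro nn_integral_Holder3) auto
  also have "(\<integral>\<^sup>+w. p (?x (fst w) (snd w)) * q (?y (fst w) (snd w)) \<partial>lborel) = ?p * ?q"
  proof -
    \<comment> \<open>The two outgoing velocities differ by z turned by 2\<theta> and reversed: a
      translation in v followed by this isometry in z separates p from q.\<close>
    have y: "?y v z = ?x v z + (- 1) *\<^sub>R rot \<theta> (rot \<theta> z)" for v z
      by (simp add: R2_eq_iff rot_def cos_add sin_add algebra_simps cos_mult_self cos_mult_self')
    have "(\<integral>\<^sup>+w. p (?x (fst w) (snd w)) * q (?y (fst w) (snd w)) \<partial>lborel)
      = (\<integral>\<^sup>+v. \<integral>\<^sup>+z. p (?x v z) * q (?y v z) \<partial>lborel \<partial>lborel)"
      by (subst nn_integral_lborel_pair) auto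
    also have "\<dots> = (\<integral>\<^sup>+z. \<integral>\<^sup>+v. p (?x v z) * q (?y v z) \<partial>lborel \<partial>lborel)"
      by (rule lborel_Fubini[symmetric]) measurable
    also have "\<dots> = (\<integral>\<^sup>+z. \<integral>\<^sup>+v. p v * q (v + (- 1) *\<^sub>R rot \<theta> (rot \<theta> z)) \<partial>lborel \<partial>lborel)"
      unfolding y
      by (intro nn_integral_cong nn_integral_lborel_shift[of "\<lambda>v. p v * q (v + (- 1) *\<^sub>R rot \<theta> (rot \<theta> _))"]) measurable
    also have "\<dots> = (\<integral>\<^sup>+v. \<integral>\<^sup>+z. p v * q (v + (- 1) *\<^sub>R rot \<theta> (rot \<theta> z)) \<partial>lborel \<partial>lborel)"
      by (rule lborel_Fubini) measurable
    also have "\<dots> = (\<integral>\<^sup>+v. p v * (\<integral>\<^sup>+z. q (v + (- 1) *\<^sub>R rot \<theta> (1 *\<^sub>R rot \<theta> z)) \<partial>lborel) \<partial>lborel)"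
      by (simp add: nn_integral_cmult)
    also have "\<dots> = (\<integral>\<^sup>+v. p v * ?q \<partial>lborel)"
      by (subst nn_integral_rot[of "\<lambda>z. q (_ + (- 1) *\<^sub>R rot \<theta> z)" 1 \<theta>]; (measurable; fail)?; (simp; fail)?)
        (subst nn_integral_rot_shift, auto)
    finally show ?thesis by (simp add: nn_integral_multc)
  qed
  also have "(\<integral>\<^sup>+w. h (fst w) * p (?x (fst w) (snd w)) \<partial>lborel) = ennreal (1/(cos \<theta>)\<^sup>2) * (?h * ?p)"
  proof -
    have "(\<integral>\<^sup>+w. h (fst w) * p (?x (fst w) (snd w)) \<partial>lborel)
      = (\<integral>\<^sup>+v. h v * (\<integral>\<^sup>+z. p (?x v z) \<partial>lborel) \<partial>lborel)"
      by (subst nn_integral_lborel_pair) (auto simp: nn_integral_cmult)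
    also have "\<dots> = (\<integral>\<^sup>+v. h v * (ennreal (1/(cos \<theta>)\<^sup>2) * ?p) \<partial>lborel)"
      using c by (subst nn_integral_rot_shift) auto
    finally show ?thesis by (simp add: nn_integral_multc mult.left_commute)
  qed
  also have "(\<integral>\<^sup>+w. h (fst w) * q (?y (fst w) (snd w)) \<partial>lborel) = ennreal (1/(sin \<theta>)\<^sup>2) * (?h * ?q)"
  proof -
    have "(\<integral>\<^sup>+w. h (fst w) * q (?y (fst w) (snd w)) \<partial>lborel)
      = (\<integral>\<^sup>+v. h v * (\<integral>\<^sup>+z. q (?y v z) \<partial>lborel) \<partial>lborel)"
      by (subst nn_integral_lborel_pair) (auto simp: nn_integral_cmult)
    also have "\<dots> = (\<integral>\<^sup>+v. h v * (ennreal (1/(sin \<theta>)\<^sup>2) * ?q) \<partial>lborel)"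
      using s by (subst nn_integral_rot_shift) auto
    finally show ?thesis by (simp add: nn_integral_multc mult.left_commute)
  qed
  also have "ennpowr (?p * ?q) \<alpha> * ennpowr (ennreal (1/(cos \<theta>)\<^sup>2) * (?h * ?p)) \<beta> * ennpowr (ennreal (1/(sin \<theta>)\<^sup>2) * (?h * ?q)) \<gamma>
    = (ennpowr (ennreal (1/(cos \<theta>)\<^sup>2)) \<beta> * ennpowr (ennreal (1/(sin \<theta>)\<^sup>2)) \<gamma>) *
      (ennpowr ?h (\<beta> + \<gamma>) * ennpowr ?p (\<alpha> + \<beta>) * ennpowr ?q (\<alpha> + \<gamma>))"
    using e by (simp add: ennpowr_mult ennpowr_add[symmetric] ac_simps)
  also have "ennpowr (ennreal (1/(cos \<theta>)\<^sup>2)) \<beta> * ennpowr (ennreal (1/(sin \<theta>)\<^sup>2)) \<gamma>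
    = ennreal (\<bar>cos \<theta>\<bar> powr (-2*\<beta>) * \<bar>sin \<theta>\<bar> powr (-2*\<gamma>))"
  proof -
    have *: "(1 / x\<^sup>2) powr r = \<bar>x\<bar> powr (-2*r)" if "x \<noteq> 0" for x r :: real
    proof -
      have "1 / x\<^sup>2 = \<bar>x\<bar> powr (-2)" using that by (simp add: powr_minus_divide)
      then show ?thesis by (simp add: powr_powr)
    qed
    show ?thesis using c s by (simp add: ennpowr_ennreal * flip: ennreal_mult)
  qed
  finally show ?thesis .
qed

text \<open>The factor 3 is 2 + 1 from the two terms of \<open>jw_collision\<close>; the last factor
  is the L^4 norm of \<langle>v\<rangle>^(-a), finite because 4a > 2.\<close>

definition coll_const :: "real \<Rightarrow> ennreal"
  where "coll_const a = 3 * (\<integral>\<^sup>+\<theta>\<in>{0..2*pi}. ang \<theta> \<partial>lborel) * ennpowr (\<integral>\<^sup>+u. jw (-(4*a)) u \<partial>lborel) (1/4)"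

lemma coll_const_finite: "1/2 < a \<Longrightarrow> coll_const a < top"
  using ang_integrable jw_integrable[of "4*a"] 
  by (simp add: coll_const_def ennreal_mult_less_top ennpowr_less_top_iff)

text \<open>Here \<open>X\<close>, \<open>Y\<close> are the weights at the two outgoing velocities
  and \<open>A\<close>, \<open>B\<close> their inverses. In each term of the bound for
  \<open>J\<close> one weight cancels against its inverse, and the other particle keeps its decaying
  weight.\<close>

lemma collision_split:
  fixes X A Y B H W F J \<kappa> :: ennreal
  assumes "X * A = 1" "Y * B = 1" "J \<le> 2 * X + \<kappa> * Y"
  shows "H * J * (A * W * (B * F)) \<le> 2 * (H * W * (B * F)) + \<kappa> * (H * (A * W) * F)"
proof -
  have "H * J * (A * W * (B * F)) \<le> H * (2 * X + \<kappa> * Y) * (A * W * (B * F))"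
    using assms by (intro mult_right_mono mult_left_mono) auto
  also have "\<dots> = 2 * (X * A) * (H * W * (B * F)) + \<kappa> * (Y * B) * (H * (A * W) * F)"
    by (simp add: algebra_simps)
  finally show ?thesis using assms by simp
qed

text \<open>The weight at v is distributed over the outgoing velocities. The decaying weight that
  survives lies in L^4 and lowers either F from L^2 to L^(4/3) or W from L^(8/5) to L^(8/7). In both
  cases the reciprocal exponents then sum to 2, as \<open>collision_trilinear\<close> demands: 5/8 +
  5/8 + 3/4 and 5/8 + 7/8 + 1/2.\<close>

theorem collision_estimate:
  fixes W F H :: "R2 \<Rightarrow> ennreal"
  assumes [measurable]: "W \<in> borel_measurable borel" "F \<in> borel_measurable borel" "H \<in> borel_measurable borel"
    and a: "1/2 < a" "a \<le> 1"
  shows "(\<integral>\<^sup>+v. H v * jw a v * nQ (\<lambda>v. jw (-a) v * W v) (\<lambda>v. jw (-a) v * F v) v \<partial>lborel)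
    \<le> coll_const a * (ennpowr (\<integral>\<^sup>+v. ennpowr (H v) (8/5) \<partial>lborel) (5/8) * ennpowr (\<integral>\<^sup>+v. ennpowr (W v) (8/5) \<partial>lborel) (5/8)
      * ennpowr (\<integral>\<^sup>+v. (F v)\<^sup>2 \<partial>lborel) (1/2))"
proof -
  let ?x = "\<lambda>\<theta> v z. v + cos \<theta> *\<^sub>R rot \<theta> z" and ?y = "\<lambda>\<theta> v z. v + (- sin \<theta>) *\<^sub>R rot (\<theta> + pi/2) z"
  define J where "J = jw (-a)"
  have [measurable]: "J \<in> borel_measurable borel" unfolding J_def by measurable
  define K where "K = (\<integral>\<^sup>+u. jw (-(4*a)) u \<partial>(lborel :: R2 measure))"
  define h where "h = (\<integral>\<^sup>+v. ennpowr (H v) (8/5) \<partial>lborel)"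
  define w where "w = (\<integral>\<^sup>+v. ennpowr (W v) (8/5) \<partial>lborel)"
  define f where "f = (\<integral>\<^sup>+v. (F v)\<^sup>2 \<partial>lborel)"
  define N where "N = ennpowr K (1/4) * (ennpowr h (5/8) * ennpowr w (5/8) * ennpowr f (1/2))"
  have J4: "ennpowr (J v) 4 = jw (-(4*a)) v" for v
    by (simp add: J_def jw_pow mult.commute)
  have Fest: "ennpowr (\<integral>\<^sup>+v. ennpowr (J v * F v) (4/3) \<partial>lborel) (3/4) \<le> ennpowr K (1/4) * ennpowr f (1/2)"
  proof -
    have "(\<integral>\<^sup>+v. ennpowr (J v * F v) (4/3) \<partial>lborel) = (\<integral>\<^sup>+v. ennpowr (ennpowr (J v) 4) (1/3) * ennpowr ((F v)\<^sup>2) (2/3) \<partial>lborel)"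
      by (simp add: ennpowr_mult ennpowr_ennpowr flip: ennpowr_2)
    also have "\<dots> \<le> ennpowr (\<integral>\<^sup>+v. ennpowr (J v) 4 \<partial>lborel) (1/3) * ennpowr f (2/3)"
      unfolding f_def by (intro nn_integral_Holder2) auto
    also have "\<dots> = ennpowr K (1/3) * ennpowr f (2/3)"
      by (simp add: J4 K_def)
    finally have "ennpowr (\<integral>\<^sup>+v. ennpowr (J v * F v) (4/3) \<partial>lborel) (3/4) \<le> ennpowr (ennpowr K (1/3) * ennpowr f (2/3)) (3/4)"
      by (intro ennpowr_mono) auto
    then show ?thesis by (simp add: ennpowr_mult ennpowr_ennpowr)
  qed
  have West: "ennpowr (\<integral>\<^sup>+v. ennpowr (J v * W v) (8/7) \<partial>lborel) (7/8) \<le> ennpowr K (1/4) * ennpowr w (5/8)"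
  proof -
    have "(\<integral>\<^sup>+v. ennpowr (J v * W v) (8/7) \<partial>lborel) = (\<integral>\<^sup>+v. ennpowr (ennpowr (J v) 4) (2/7) * ennpowr (ennpowr (W v) (8/5)) (5/7) \<partial>lborel)"
      by (simp add: ennpowr_mult ennpowr_ennpowr)
    also have "\<dots> \<le> ennpowr (\<integral>\<^sup>+v. ennpowr (J v) 4 \<partial>lborel) (2/7) * ennpowr w (5/7)"
      unfolding w_def by (intro nn_integral_Holder2) auto
    also have "\<dots> = ennpowr K (2/7) * ennpowr w (5/7)"
      by (simp add: J4 K_def)
    finally have "ennpowr (\<integral>\<^sup>+v. ennpowr (J v * W v) (8/7) \<partial>lborel) (7/8) \<le> ennpowr (ennpowr K (2/7) * ennpowr w (5/7)) (7/8)"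
      by (intro ennpowr_mono) auto
    then show ?thesis by (simp add: ennpowr_mult ennpowr_ennpowr)
  qed
  have angle: "(\<integral>\<^sup>+v. \<integral>\<^sup>+z. H v * jw a v * (J (?x \<theta> v z) * W (?x \<theta> v z) * (J (?y \<theta> v z) * F (?y \<theta> v z))) \<partial>lborel \<partial>lborel)
      \<le> 3 * (ang \<theta> * N)" if c: "cos \<theta> \<noteq> 0" and s: "sin \<theta> \<noteq> 0" for \<theta>
  proof -
    let ?\<kappa> = "ennreal (\<bar>cos \<theta>\<bar> powr a)"
    let ?I1 = "(\<integral>\<^sup>+v. \<integral>\<^sup>+z. H v * W (?x \<theta> v z) * (J (?y \<theta> v z) * F (?y \<theta> v z)) \<partial>lborel \<partial>lborel)"
    let ?I2 = "(\<integral>\<^sup>+v. \<integral>\<^sup>+z. H v * (J (?x \<theta> v z) * W (?x \<theta> v z)) * F (?y \<theta> v z) \<partial>lborel \<partial>lborel)"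
    have "(\<integral>\<^sup>+v. \<integral>\<^sup>+z. H v * jw a v * (J (?x \<theta> v z) * W (?x \<theta> v z) * (J (?y \<theta> v z) * F (?y \<theta> v z))) \<partial>lborel \<partial>lborel)
      \<le> (\<integral>\<^sup>+v. \<integral>\<^sup>+z. 2 * (H v * W (?x \<theta> v z) * (J (?y \<theta> v z) * F (?y \<theta> v z)))
         + ?\<kappa> * (H v * (J (?x \<theta> v z) * W (?x \<theta> v z)) * F (?y \<theta> v z)) \<partial>lborel \<partial>lborel)"
      using a unfolding J_def
      by (intro nn_integral_mono collision_split[OF jw_cancel(1) jw_cancel(1) jw_collision]) simp_all
    also have "\<dots> = 2 * ?I1 + ?\<kappa> * ?I2"
      by (simp add: nn_integral_add nn_integral_cmult)
    finally have main: "(\<integral>\<^sup>+v. \<integral>\<^sup>+z. H v * jw a v * (J (?x \<theta> v z) * W (?x \<theta> v z) * (J (?y \<theta> v z) * F (?y \<theta> v z))) \<partial>lborel \<partial>lborel)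
      \<le> 2 * ?I1 + ?\<kappa> * ?I2" .
    have i1: "?I1 \<le> ang \<theta> * N"
    proof -
      \<comment> \<open>The conditions \<beta> + \<gamma> = 5/8, \<alpha> + \<beta> = 5/8, \<alpha>
        + \<gamma> = 3/4 determine the exponents 3/8, 1/4, 3/8.\<close>
      have "?I1 \<le> ennreal (\<bar>cos \<theta>\<bar> powr (-2*(1/4)) * \<bar>sin \<theta>\<bar> powr (-2*(3/8)))
        * (ennpowr h (1/4 + 3/8) * ennpowr w (3/8 + 1/4) * ennpowr (\<integral>\<^sup>+v. ennpowr (J v * F v) (4/3) \<partial>lborel) (3/8 + 3/8))"
        using collision_trilinear[of "\<lambda>v. ennpowr (W v) (8/5)" "\<lambda>v. ennpowr (J v * F v) (4/3)" "\<lambda>v. ennpowr (H v) (8/5)" "3/8" "1/4" "3/8" \<theta>] c s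
        by (simp add: ennpowr_ennpowr h_def w_def)
      also have "\<dots> \<le> ang \<theta> * (ennpowr h (5/8) * ennpowr w (5/8) * (ennpowr K (1/4) * ennpowr f (1/2)))"
        using Fest by (simp add: ang_def mult_left_mono)
      finally show ?thesis by (simp add: N_def ac_simps)
    qed
    have i2: "?\<kappa> * ?I2 \<le> ang \<theta> * N"
    proof -
      \<comment> \<open>Now \<beta> + \<gamma> = 5/8, \<alpha> + \<beta> = 7/8, \<alpha> + \<gamma>
        = 1/2, hence 3/8, 1/2, 1/8. The resulting 1/|cos \<theta>| is not integrable by
        itself.\<close>
      have "?I2 \<le> ennreal (\<bar>cos \<theta>\<bar> powr (-2*(1/2)) * \<bar>sin \<theta>\<bar> powr (-2*(1/8)))
        * (ennpowr h (1/2 + 1/8) * ennpowr (\<integral>\<^sup>+v. ennpowr (J v * W v) (8/7) \<partial>lborel) (3/8 + 1/2) * ennpowr f (3/8 + 1/8))"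
        using collision_trilinear[of "\<lambda>v. ennpowr (J v * W v) (8/7)" "\<lambda>v. (F v)\<^sup>2" "\<lambda>v. ennpowr (H v) (8/5)" "3/8" "1/2" "1/8" \<theta>] c s
        by (simp add: ennpowr_ennpowr ennpowr_half_sq h_def f_def)
      also have "\<dots> \<le> ennreal (\<bar>cos \<theta>\<bar> powr (-1) * \<bar>sin \<theta>\<bar> powr (-1/4)) * (ennpowr h (5/8) * (ennpowr K (1/4) * ennpowr w (5/8)) * ennpowr f (1/2))"
        using West by (simp add: mult_left_mono mult_right_mono)
      also have "\<dots> = ennreal (\<bar>cos \<theta>\<bar> powr (-1) * \<bar>sin \<theta>\<bar> powr (-1/4)) * N"
        by (simp add: N_def ac_simps)
      finally have "?\<kappa> * ?I2 \<le> ?\<kappa> * (ennreal (\<bar>cos \<theta>\<bar> powr (-1) * \<bar>sin \<theta>\<bar> powr (-1/4)) * N)"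
        by (rule mult_left_mono) simp
      also have "\<dots> = ennreal (\<bar>cos \<theta>\<bar> powr a * (\<bar>cos \<theta>\<bar> powr (-1) * \<bar>sin \<theta>\<bar> powr (-1/4))) * N"
        by (simp only: ennreal_mult[OF powr_ge_zero mult_nonneg_nonneg[OF powr_ge_zero powr_ge_zero]] mult.assoc)
      also have "\<dots> \<le> ang \<theta> * N"
      proof (intro mult_right_mono)
        \<comment> \<open>The factor |cos \<theta>|^a from the weight restores integrability: a - 1
          > -1/2.\<close>
        have "\<bar>cos \<theta>\<bar> powr a * \<bar>cos \<theta>\<bar> powr (-1) \<le> \<bar>cos \<theta>\<bar> powr (-1/2)"
          using a c powr_add[of "\<bar>cos \<theta>\<bar>" a "-1", symmetric] by (auto intro!: powr_mono')
        moreover have "\<bar>sin \<theta>\<bar> powr (-1/4) \<le> \<bar>sin \<theta>\<bar> powr (-3/4)"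
          using s by (intro powr_mono') auto
        ultimately have "(\<bar>cos \<theta>\<bar> powr a * \<bar>cos \<theta>\<bar> powr (-1)) * \<bar>sin \<theta>\<bar> powr (-1/4) \<le> \<bar>cos \<theta>\<bar> powr (-1/2) * \<bar>sin \<theta>\<bar> powr (-3/4)"
          by (intro mult_mono) auto
        then show "ennreal (\<bar>cos \<theta>\<bar> powr a * (\<bar>cos \<theta>\<bar> powr (-1) * \<bar>sin \<theta>\<bar> powr (-1/4))) \<le> ang \<theta>"
          by (simp only: ang_def mult.assoc ennreal_leI)
      qed simp
      finally show ?thesis .
    qed
    note main
    also have "2 * ?I1 + ?\<kappa> * ?I2 \<le> 2 * (ang \<theta> * N) + ang \<theta> * N"
      by (intro add_mono mult_left_mono i1 i2) simp
    also have "\<dots> = (2 + 1) * (ang \<theta> * N)"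
      by (simp only: distrib_right mult_1)
    finally show ?thesis by simp
  qed
  have "(\<integral>\<^sup>+v. H v * jw a v * nQ (\<lambda>v. jw (-a) v * W v) (\<lambda>v. jw (-a) v * F v) v \<partial>lborel)
    = (\<integral>\<^sup>+v. \<integral>\<^sup>+\<theta>. (\<integral>\<^sup>+z. H v * jw a v * (J (?x \<theta> v z) * W (?x \<theta> v z) * (J (?y \<theta> v z) * F (?y \<theta> v z))) \<partial>lborel)
        * indicator {0..2*pi} \<theta> \<partial>lborel \<partial>lborel)"
    by (subst nQ_relative) (auto simp: J_def nn_integral_cmult mult.assoc intro!: nn_integral_cong)
  also have "\<dots> = (\<integral>\<^sup>+\<theta>. \<integral>\<^sup>+v. (\<integral>\<^sup>+z. H v * jw a v * (J (?x \<theta> v z) * W (?x \<theta> v z) * (J (?y \<theta> v z) * F (?y \<theta> v z))) \<partial>lborel)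
        * indicator {0..2*pi} \<theta> \<partial>lborel \<partial>lborel)"
    by (rule lborel_Fubini[symmetric]) measurable
  also have "\<dots> \<le> (\<integral>\<^sup>+\<theta>. (3 * (ang \<theta> * N)) * indicator {0..2*pi} \<theta> \<partial>lborel)"
  proof (rule nn_integral_mono_AE)
    show "AE \<theta> in lborel. (\<integral>\<^sup>+v. (\<integral>\<^sup>+z. H v * jw a v * (J (?x \<theta> v z) * W (?x \<theta> v z) * (J (?y \<theta> v z) * F (?y \<theta> v z))) \<partial>lborel)
        * indicator {0..2*pi} \<theta> \<partial>lborel) \<le> (3 * (ang \<theta> * N)) * indicator {0..2*pi} \<theta>"
      using AE_angle
      by eventually_elim (use angle in \<open>auto simp: nn_integral_multc intro!: mult_right_mono\<close>)
  qed
  also have "\<dots> = 3 * (\<integral>\<^sup>+\<theta>\<in>{0..2*pi}. ang \<theta> \<partial>lborel) * N"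
  proof -
    have "(\<integral>\<^sup>+\<theta>. (3 * (ang \<theta> * N)) * indicator {0..2*pi} \<theta> \<partial>lborel) = (\<integral>\<^sup>+\<theta>. (3 * N) * (ang \<theta> * indicator {0..2*pi} \<theta>) \<partial>lborel)"
      by (simp add: ac_simps)
    also have "\<dots> = (3 * N) * (\<integral>\<^sup>+\<theta>\<in>{0..2*pi}. ang \<theta> \<partial>lborel)"
      by (rule nn_integral_cmult) measurable
    finally show ?thesis by (simp only: ac_simps)
  qed
  finally show ?thesis
    by (simp add: N_def K_def h_def w_def f_def coll_const_def ac_simps)
qed

section \<open>Dispersion and Strichartz estimates\<close>

lemma nn_integral_transport_pair:
  fixes f :: "R2 \<times> R2 \<Rightarrow> ennreal"
  assumes [measurable]: "f \<in> borel_measurable borel"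
  shows "(\<integral>\<^sup>+z. f (fst z + t *\<^sub>R snd z, snd z) \<partial>lborel) = (\<integral>\<^sup>+z. f z \<partial>lborel)"
  using nn_integral_transport[of f t]
  by (simp add: nn_integral_lborel_pair[of f] nn_integral_lborel_pair[of "\<lambda>z. f (fst z + t *\<^sub>R snd z, snd z)"])

lemma nn_integral_power2:
  fixes f :: "'a \<Rightarrow> ennreal"
  assumes [measurable]: "f \<in> borel_measurable M"
  shows "(\<integral>\<^sup>+t. f t \<partial>M)\<^sup>2 = (\<integral>\<^sup>+t. \<integral>\<^sup>+s. f t * f s \<partial>M \<partial>M)"
  by (simp add: power2_eq_square nn_integral_cmult nn_integral_multc)

text \<open>The flow is moved from A to \<phi> by the measure-preserving change of variables,
  Cauchy-Schwarz is applied on phase space, and the square of the time integral is expanded. Every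
  estimate of transported functions is thereby reduced to the correlation of a test function at two
  times.\<close>

lemma TT_star:
  fixes A :: "R2 \<times> R2 \<Rightarrow> ennreal" and \<phi> :: "real \<times> R2 \<times> R2 \<Rightarrow> ennreal"
  assumes [measurable]: "A \<in> borel_measurable borel" "\<phi> \<in> borel_measurable borel" "I \<in> sets borel"
  shows "(\<integral>\<^sup>+t\<in>I. (\<integral>\<^sup>+z. A (fst z - t *\<^sub>R snd z, snd z) * \<phi> (t, z) \<partial>lborel) \<partial>lborel)
    \<le> ennpowr (\<integral>\<^sup>+z. (A z)\<^sup>2 \<partial>lborel) (1/2) *
      ennpowr (\<integral>\<^sup>+t\<in>I. (\<integral>\<^sup>+s\<in>I. (\<integral>\<^sup>+z. \<phi> (t, z) * \<phi> (s, fst z + (s - t) *\<^sub>R snd z, snd z) \<partial>lborel) \<partial>lborel) \<partial>lborel) (1/2)"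
proof -
  let ?g = "\<lambda>t z. \<phi> (t, fst z + t *\<^sub>R snd z, snd z) * indicator I t"
  have shift: "(\<integral>\<^sup>+z. A (fst z - t *\<^sub>R snd z, snd z) * \<phi> (t, z) \<partial>lborel)
    = (\<integral>\<^sup>+z. A z * \<phi> (t, fst z + t *\<^sub>R snd z, snd z) \<partial>lborel)" for t
    using nn_integral_transport_pair[of "\<lambda>z. A (fst z - t *\<^sub>R snd z, snd z) * \<phi> (t, z)" t] by simp
  have "(\<integral>\<^sup>+t\<in>I. (\<integral>\<^sup>+z. A (fst z - t *\<^sub>R snd z, snd z) * \<phi> (t, z) \<partial>lborel) \<partial>lborel)
    = (\<integral>\<^sup>+t. \<integral>\<^sup>+z. A z * ?g t z \<partial>lborel \<partial>lborel)"
    unfolding shift by (simp add: nn_integral_multc[symmetric] mult.assoc)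
  also have "\<dots> = (\<integral>\<^sup>+z. \<integral>\<^sup>+t. A z * ?g t z \<partial>lborel \<partial>lborel)"
    by (rule lborel_Fubini[symmetric]) measurable
  also have "\<dots> = (\<integral>\<^sup>+z. A z * (\<integral>\<^sup>+t. ?g t z \<partial>lborel) \<partial>lborel)"
    by (simp add: nn_integral_cmult)
  also have "\<dots> \<le> ennpowr (\<integral>\<^sup>+z. (A z)\<^sup>2 \<partial>lborel) (1/2) * ennpowr (\<integral>\<^sup>+z. (\<integral>\<^sup>+t. ?g t z \<partial>lborel)\<^sup>2 \<partial>lborel) (1/2)"
    by (rule nn_integral_Cauchy_Schwarz) measurable
  also have "(\<integral>\<^sup>+z. (\<integral>\<^sup>+t. ?g t z \<partial>lborel)\<^sup>2 \<partial>lborel) = (\<integral>\<^sup>+z. \<integral>\<^sup>+t. \<integral>\<^sup>+s. ?g t z * ?g s z \<partial>lborel \<partial>lborel \<partial>lborel)"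
    by (intro nn_integral_cong nn_integral_power2) measurable
  also have "\<dots> = (\<integral>\<^sup>+t. \<integral>\<^sup>+z. \<integral>\<^sup>+s. ?g t z * ?g s z \<partial>lborel \<partial>lborel \<partial>lborel)"
    by (rule lborel_Fubini) measurable
  also have "\<dots> = (\<integral>\<^sup>+t. \<integral>\<^sup>+s. \<integral>\<^sup>+z. ?g t z * ?g s z \<partial>lborel \<partial>lborel \<partial>lborel)"
    by (intro nn_integral_cong lborel_Fubini) measurable
  also have "\<dots> = (\<integral>\<^sup>+t\<in>I. (\<integral>\<^sup>+s\<in>I. (\<integral>\<^sup>+z. \<phi> (t, z) * \<phi> (s, fst z + (s - t) *\<^sub>R snd z, snd z) \<partial>lborel) \<partial>lborel) \<partial>lborel)"
  proof (rule nn_integral_cong)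
    fix t
    have sh: "(\<integral>\<^sup>+z. \<phi> (t, fst z + t *\<^sub>R snd z, snd z) * \<phi> (s, fst z + s *\<^sub>R snd z, snd z) \<partial>lborel)
      = (\<integral>\<^sup>+z. \<phi> (t, z) * \<phi> (s, fst z + (s - t) *\<^sub>R snd z, snd z) \<partial>lborel)" for s
      using nn_integral_transport_pair[of "\<lambda>z. \<phi> (t, z) * \<phi> (s, fst z + (s - t) *\<^sub>R snd z, snd z)" t]
      by (simp add: algebra_simps)
    have "(\<integral>\<^sup>+s. \<integral>\<^sup>+z. ?g t z * ?g s z \<partial>lborel \<partial>lborel)
      = (\<integral>\<^sup>+s. (\<integral>\<^sup>+z. \<phi> (t, fst z + t *\<^sub>R snd z, snd z) * \<phi> (s, fst z + s *\<^sub>R snd z, snd z) \<partial>lborel) * indicator I s * indicator I t \<partial>lborel)"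
      by (simp add: nn_integral_cmult[symmetric] nn_integral_multc[symmetric] ac_simps)
    then show "(\<integral>\<^sup>+s. \<integral>\<^sup>+z. ?g t z * ?g s z \<partial>lborel \<partial>lborel)
      = (\<integral>\<^sup>+s\<in>I. (\<integral>\<^sup>+z. \<phi> (t, z) * \<phi> (s, fst z + (s - t) *\<^sub>R snd z, snd z) \<partial>lborel) \<partial>lborel) * indicator I t"
      unfolding sh by (simp add: nn_integral_multc)
  qed
  finally show ?thesis .
qed

text \<open>The three factors carry the exponents \<open>3/8, 3/8, 1/4\<close>; in the last one the velocity is the
  only link between the two positions, and substituting it produces the dispersive factor.\<close>

lemma dispersive_estimate:
  fixes \<phi> \<psi> :: "R2 \<times> R2 \<Rightarrow> ennreal" and m n :: "R2 \<Rightarrow> real"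
  assumes [measurable]: "\<phi> \<in> borel_measurable borel" "\<psi> \<in> borel_measurable borel"
      "m \<in> borel_measurable borel" "n \<in> borel_measurable borel"
    and m: "\<And>x. 0 \<le> m x" "\<And>x. (\<integral>\<^sup>+v. ennpowr (\<phi> (x, v)) (8/3) \<partial>lborel) \<le> ennreal (m x)" "\<And>x v. m x = 0 \<Longrightarrow> \<phi> (x, v) = 0"
    and n: "\<And>x. 0 \<le> n x" "\<And>x. (\<integral>\<^sup>+v. ennpowr (\<psi> (x, v)) (8/3) \<partial>lborel) \<le> ennreal (n x)" "\<And>x v. n x = 0 \<Longrightarrow> \<psi> (x, v) = 0"
    and \<tau>: "\<tau> \<noteq> 0"
  shows "(\<integral>\<^sup>+z. \<phi> z * \<psi> (fst z + \<tau> *\<^sub>R snd z, snd z) \<partial>lborel)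
    \<le> ennreal (\<bar>\<tau>\<bar> powr (-1/2)) * (ennpowr (\<integral>\<^sup>+x. ennreal (m x powr (3/5)) \<partial>lborel) (5/8) * ennpowr (\<integral>\<^sup>+x. ennreal (n x powr (3/5)) \<partial>lborel) (5/8))"
proof -
  define M where "M = (\<integral>\<^sup>+x. ennreal (m x powr (3/5)) \<partial>lborel)"
  define N where "N = (\<integral>\<^sup>+x. ennreal (n x powr (3/5)) \<partial>lborel)"
  let ?y = "\<lambda>z. fst z + \<tau> *\<^sub>R snd z"
  \<comment> \<open>Powers of the masses are inserted for free, since (-2/5)(3/8) + (3/5)(1/4) = 0.
    They are chosen so that integrating out the velocity in \<open>?f\<close> gives m^(1 - 2/5) =
    m^(3/5), the same power that appears in \<open>?h\<close>.\<close>
  let ?f = "\<lambda>z. ennpowr (\<phi> z) (8/3) * ennreal (m (fst z) powr (-2/5))"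
  let ?g = "\<lambda>z. ennpowr (\<psi> z) (8/3) * ennreal (n (fst z) powr (-2/5))"
  let ?h = "\<lambda>z. ennreal (m (fst z) powr (3/5)) * ennreal (n (?y z) powr (3/5))"
  have pw: "ennpowr (ennreal (r powr (-2/5))) (3/8) * ennpowr (ennreal (r powr (3/5))) (1/4) = 1" if "0 < r" for r
  proof -
    have "(r powr (-2/5)) powr (3/8) * (r powr (3/5)) powr (1/4) = 1"
      using that unfolding powr_powr powr_add[symmetric] by simp
    then show ?thesis by (simp only: ennpowr_ennreal powr_ge_zero ennreal_mult[symmetric]) simp
  qed
  have pt: "\<phi> z * \<psi> (?y z, snd z) \<le> ennpowr (?f z) (3/8) * ennpowr (?g (?y z, snd z)) (3/8) * ennpowr (?h z) (1/4)" for z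
  proof (cases "m (fst z) = 0 \<or> n (?y z) = 0")
    case True
    then show ?thesis using m(3)[of "fst z" "snd z"] n(3)[of "?y z" "snd z"] by auto
  next
    case False
    then have pos: "0 < m (fst z)" "0 < n (?y z)" using m(1) n(1) by (auto simp: less_le)
    have "ennpowr (?f z) (3/8) * ennpowr (?g (?y z, snd z)) (3/8) * ennpowr (?h z) (1/4)
      = \<phi> z * \<psi> (?y z, snd z) * (ennpowr (ennreal (m (fst z) powr (-2/5))) (3/8) * ennpowr (ennreal (m (fst z) powr (3/5))) (1/4))
        * (ennpowr (ennreal (n (?y z) powr (-2/5))) (3/8) * ennpowr (ennreal (n (?y z) powr (3/5))) (1/4))"
      by (simp add: ennpowr_mult ennpowr_ennpowr ac_simps)
    then show ?thesis unfolding pw[OF pos(1)] pw[OF pos(2)] by simp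
  qed
  have bound: "(\<integral>\<^sup>+z. ennpowr (\<eta> z) (8/3) * ennreal (k (fst z) powr (-2/5)) \<partial>lborel) \<le> (\<integral>\<^sup>+x. ennreal (k x powr (3/5)) \<partial>lborel)"
    if [measurable]: "\<eta> \<in> borel_measurable borel" "k \<in> borel_measurable borel" and k: "\<And>x. 0 \<le> k x" "\<And>x. (\<integral>\<^sup>+v. ennpowr (\<eta> (x, v)) (8/3) \<partial>lborel) \<le> ennreal (k x)"
    for \<eta> :: "R2 \<times> R2 \<Rightarrow> ennreal" and k :: "R2 \<Rightarrow> real"
  proof -
    have "(\<integral>\<^sup>+z. ennpowr (\<eta> z) (8/3) * ennreal (k (fst z) powr (-2/5)) \<partial>lborel)
      = (\<integral>\<^sup>+x. (\<integral>\<^sup>+v. ennpowr (\<eta> (x, v)) (8/3) \<partial>lborel) * ennreal (k x powr (-2/5)) \<partial>lborel)"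
      by (subst nn_integral_lborel_pair) (auto simp: nn_integral_multc)
    also have "\<dots> \<le> (\<integral>\<^sup>+x. ennreal (k x powr (3/5)) \<partial>lborel)"
    proof (rule nn_integral_mono)
      fix x
      have "(\<integral>\<^sup>+v. ennpowr (\<eta> (x, v)) (8/3) \<partial>lborel) * ennreal (k x powr (-2/5)) \<le> ennreal (k x) * ennreal (k x powr (-2/5))"
        using k(2) by (intro mult_right_mono) auto
      also have "\<dots> = ennreal (k x powr (3/5))"
        using k(1)[of x] powr_add[of "k x" 1 "-2/5"] by (simp flip: ennreal_mult)
      finally show "(\<integral>\<^sup>+v. ennpowr (\<eta> (x, v)) (8/3) \<partial>lborel) * ennreal (k x powr (-2/5)) \<le> ennreal (k x powr (3/5))" .
    qed
    finally show ?thesis .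
  qed
  have "(\<integral>\<^sup>+z. \<phi> z * \<psi> (?y z, snd z) \<partial>lborel) \<le> (\<integral>\<^sup>+z. ennpowr (?f z) (3/8) * ennpowr (?g (?y z, snd z)) (3/8) * ennpowr (?h z) (1/4) \<partial>lborel)"
    by (intro nn_integral_mono pt)
  also have "\<dots> \<le> ennpowr (\<integral>\<^sup>+z. ?f z \<partial>lborel) (3/8) * ennpowr (\<integral>\<^sup>+z. ?g (?y z, snd z) \<partial>lborel) (3/8) * ennpowr (\<integral>\<^sup>+z. ?h z \<partial>lborel) (1/4)"
    by (intro nn_integral_Holder3) auto
  also have "(\<integral>\<^sup>+z. ?g (?y z, snd z) \<partial>lborel) = (\<integral>\<^sup>+z. ?g z \<partial>lborel)"
    using nn_integral_transport_pair[of ?g \<tau>] by simp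
  \<comment> \<open>Here \<open>rot 0\<close> is the identity, inserted so that
    \<open>nn_integral_rot_shift\<close> applies with factor \<tau>; the Jacobian 1/\<tau>^2 to the
    power 1/4 is the dispersive decay.\<close>
  also have "(\<integral>\<^sup>+z. ?h z \<partial>lborel) = (\<integral>\<^sup>+x. ennreal (m x powr (3/5)) * (\<integral>\<^sup>+v. ennreal (n (x + \<tau> *\<^sub>R rot 0 v) powr (3/5)) \<partial>lborel) \<partial>lborel)"
    by (subst nn_integral_lborel_pair) (auto simp: nn_integral_cmult rot_def)
  also have "\<dots> = (\<integral>\<^sup>+x. ennreal (m x powr (3/5)) * (ennreal (1 / \<tau>\<^sup>2) * N) \<partial>lborel)"
    using \<tau> unfolding N_def by (subst nn_integral_rot_shift[of "\<lambda>x. ennreal (n x powr (3/5))"]) auto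
  also have "\<dots> = ennreal (1 / \<tau>\<^sup>2) * (M * N)"
    by (simp add: nn_integral_cmult M_def ac_simps)
  also have "ennpowr (\<integral>\<^sup>+z. ?f z \<partial>lborel) (3/8) * ennpowr (\<integral>\<^sup>+z. ?g z \<partial>lborel) (3/8) * ennpowr (ennreal (1 / \<tau>\<^sup>2) * (M * N)) (1/4)
    \<le> ennpowr M (3/8) * ennpowr N (3/8) * ennpowr (ennreal (1 / \<tau>\<^sup>2) * (M * N)) (1/4)"
    unfolding M_def N_def using m n by (intro mult_mono ennpowr_mono bound) auto
  also have "\<dots> = ennpowr (ennreal (1 / \<tau>\<^sup>2)) (1/4) * ((ennpowr M (3/8) * ennpowr M (1/4)) * (ennpowr N (3/8) * ennpowr N (1/4)))"
    by (simp add: ennpowr_mult ac_simps)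
  also have "\<dots> = ennpowr (ennreal (1 / \<tau>\<^sup>2)) (1/4) * (ennpowr M (5/8) * ennpowr N (5/8))"
    by (simp add: ennpowr_add)
  also have "ennpowr (ennreal (1 / \<tau>\<^sup>2)) (1/4) = ennreal (\<bar>\<tau>\<bar> powr (-1/2))"
  proof -
    have "1 / \<tau>\<^sup>2 = \<bar>\<tau>\<bar> powr (-2)" using \<tau> by (simp add: powr_minus_divide)
    then show ?thesis by (simp add: ennpowr_ennreal powr_powr)
  qed
  finally show ?thesis by (simp add: M_def N_def)
qed

text \<open>Either side of t contributes at most the integral of y^(-1/2) over [0, c - b], which is
  2 sqrt (c - b).\<close>

lemma nn_integral_abs_powr:
  assumes t: "b \<le> t" "t \<le> c"
  shows "(\<integral>\<^sup>+s\<in>{b..c}. ennreal (\<bar>s - t\<bar> powr (-1/2)) \<partial>lborel) \<le> ennreal (4 * sqrt (c - b))"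
proof -
  let ?g = "\<lambda>y. ennreal (y powr (-1/2)) * indicator {0..c - b} y"
  have i: "(\<integral>\<^sup>+y. ?g y \<partial>lborel) = ennreal (2 * sqrt (c - b))"
    using nn_integral_powr_0[of "-1/2" "c - b"] t by (simp add: powr_half_sqrt)
  have "(\<integral>\<^sup>+s\<in>{b..c}. ennreal (\<bar>s - t\<bar> powr (-1/2)) \<partial>lborel) \<le> (\<integral>\<^sup>+s. ?g (s + (-t)) + ?g (t + (-1) * s) \<partial>lborel)"
    using t by (intro nn_integral_mono) (auto split: split_indicator simp: abs_if)
  also have "\<dots> = (\<integral>\<^sup>+s. ?g (s + (-t)) \<partial>lborel) + (\<integral>\<^sup>+s. ?g (t + (-1) * s) \<partial>lborel)"
    by (rule nn_integral_add) measurable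
  also have "(\<integral>\<^sup>+s. ?g (t + (-1) * s) \<partial>lborel) = (\<integral>\<^sup>+y. ?g y \<partial>lborel)"
    using nn_integral_real_affine[of ?g "-1" t] by simp
  also have "(\<integral>\<^sup>+s. ?g (s + (-t)) \<partial>lborel) = (\<integral>\<^sup>+y. ?g y \<partial>lborel)"
    by (rule nn_integral_lborel_shift) measurable
  finally show ?thesis
    unfolding i using t by (simp flip: ennreal_plus)
qed

lemma ennreal_two_mult_le: "2 * (x * y) \<le> x\<^sup>2 + (y::ennreal)\<^sup>2"
proof (cases x; cases y)
  fix r s :: real assume "x = ennreal r" "0 \<le> r" "y = ennreal s" "0 \<le> s"
  moreover have "2 * (r * s) \<le> r\<^sup>2 + s\<^sup>2" using sum_squares_bound[of r s] by simp
  ultimately show ?thesis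
    by (simp add: ennreal_power ennreal_leI flip: ennreal_mult ennreal_plus ennreal_numeral)
qed (auto simp: power2_eq_square)

text \<open>Schur's test for a symmetric kernel: 2 f(t) f(s) \<le> f(t)^2 + f(s)^2, and by symmetry
  both squares contribute the same amount.\<close>

lemma double_integral_AMGM:
  fixes f :: "real \<Rightarrow> ennreal" and k :: "real \<Rightarrow> real \<Rightarrow> ennreal"
  assumes [measurable]: "f \<in> borel_measurable borel" "(\<lambda>p. k (fst p) (snd p)) \<in> borel_measurable borel" "I \<in> sets borel"
    and sym: "\<And>t s. k t s = k s t" and K: "\<And>t. t \<in> I \<Longrightarrow> (\<integral>\<^sup>+s\<in>I. k t s \<partial>lborel) \<le> K"
  shows "(\<integral>\<^sup>+t\<in>I. (\<integral>\<^sup>+s\<in>I. k t s * (f t * f s) \<partial>lborel) \<partial>lborel) \<le> K * (\<integral>\<^sup>+t\<in>I. (f t)\<^sup>2 \<partial>lborel)"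
proof -
  let ?S = "\<integral>\<^sup>+t\<in>I. (\<integral>\<^sup>+s\<in>I. k t s * (f t * f s) \<partial>lborel) \<partial>lborel"
  have km [measurable]: "(\<lambda>x. k (g x) (h x)) \<in> borel_measurable M" if [measurable]: "g \<in> borel_measurable M" "h \<in> borel_measurable M" for g h and M :: "(real \<times> real) measure"
    using measurable_compose[OF _ assms(2), of "\<lambda>x. (g x, h x)" M] by simp
  have km1 [measurable]: "(\<lambda>x. k (g x) (h x)) \<in> borel_measurable M" if [measurable]: "g \<in> borel_measurable M" "h \<in> borel_measurable M" for g h and M :: "real measure"
    using measurable_compose[OF _ assms(2), of "\<lambda>x. (g x, h x)" M] by simp
  define D where "D = (\<integral>\<^sup>+t. \<integral>\<^sup>+s. indicator I t * indicator I s * k t s * (f t)\<^sup>2 \<partial>lborel \<partial>lborel)"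
  have D: "D \<le> K * (\<integral>\<^sup>+t\<in>I. (f t)\<^sup>2 \<partial>lborel)"
  proof -
    have "D = (\<integral>\<^sup>+t. indicator I t * (f t)\<^sup>2 * (\<integral>\<^sup>+s\<in>I. k t s \<partial>lborel) \<partial>lborel)"
      unfolding D_def by (simp add: nn_integral_cmult[symmetric] ac_simps)
    also have "\<dots> \<le> (\<integral>\<^sup>+t. indicator I t * (f t)\<^sup>2 * K \<partial>lborel)"
      using K by (intro nn_integral_mono) (auto split: split_indicator intro!: mult_left_mono)
    finally show ?thesis by (simp add: nn_integral_cmult ac_simps)
  qed
  have "2 * ?S = (\<integral>\<^sup>+t. \<integral>\<^sup>+s. indicator I t * indicator I s * k t s * (2 * (f t * f s)) \<partial>lborel \<partial>lborel)"
    by (simp add: nn_integral_cmult[symmetric] nn_integral_multc[symmetric] ac_simps)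
  also have "\<dots> \<le> (\<integral>\<^sup>+t. \<integral>\<^sup>+s. indicator I t * indicator I s * k t s * ((f t)\<^sup>2 + (f s)\<^sup>2) \<partial>lborel \<partial>lborel)"
    by (intro nn_integral_mono mult_left_mono ennreal_two_mult_le) simp
  also have "\<dots> = D + (\<integral>\<^sup>+t. \<integral>\<^sup>+s. indicator I t * indicator I s * k t s * (f s)\<^sup>2 \<partial>lborel \<partial>lborel)"
    unfolding D_def by (simp add: distrib_left nn_integral_add)
  also have "(\<integral>\<^sup>+t. \<integral>\<^sup>+s. indicator I t * indicator I s * k t s * (f s)\<^sup>2 \<partial>lborel \<partial>lborel) = D"
    unfolding D_def by (subst lborel_Fubini) (auto simp: sym[of "_ :: real"] ac_simps intro!: nn_integral_cong)
  also have "D + D = 2 * D" by (simp add: mult_2)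
  finally have "?S \<le> D" by (simp add: ennreal_mult_le_mult_iff)
  with D show ?thesis by simp
qed

section \<open>Strichartz estimate for free transport in mixed norms\<close>

definition vmass :: "(R2 \<times> R2 \<Rightarrow> ennreal) \<Rightarrow> real \<times> R2 \<Rightarrow> ennreal"
  where "vmass A y = (\<integral>\<^sup>+v. ennpowr (A (snd y - fst y *\<^sub>R v, v)) (8/5) \<partial>lborel)"

text \<open>Since (8/5)(5/3) = 8/3, this is the 8/3-th power of the L^(8/3)_x L^(8/5)_v norm of
  \<open>T(t) A\<close>; its power 3/4 is the square of that norm. Keeping powers instead of norms
  avoids roots in the nested integrals.\<close>

definition xmass :: "(R2 \<times> R2 \<Rightarrow> ennreal) \<Rightarrow> real \<Rightarrow> ennreal"
  where "xmass A t = (\<integral>\<^sup>+x. ennpowr (vmass A (t, x)) (5/3) \<partial>lborel)"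

lemma vmass_measurable [measurable]:
  assumes [measurable]: "A \<in> borel_measurable borel"
  shows "vmass A \<in> borel_measurable borel"
  unfolding vmass_def by measurable

lemma xmass_measurable [measurable]:
  assumes [measurable]: "A \<in> borel_measurable borel"
  shows "xmass A \<in> borel_measurable borel"
  unfolding xmass_def by measurable

text \<open>Let X be the squared space-time norm. Pairing \<open>T(t) A\<close> with its own dual
  extremiser gives X, and the dispersive bound for that extremiser gives X \<le> ||A|| (4 sqrt (c -
  b) X)^(1/2) with the L^2 norm of A. Boundedness and bounded support of A serve to make X finite,
  so that it can be divided out.\<close>

lemma strichartz_bounded:
  fixes A :: "R2 \<times> R2 \<Rightarrow> ennreal" and R b c :: real
  assumes [measurable]: "A \<in> borel_measurable borel"
    and A: "\<And>x v. A (x, v) \<le> ennreal R * indicator (cball 0 R) x * indicator (cball 0 R) v"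
    and R: "0 \<le> R" and bc: "0 \<le> b" "b \<le> c"
  shows "(\<integral>\<^sup>+t\<in>{b..c}. ennpowr (xmass A t) (3/4) \<partial>lborel) \<le> ennreal (4 * sqrt (c - b)) * (\<integral>\<^sup>+z. (A z)\<^sup>2 \<partial>lborel)"
proof -
  define K where "K = ennreal (R powr (8/5) * (pi * R\<^sup>2))"
  have Pbd: "vmass A (t, x) \<le> K * indicator (cball 0 (R + \<bar>t\<bar> * R)) x" for t x
  proof (cases "x \<in> cball 0 (R + \<bar>t\<bar> * R)")
    case True
    have "vmass A (t, x) \<le> (\<integral>\<^sup>+v. ennreal (R powr (8/5)) * indicator (cball 0 R) v \<partial>(lborel :: R2 measure))"
      unfolding vmass_def
    proof (rule nn_integral_mono)
      fix v :: R2
      have "ennpowr (A (x - t *\<^sub>R v, v)) (8/5) \<le> ennpowr (ennreal R * indicator (cball 0 R) (x - t *\<^sub>R v) * indicator (cball 0 R) v) (8/5)"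
        by (intro ennpowr_mono A) auto
      also have "\<dots> \<le> ennreal (R powr (8/5)) * indicator (cball 0 R) v"
        using R by (auto split: split_indicator simp: ennpowr_ennreal)
      finally show "ennpowr (A (snd (t, x) - fst (t, x) *\<^sub>R v, v)) (8/5) \<le> ennreal (R powr (8/5)) * indicator (cball 0 R) v"
        by simp
    qed
    also have "\<dots> = K"
      using R by (subst nn_integral_cmult_indicator) (auto simp: K_def emeasure_cball_R2 ennreal_mult)
    finally show ?thesis using True by simp
  next
    case False
    have "A (x - t *\<^sub>R v, v) = 0" for v
    proof (cases "norm v \<le> R \<and> norm (x - t *\<^sub>R v) \<le> R")
      case True
      have "norm x \<le> norm (x - t *\<^sub>R v) + norm (t *\<^sub>R v)"
        using norm_triangle_ineq[of "x - t *\<^sub>R v" "t *\<^sub>R v"] by simp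
      also have "\<dots> \<le> R + \<bar>t\<bar> * R" using True by (auto intro!: add_mono mult_left_mono)
      finally show ?thesis using False by simp
    next
      case F: False
      then show ?thesis using A[of "x - t *\<^sub>R v" v] by (auto split: split_indicator_asm)
    qed
    then show ?thesis by (simp add: vmass_def)
  qed
  have Qbd: "xmass A t \<le> ennpowr K (5/3) * ennreal (pi * (R + \<bar>t\<bar> * R)\<^sup>2)" for t
  proof -
    have "xmass A t \<le> (\<integral>\<^sup>+x. ennpowr K (5/3) * indicator (cball 0 (R + \<bar>t\<bar> * R)) x \<partial>(lborel :: R2 measure))"
      unfolding xmass_def
    proof (rule nn_integral_mono)
      fix x
      have "ennpowr (vmass A (t, x)) (5/3) \<le> ennpowr (K * indicator (cball 0 (R + \<bar>t\<bar> * R)) x) (5/3)"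
        by (intro ennpowr_mono Pbd) auto
      then show "ennpowr (vmass A (t, x)) (5/3) \<le> ennpowr K (5/3) * indicator (cball 0 (R + \<bar>t\<bar> * R)) x"
        by (auto split: split_indicator split_indicator_asm)
    qed
    also have "\<dots> = ennpowr K (5/3) * ennreal (pi * (R + \<bar>t\<bar> * R)\<^sup>2)"
      using R by (subst nn_integral_cmult_indicator) (auto simp: emeasure_cball_R2)
    finally show ?thesis .
  qed
  have Kfin: "K < top" by (simp add: K_def)
  have Pfin: "vmass A y < top" for y
    using order.strict_trans1[OF Pbd[of "fst y" "snd y"]] Kfin by (auto simp: ennreal_mult_less_top split: split_indicator)
  have Qfin: "xmass A t < top" for t
    using order.strict_trans1[OF Qbd[of t]] Kfin by (simp add: ennreal_mult_less_top ennpowr_less_top_iff)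
  define p where "p y = enn2real (vmass A y)" for y
  define q where "q t = enn2real (xmass A t)" for t
  have [measurable]: "p \<in> borel_measurable borel" "q \<in> borel_measurable borel"
    unfolding p_def q_def by measurable
  have p0: "0 \<le> p y" and Pp: "vmass A y = ennreal (p y)" for y
    using Pfin by (simp_all add: p_def)
  have q0: "0 \<le> q t" and Qq: "xmass A t = ennreal (q t)" for t
    using Qfin by (simp_all add: q_def)
  \<comment> \<open>The dual extremiser, with p and q the real values of \<open>vmass\<close> and
    \<open>xmass\<close>. It is scaled so that the pairing with \<open>T(t) A\<close> is q^(3/4),
    while its norm in the dual space L^(8/5)_x L^(8/3)_v is q^(3/8).\<close>
  define \<phi> where "\<phi> w = ennpowr (A (fst (snd w) - fst w *\<^sub>R snd (snd w), snd (snd w))) (3/5)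
      * ennreal (p (fst w, fst (snd w)) powr (2/3) * q (fst w) powr (-1/4))" for w
  define m where "m t x = p (t, x) powr (25/9) * q t powr (-2/3)" for t x
  have [measurable]: "\<phi> \<in> borel_measurable borel" unfolding \<phi>_def by measurable
  have [measurable]: "m t \<in> borel_measurable borel" for t unfolding m_def by measurable
  have m0: "0 \<le> m t x" for t x by (simp add: m_def)
  have mint: "(\<integral>\<^sup>+v. ennpowr (\<phi> (t, x, v)) (8/3) \<partial>lborel) \<le> ennreal (m t x)" for t x
  proof -
    have "(\<integral>\<^sup>+v. ennpowr (\<phi> (t, x, v)) (8/3) \<partial>lborel)
      = (\<integral>\<^sup>+v. ennpowr (A (x - t *\<^sub>R v, v)) (8/5) * ennreal (p (t, x) powr (16/9) * q t powr (-2/3)) \<partial>lborel)"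
      by (simp add: \<phi>_def ennpowr_mult ennpowr_ennpowr ennpowr_ennreal powr_mult powr_powr)
    also have "\<dots> = ennreal (p (t, x)) * ennreal (p (t, x) powr (16/9) * q t powr (-2/3))"
      by (simp add: nn_integral_multc Pp[symmetric]) (simp add: vmass_def)
    also have "\<dots> = ennreal (m t x)"
    proof -
      have "p (t, x) * p (t, x) powr (16/9) = p (t, x) powr (25/9)"
        using p0[of "(t, x)"] powr_add[of "p (t, x)" 1 "16/9"] by simp
      then have "p (t, x) * (p (t, x) powr (16/9) * q t powr (-2/3)) = m t x"
        by (simp add: m_def mult.assoc[symmetric])
      then show ?thesis using p0[of "(t, x)"] by (simp only: ennreal_mult'[symmetric])
    qed
    finally show ?thesis by simp
  qed
  \<comment> \<open>The convention \<open>0 powr r = 0\<close>, also for negative r, makes both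
    functions vanish wherever p or q does.\<close>
  have mz: "\<phi> (t, x, v) = 0" if "m t x = 0" for t x v
    using that by (auto simp: m_def \<phi>_def)
  have Mint: "(\<integral>\<^sup>+x. ennreal (m t x powr (3/5)) \<partial>lborel) = ennreal (q t powr (3/5))" for t
  proof -
    have "(\<integral>\<^sup>+x. ennreal (m t x powr (3/5)) \<partial>lborel) = (\<integral>\<^sup>+x. ennpowr (vmass A (t, x)) (5/3) * ennreal (q t powr (-2/5)) \<partial>lborel)"
      using p0 by (simp add: m_def powr_mult powr_powr Pp ennpowr_ennreal ennreal_mult)
    also have "\<dots> = ennreal (q t) * ennreal (q t powr (-2/5))"
      by (simp add: nn_integral_multc Qq[symmetric]) (simp add: xmass_def)
    also have "\<dots> = ennreal (q t powr (3/5))"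
      using q0[of t] powr_add[of "q t" 1 "-2/5"] by (simp flip: ennreal_mult)
    finally show ?thesis .
  qed
  have pair: "(\<integral>\<^sup>+z. A (fst z - t *\<^sub>R snd z, snd z) * \<phi> (t, z) \<partial>lborel) = ennpowr (xmass A t) (3/4)" for t
  proof -
    have "(\<integral>\<^sup>+z. A (fst z - t *\<^sub>R snd z, snd z) * \<phi> (t, z) \<partial>lborel)
      = (\<integral>\<^sup>+x. \<integral>\<^sup>+v. ennpowr (A (x - t *\<^sub>R v, v)) (8/5) * ennreal (p (t, x) powr (2/3) * q t powr (-1/4)) \<partial>lborel \<partial>lborel)"
    proof -
      have "c * ennpowr c (3/5) = ennpowr c (8/5)" for c
        using ennpowr_add[of 1 "3/5" c] by simp
      then show ?thesis
        by (subst nn_integral_lborel_pair) (auto simp: \<phi>_def mult.assoc[symmetric])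
    qed
    also have "\<dots> = (\<integral>\<^sup>+x. ennreal (p (t, x)) * ennreal (p (t, x) powr (2/3) * q t powr (-1/4)) \<partial>lborel)"
      by (simp add: nn_integral_multc Pp[symmetric]) (simp add: vmass_def)
    also have "\<dots> = (\<integral>\<^sup>+x. ennpowr (vmass A (t, x)) (5/3) * ennreal (q t powr (-1/4)) \<partial>lborel)"
    proof (rule nn_integral_cong)
      fix x
      have "p (t, x) * p (t, x) powr (2/3) = p (t, x) powr (5/3)"
        using p0[of "(t, x)"] powr_add[of "p (t, x)" 1 "2/3"] by simp
      then have "p (t, x) * (p (t, x) powr (2/3) * q t powr (-1/4)) = p (t, x) powr (5/3) * q t powr (-1/4)"
        by (simp add: mult.assoc[symmetric])
      then show "ennreal (p (t, x)) * ennreal (p (t, x) powr (2/3) * q t powr (-1/4)) = ennpowr (vmass A (t, x)) (5/3) * ennreal (q t powr (-1/4))"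
        using p0[of "(t, x)"] by (simp only: ennreal_mult'[symmetric] Pp ennpowr_ennreal powr_ge_zero)
    qed
    also have "\<dots> = ennreal (q t) * ennreal (q t powr (-1/4))"
      by (simp add: nn_integral_multc Qq[symmetric]) (simp add: xmass_def)
    also have "\<dots> = ennpowr (xmass A t) (3/4)"
      using q0[of t] powr_add[of "q t" 1 "-1/4"] by (simp add: Qq ennpowr_ennreal flip: ennreal_mult)
    finally show ?thesis .
  qed
  define X where "X = (\<integral>\<^sup>+t\<in>{b..c}. ennpowr (xmass A t) (3/4) \<partial>lborel)"
  define f where "f t = ennreal (q t powr (3/8))" for t
  have [measurable]: "f \<in> borel_measurable borel" unfolding f_def by measurable
  have f2: "(f t)\<^sup>2 = ennpowr (xmass A t) (3/4)" for t
    using powr_add[of "q t" "3/8" "3/8"] q0[of t]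
    by (simp add: f_def Qq ennpowr_ennreal power2_eq_square flip: ennreal_mult)
  have Xfin: "X < top"
  proof -
    have "X \<le> (\<integral>\<^sup>+t\<in>{b..c}. ennpowr (ennpowr K (5/3) * ennreal (pi * (R + c * R)\<^sup>2)) (3/4) \<partial>lborel)"
      unfolding X_def
    proof (rule nn_integral_mono)
      fix t
      have "xmass A t \<le> ennpowr K (5/3) * ennreal (pi * (R + c * R)\<^sup>2)" if "t \<in> {b..c}"
      proof -
        have "(R + \<bar>t\<bar> * R)\<^sup>2 \<le> (R + c * R)\<^sup>2"
          using that R bc by (intro power_mono add_mono mult_right_mono) auto
        then have "ennpowr K (5/3) * ennreal (pi * (R + \<bar>t\<bar> * R)\<^sup>2) \<le> ennpowr K (5/3) * ennreal (pi * (R + c * R)\<^sup>2)"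
          by (intro mult_left_mono ennreal_leI) auto
        then show ?thesis using Qbd[of t] by (rule order.trans[rotated])
      qed
      then show "ennpowr (xmass A t) (3/4) * indicator {b..c} t \<le> ennpowr (ennpowr K (5/3) * ennreal (pi * (R + c * R)\<^sup>2)) (3/4) * indicator {b..c} t"
        by (auto split: split_indicator intro!: ennpowr_mono)
    qed
    also have "\<dots> = ennpowr (ennpowr K (5/3) * ennreal (pi * (R + c * R)\<^sup>2)) (3/4) * ennreal (c - b)"
      using bc by (subst nn_integral_cmult_indicator) auto
    also have "\<dots> < top"
      using Kfin by (simp add: ennreal_mult_less_top ennpowr_less_top_iff)
    finally show ?thesis .
  qed
  have disp: "(\<integral>\<^sup>+s\<in>{b..c}. (\<integral>\<^sup>+z. \<phi> (t, z) * \<phi> (s, fst z + (s - t) *\<^sub>R snd z, snd z) \<partial>lborel) \<partial>lborel)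
      \<le> (\<integral>\<^sup>+s\<in>{b..c}. ennreal (\<bar>s - t\<bar> powr (-1/2)) * (f t * f s) \<partial>lborel)" for t
  proof (rule nn_integral_mono_AE)
    have "AE s in lborel. s \<noteq> t" by (rule AE_lborel_singleton)
    then show "AE s in lborel. (\<integral>\<^sup>+z. \<phi> (t, z) * \<phi> (s, fst z + (s - t) *\<^sub>R snd z, snd z) \<partial>lborel) * indicator {b..c} s
      \<le> ennreal (\<bar>s - t\<bar> powr (-1/2)) * (f t * f s) * indicator {b..c} s"
    proof eventually_elim
      case (elim s)
      have "(\<integral>\<^sup>+z. \<phi> (t, z) * \<phi> (s, fst z + (s - t) *\<^sub>R snd z, snd z) \<partial>lborel)
        \<le> ennreal (\<bar>s - t\<bar> powr (-1/2)) * (ennpowr (\<integral>\<^sup>+x. ennreal (m t x powr (3/5)) \<partial>lborel) (5/8) * ennpowr (\<integral>\<^sup>+x. ennreal (m s x powr (3/5)) \<partial>lborel) (5/8))"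
        by (rule dispersive_estimate[of "\<lambda>z. \<phi> (t, z)" "\<lambda>z. \<phi> (s, z)" "m t" "m s" "s - t"])
          (use elim m0 mint mz in auto)
      also have "\<dots> = ennreal (\<bar>s - t\<bar> powr (-1/2)) * (f t * f s)"
        by (simp add: Mint f_def ennpowr_ennreal powr_powr)
      finally show ?case by (rule mult_right_mono) simp
    qed
  qed
  have "X \<le> ennpowr (\<integral>\<^sup>+z. (A z)\<^sup>2 \<partial>lborel) (1/2) *
      ennpowr (\<integral>\<^sup>+t\<in>{b..c}. (\<integral>\<^sup>+s\<in>{b..c}. (\<integral>\<^sup>+z. \<phi> (t, z) * \<phi> (s, fst z + (s - t) *\<^sub>R snd z, snd z) \<partial>lborel) \<partial>lborel) \<partial>lborel) (1/2)"
    unfolding X_def pair[symmetric] by (rule TT_star) auto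
  also have "\<dots> \<le> ennpowr (\<integral>\<^sup>+z. (A z)\<^sup>2 \<partial>lborel) (1/2) *
      ennpowr (\<integral>\<^sup>+t\<in>{b..c}. (\<integral>\<^sup>+s\<in>{b..c}. ennreal (\<bar>s - t\<bar> powr (-1/2)) * (f t * f s) \<partial>lborel) \<partial>lborel) (1/2)"
    by (rule mult_left_mono[OF ennpowr_mono[OF _ nn_integral_mono[OF mult_right_mono[OF disp]]]]) auto
  also have "\<dots> \<le> ennpowr (\<integral>\<^sup>+z. (A z)\<^sup>2 \<partial>lborel) (1/2) * ennpowr (ennreal (4 * sqrt (c - b)) * X) (1/2)"
  proof (intro mult_left_mono ennpowr_mono)
    show "(\<integral>\<^sup>+t\<in>{b..c}. (\<integral>\<^sup>+s\<in>{b..c}. ennreal (\<bar>s - t\<bar> powr (-1/2)) * (f t * f s) \<partial>lborel) \<partial>lborel) \<le> ennreal (4 * sqrt (c - b)) * X"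
      unfolding X_def f2[symmetric]
    proof (rule double_integral_AMGM)
      show "ennreal (\<bar>s - t\<bar> powr (-1/2)) = ennreal (\<bar>t - s\<bar> powr (-1/2))" for s t
        by (simp add: abs_minus_commute)
    qed (use nn_integral_abs_powr[of b _ c] in auto)
  qed auto
  finally have "X \<le> ennpowr (\<integral>\<^sup>+z. (A z)\<^sup>2 \<partial>lborel) (1/2) * ennpowr (ennreal (4 * sqrt (c - b)) * X) (1/2)" .
  then have "X\<^sup>2 \<le> (ennpowr (\<integral>\<^sup>+z. (A z)\<^sup>2 \<partial>lborel) (1/2) * ennpowr (ennreal (4 * sqrt (c - b)) * X) (1/2))\<^sup>2"
    by (rule power_mono) simp
  also have "\<dots> = (\<integral>\<^sup>+z. (A z)\<^sup>2 \<partial>lborel) * (ennreal (4 * sqrt (c - b)) * X)"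
    by (simp only: power_mult_distrib sq_ennpowr_half)
  finally have le: "X * X \<le> X * (ennreal (4 * sqrt (c - b)) * (\<integral>\<^sup>+z. (A z)\<^sup>2 \<partial>lborel))"
    by (simp add: power2_eq_square ac_simps)
  \<comment> \<open>Cancelling X on both sides is legitimate because X is finite and, in the
    remaining case, nonzero.\<close>
  have "X \<le> ennreal (4 * sqrt (c - b)) * (\<integral>\<^sup>+z. (A z)\<^sup>2 \<partial>lborel)"
  proof (cases "X = 0")
    case False
    then show ?thesis using le Xfin by (subst (asm) ennreal_mult_le_mult_iff) auto
  qed simp
  then show ?thesis by (simp add: X_def)
qed

text \<open>Cutting off A in position, velocity and height gives an increasing sequence of functions
  to which the bounded case applies, with a constant independent of the cutoff; monotone convergence
  passes through the three nested integrals.\<close>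

theorem strichartz:
  fixes A :: "R2 \<times> R2 \<Rightarrow> ennreal" and b c :: real
  assumes [measurable]: "A \<in> borel_measurable borel" and bc: "0 \<le> b" "b \<le> c"
  shows "(\<integral>\<^sup>+t\<in>{b..c}. ennpowr (xmass A t) (3/4) \<partial>lborel) \<le> ennreal (4 * sqrt (c - b)) * (\<integral>\<^sup>+z. (A z)\<^sup>2 \<partial>lborel)"
proof -
  define B where "B n z = (if norm (fst z) \<le> real n \<and> norm (snd z) \<le> real n then min (A z) (of_nat n) else 0)"
    for n :: nat and z
  have [measurable]: "B n \<in> borel_measurable borel" for n unfolding B_def by measurable
  have inc: "B m z \<le> B n z" if "m \<le> n" for m n z
    using that unfolding B_def by (auto simp: min_le_iff_disj)
  have sup: "(SUP n. B n z) = A z" for z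
  proof (rule antisym)
    show "(SUP n. B n z) \<le> A z"
      by (rule SUP_least) (auto simp: B_def)
    have "A z = inf (A z) (SUP n. of_nat n)"
      by (simp add: ennreal_SUP_of_nat_eq_top)
    also have "\<dots> = (SUP n. inf (A z) (of_nat n))"
      by (rule inf_SUP)
    also have "\<dots> \<le> (SUP n. B n z)"
    proof (rule SUP_mono)
      fix n :: nat
      \<comment> \<open>From index k on, the cutoffs in position and velocity are inactive at this
        point and only the height is truncated.\<close>
      obtain k :: nat where k: "norm (fst z) \<le> real k" "norm (snd z) \<le> real k"
        using real_arch_simple[of "max (norm (fst z)) (norm (snd z))"] by auto
      have "inf (A z) (of_nat n) \<le> min (A z) (of_nat (max n k))"
        unfolding inf_min by (intro min.mono order.refl of_nat_mono) simp
      also have "\<dots> = B (max n k) z"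
        using k by (auto simp: B_def)
      finally have "inf (A z) (of_nat n) \<le> B (max n k) z" .
      then show "\<exists>m\<in>UNIV. inf (A z) (of_nat n) \<le> B m z" by auto
    qed
    finally show "A z \<le> (SUP n. B n z)" .
  qed
  have vinc: "vmass (B m) y \<le> vmass (B n) y" if "m \<le> n" for m n y
    unfolding vmass_def using that by (intro nn_integral_mono ennpowr_mono inc) auto
  have vsup: "vmass A y = (SUP n. vmass (B n) y)" for y
    unfolding vmass_def sup[symmetric]
    by (subst ennpowr_SUP, simp, subst nn_integral_monotone_convergence_SUP)
      (auto intro!: incseq_SucI le_funI ennpowr_mono inc)
  have xinc: "xmass (B m) t \<le> xmass (B n) t" if "m \<le> n" for m n t
    unfolding xmass_def using that by (intro nn_integral_mono ennpowr_mono vinc) auto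
  have xsup: "xmass A t = (SUP n. xmass (B n) t)" for t
    unfolding xmass_def vsup
    by (subst ennpowr_SUP, simp, subst nn_integral_monotone_convergence_SUP)
      (auto intro!: incseq_SucI le_funI ennpowr_mono vinc)
  have "(\<integral>\<^sup>+t\<in>{b..c}. ennpowr (xmass A t) (3/4) \<partial>lborel)
    = (\<integral>\<^sup>+t. (SUP n. ennpowr (xmass (B n) t) (3/4) * indicator {b..c} t) \<partial>lborel)"
    unfolding xsup by (subst ennpowr_SUP) (auto simp: SUP_mult_right_ennreal)
  also have "\<dots> = (SUP n. \<integral>\<^sup>+t\<in>{b..c}. ennpowr (xmass (B n) t) (3/4) \<partial>lborel)"
    by (rule nn_integral_monotone_convergence_SUP)
      (auto intro!: incseq_SucI le_funI mult_right_mono ennpowr_mono xinc)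
  also have "\<dots> \<le> ennreal (4 * sqrt (c - b)) * (\<integral>\<^sup>+z. (A z)\<^sup>2 \<partial>lborel)"
  proof (rule SUP_least)
    fix n
    have "(\<integral>\<^sup>+t\<in>{b..c}. ennpowr (xmass (B n) t) (3/4) \<partial>lborel) \<le> ennreal (4 * sqrt (c - b)) * (\<integral>\<^sup>+z. (B n z)\<^sup>2 \<partial>lborel)"
      by (rule strichartz_bounded[of _ "real n"])
        (use bc in \<open>auto simp: B_def ennreal_of_nat_eq_real_of_nat split: split_indicator\<close>)
    also have "\<dots> \<le> ennreal (4 * sqrt (c - b)) * (\<integral>\<^sup>+z. (A z)\<^sup>2 \<partial>lborel)"
      by (intro mult_left_mono nn_integral_mono power_mono) (auto simp: B_def)
    finally show "(\<integral>\<^sup>+t\<in>{b..c}. ennpowr (xmass (B n) t) (3/4) \<partial>lborel) \<le> ennreal (4 * sqrt (c - b)) * (\<integral>\<^sup>+z. (A z)\<^sup>2 \<partial>lborel)" .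
  qed
  finally show ?thesis .
qed

section \<open>Space-time estimates for the gain and loss terms\<close>

definition L2norm :: "(R2 \<times> R2 \<Rightarrow> ennreal) \<Rightarrow> ennreal"
  where "L2norm A = ennpowr (\<integral>\<^sup>+z. (A z)\<^sup>2 \<partial>lborel) (1/2)"

definition L42 :: "(real \<times> R2 \<times> R2 \<Rightarrow> ennreal) \<Rightarrow> real \<Rightarrow> ennreal"
  where "L42 F t = ennpowr (\<integral>\<^sup>+x. (\<integral>\<^sup>+v. (F (t, x, v))\<^sup>2 \<partial>lborel)\<^sup>2 \<partial>lborel) (1/4)"

text \<open>The collision estimate is applied at each position, then Hoelder in x with exponents
  3/8, 3/8, 1/4 and Cauchy-Schwarz in time. Each of the two Strichartz factors contributes the
  square root of 4 sqrt (c - b).\<close>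

theorem gain_estimate:
  fixes A B :: "R2 \<times> R2 \<Rightarrow> ennreal" and F :: "real \<times> R2 \<times> R2 \<Rightarrow> ennreal"
  assumes [measurable]: "A \<in> borel_measurable borel" "B \<in> borel_measurable borel" "F \<in> borel_measurable borel"
    and a: "1/2 < a" "a \<le> 1" and bc: "0 \<le> b" "b \<le> c"
    and F: "AE t in lborel. t \<in> {b..c} \<longrightarrow> L42 F t \<le> C"
  shows "(\<integral>\<^sup>+t\<in>{b..c}. (\<integral>\<^sup>+x. \<integral>\<^sup>+v. B (x - t *\<^sub>R v, v) * jw a v *
      nQ (\<lambda>v. jw (-a) v * A (x - t *\<^sub>R v, v)) (\<lambda>v. jw (-a) v * F (t, x, v)) v \<partial>lborel \<partial>lborel) \<partial>lborel)
    \<le> coll_const a * C * ennreal (4 * sqrt (c - b)) * (L2norm A * L2norm B)"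
proof -
  let ?L = "ennreal (4 * sqrt (c - b))"
  let ?f = "\<lambda>t x. \<integral>\<^sup>+v. (F (t, x, v))\<^sup>2 \<partial>lborel"
  let ?G = "\<lambda>t. \<integral>\<^sup>+x. \<integral>\<^sup>+v. B (x - t *\<^sub>R v, v) * jw a v *
      nQ (\<lambda>v. jw (-a) v * A (x - t *\<^sub>R v, v)) (\<lambda>v. jw (-a) v * F (t, x, v)) v \<partial>lborel \<partial>lborel"
  have x: "?G t \<le> coll_const a * (ennpowr (xmass B t) (3/8) * ennpowr (xmass A t) (3/8) * L42 F t)" for t
  proof -
    have "?G t \<le> (\<integral>\<^sup>+x. coll_const a * (ennpowr (vmass B (t, x)) (5/8) * ennpowr (vmass A (t, x)) (5/8) * ennpowr (?f t x) (1/2)) \<partial>lborel)"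
    proof (rule nn_integral_mono)
      fix x
      show "(\<integral>\<^sup>+v. B (x - t *\<^sub>R v, v) * jw a v * nQ (\<lambda>v. jw (-a) v * A (x - t *\<^sub>R v, v)) (\<lambda>v. jw (-a) v * F (t, x, v)) v \<partial>lborel)
        \<le> coll_const a * (ennpowr (vmass B (t, x)) (5/8) * ennpowr (vmass A (t, x)) (5/8) * ennpowr (?f t x) (1/2))"
        using collision_estimate[of "\<lambda>v. A (x - t *\<^sub>R v, v)" "\<lambda>v. F (t, x, v)" "\<lambda>v. B (x - t *\<^sub>R v, v)" a] a
        by (simp add: vmass_def)
    qed
    also have "\<dots> = coll_const a * (\<integral>\<^sup>+x. ennpowr (ennpowr (vmass B (t, x)) (5/3)) (3/8) * ennpowr (ennpowr (vmass A (t, x)) (5/3)) (3/8)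
        * ennpowr ((?f t x)\<^sup>2) (1/4) \<partial>lborel)"
      by (simp add: nn_integral_cmult ennpowr_ennpowr flip: ennpowr_2)
    also have "\<dots> \<le> coll_const a * (ennpowr (\<integral>\<^sup>+x. ennpowr (vmass B (t, x)) (5/3) \<partial>lborel) (3/8)
        * ennpowr (\<integral>\<^sup>+x. ennpowr (vmass A (t, x)) (5/3) \<partial>lborel) (3/8) * ennpowr (\<integral>\<^sup>+x. (?f t x)\<^sup>2 \<partial>lborel) (1/4))"
      by (intro mult_left_mono nn_integral_Holder3) auto
    finally show ?thesis by (simp add: xmass_def L42_def)
  qed
  have "(\<integral>\<^sup>+t\<in>{b..c}. ?G t \<partial>lborel)
    \<le> (\<integral>\<^sup>+t. (coll_const a * C) * ((ennpowr (xmass B t) (3/8) * indicator {b..c} t) * (ennpowr (xmass A t) (3/8) * indicator {b..c} t)) \<partial>lborel)"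
  proof (rule nn_integral_mono_AE)
    show "AE t in lborel. ?G t * indicator {b..c} t
      \<le> (coll_const a * C) * ((ennpowr (xmass B t) (3/8) * indicator {b..c} t) * (ennpowr (xmass A t) (3/8) * indicator {b..c} t))"
      using F
    proof eventually_elim
      case (elim t)
      show ?case
      proof (cases "t \<in> {b..c}")
        case True
        have "?G t \<le> coll_const a * (ennpowr (xmass B t) (3/8) * ennpowr (xmass A t) (3/8) * L42 F t)" by (rule x)
        also have "\<dots> \<le> coll_const a * (ennpowr (xmass B t) (3/8) * ennpowr (xmass A t) (3/8) * C)"
          using elim True by (intro mult_left_mono) auto
        finally show ?thesis using True by (simp add: ac_simps)
      qed simp
    qed
  qed
  also have "\<dots> = (coll_const a * C) * (\<integral>\<^sup>+t. (ennpowr (xmass B t) (3/8) * indicator {b..c} t) * (ennpowr (xmass A t) (3/8) * indicator {b..c} t) \<partial>lborel)"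
    by (rule nn_integral_cmult) measurable
  also have "\<dots> \<le> (coll_const a * C) * (ennpowr (\<integral>\<^sup>+t. (ennpowr (xmass B t) (3/8) * indicator {b..c} t)\<^sup>2 \<partial>lborel) (1/2)
      * ennpowr (\<integral>\<^sup>+t. (ennpowr (xmass A t) (3/8) * indicator {b..c} t)\<^sup>2 \<partial>lborel) (1/2))"
    by (intro mult_left_mono nn_integral_Cauchy_Schwarz) auto
  also have "\<dots> \<le> (coll_const a * C) * (ennpowr (?L * (\<integral>\<^sup>+z. (B z)\<^sup>2 \<partial>lborel)) (1/2) * ennpowr (?L * (\<integral>\<^sup>+z. (A z)\<^sup>2 \<partial>lborel)) (1/2))"
  proof -
    have "(\<integral>\<^sup>+t. (ennpowr (xmass D t) (3/8) * indicator {b..c} t)\<^sup>2 \<partial>lborel) \<le> ?L * (\<integral>\<^sup>+z. (D z)\<^sup>2 \<partial>lborel)"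
      if [measurable]: "D \<in> borel_measurable borel" for D :: "R2 \<times> R2 \<Rightarrow> ennreal"
    proof -
      have "(\<integral>\<^sup>+t. (ennpowr (xmass D t) (3/8) * indicator {b..c} t)\<^sup>2 \<partial>lborel) = (\<integral>\<^sup>+t\<in>{b..c}. ennpowr (xmass D t) (3/4) \<partial>lborel)"
        by (intro nn_integral_cong) (auto simp: power_mult_distrib ennpowr_ennpowr split: split_indicator simp flip: ennpowr_2)
      then show ?thesis using strichartz[of D b c] bc by simp
    qed
    then show ?thesis by (intro mult_left_mono mult_mono ennpowr_mono) auto
  qed
  also have "\<dots> = (coll_const a * C) * ((ennpowr ?L (1/2))\<^sup>2 * (L2norm A * L2norm B))"
    unfolding power2_eq_square[of "ennpowr ?L (1/2)"] by (simp add: ennpowr_mult L2norm_def ac_simps)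
  finally show ?thesis by (simp add: sq_ennpowr_half mult.assoc)
qed

section \<open>Velocity averaging and the loss term\<close>

definition overlap :: "(R2 \<Rightarrow> ennreal) \<Rightarrow> (R2 \<Rightarrow> ennreal) \<Rightarrow> real \<Rightarrow> ennreal"
  where "overlap \<psi> \<eta> r = (\<integral>\<^sup>+x. \<integral>\<^sup>+y. \<psi> x * \<eta> y * indicator {y. dist x y \<le> r} y \<partial>lborel \<partial>lborel)"

text \<open>The summand \<pi> comes from radii below the splitting radius, where areas are used; 2
  \<pi>^(1/4) comes from integrating r^(-3/2) over larger radii; the outer 2 is the cost of the
  symmetrisation.\<close>

definition hls_const :: real
  where "hls_const = 2 * (pi + 2 * pi powr (1/4))"

text \<open>This is the Hardy--Littlewood--Sobolev inequality for the kernel \<open>1/|x - y|\<close> on \<open>L\<^sup>4\<^sup>/\<^sup>3\<close>, with the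
  kernel written as a superposition of balls. After restricting to \<open>\<psi> y \<le> \<psi> x\<close> by symmetry, the
  inner integral is bounded by \<open>\<psi> x\<close> times the area for small radii and by Hoelder's inequality for large radii.\<close>

lemma layered_HLS:
  fixes \<psi> :: "R2 \<Rightarrow> ennreal"
  assumes [measurable]: "\<psi> \<in> borel_measurable borel"
  shows "(\<integral>\<^sup>+r\<in>{0<..}. ennreal (r powr (-2)) * overlap \<psi> \<psi> r \<partial>lborel)
    \<le> ennreal hls_const * ennpowr (\<integral>\<^sup>+x. ennpowr (\<psi> x) (4/3) \<partial>lborel) (3/2)"
proof -
  define N where "N = (\<integral>\<^sup>+x. ennpowr (\<psi> x) (4/3) \<partial>lborel)"
  define g where "g p = (\<integral>\<^sup>+y. \<psi> y * indicator {y. dist (fst p) y \<le> snd p} y * (if \<psi> y \<le> \<psi> (fst p) then 1 else 0) \<partial>lborel)" for p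
  have [measurable]: "g \<in> borel_measurable borel" unfolding g_def by measurable
  have half: "overlap \<psi> \<psi> r \<le> 2 * (\<integral>\<^sup>+x. \<psi> x * g (x, r) \<partial>lborel)" for r
  proof -
    let ?k = "\<lambda>x y. \<psi> x * (\<psi> y * indicator {y. dist x y \<le> r} y * (if \<psi> y \<le> \<psi> x then 1 else 0))"
    have "overlap \<psi> \<psi> r \<le> (\<integral>\<^sup>+x. \<integral>\<^sup>+y. ?k x y + ?k y x \<partial>lborel \<partial>lborel)"
      unfolding overlap_def by (intro nn_integral_mono) (auto split: split_indicator simp: dist_commute mult.commute)
    also have "\<dots> = (\<integral>\<^sup>+x. \<integral>\<^sup>+y. ?k x y \<partial>lborel \<partial>lborel) + (\<integral>\<^sup>+x. \<integral>\<^sup>+y. ?k y x \<partial>lborel \<partial>lborel)"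
      by (simp add: nn_integral_add)
    also have "(\<integral>\<^sup>+x. \<integral>\<^sup>+y. ?k y x \<partial>lborel \<partial>lborel) = (\<integral>\<^sup>+x. \<integral>\<^sup>+y. ?k x y \<partial>lborel \<partial>lborel)"
      by (rule lborel_Fubini) measurable
    also have "(\<integral>\<^sup>+x. \<integral>\<^sup>+y. ?k x y \<partial>lborel \<partial>lborel) = (\<integral>\<^sup>+x. \<psi> x * g (x, r) \<partial>lborel)"
      by (simp add: g_def nn_integral_cmult)
    finally show ?thesis by (simp add: mult_2)
  qed
  have "(\<integral>\<^sup>+r\<in>{0<..}. ennreal (r powr (-2)) * overlap \<psi> \<psi> r \<partial>lborel)
    \<le> (\<integral>\<^sup>+r\<in>{0<..}. ennreal (r powr (-2)) * (2 * (\<integral>\<^sup>+x. \<psi> x * g (x, r) \<partial>lborel)) \<partial>lborel)"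
    by (intro nn_integral_mono mult_right_mono mult_left_mono half) auto
  also have "\<dots> = (\<integral>\<^sup>+r. \<integral>\<^sup>+x. 2 * (\<psi> x * (ennreal (r powr (-2)) * g (x, r) * indicator {0<..} r)) \<partial>lborel \<partial>lborel)"
    by (simp add: nn_integral_cmult[symmetric] nn_integral_multc[symmetric] ac_simps)
  also have "\<dots> = (\<integral>\<^sup>+x. \<integral>\<^sup>+r. 2 * (\<psi> x * (ennreal (r powr (-2)) * g (x, r) * indicator {0<..} r)) \<partial>lborel \<partial>lborel)"
    by (rule lborel_Fubini) measurable
  also have "\<dots> = 2 * (\<integral>\<^sup>+x. \<psi> x * (\<integral>\<^sup>+r\<in>{0<..}. ennreal (r powr (-2)) * g (x, r) \<partial>lborel) \<partial>lborel)"
    by (simp add: nn_integral_cmult)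
  finally have main: "(\<integral>\<^sup>+r\<in>{0<..}. ennreal (r powr (-2)) * overlap \<psi> \<psi> r \<partial>lborel)
    \<le> 2 * (\<integral>\<^sup>+x. \<psi> x * (\<integral>\<^sup>+r\<in>{0<..}. ennreal (r powr (-2)) * g (x, r) \<partial>lborel) \<partial>lborel)" .
  consider "N = 0" | "N = top" | "0 < N" "N < top"
    by (metis not_gr_zero top.not_eq_extremum)
  then show ?thesis
  proof cases
    case 1
    then have "AE x in lborel. ennpowr (\<psi> x) (4/3) = 0"
      unfolding N_def by (subst (asm) nn_integral_0_iff_AE) auto
    then have "AE x in lborel. \<psi> x * (\<integral>\<^sup>+r\<in>{0<..}. ennreal (r powr (-2)) * g (x, r) \<partial>lborel) = 0"
      by eventually_elim (simp add: ennpowr_eq_0_iff)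
    then have "(\<integral>\<^sup>+x. \<psi> x * (\<integral>\<^sup>+r\<in>{0<..}. ennreal (r powr (-2)) * g (x, r) \<partial>lborel) \<partial>lborel) = 0"
      by (subst nn_integral_0_iff_AE) auto
    with main show ?thesis by simp
  next
    case 2
    have "0 < hls_const" by (simp add: hls_const_def add_pos_pos)
    with 2 show ?thesis by (simp add: N_def[symmetric] ennreal_mult_top)
  next
    case 3
    then obtain n where n: "N = ennreal n" "0 < n" by (cases N) auto
    have AEfin: "AE x in lborel. \<psi> x < top"
    proof -
      have "AE x in lborel. ennpowr (\<psi> x) (4/3) \<noteq> \<infinity>"
        using 3 unfolding N_def by (intro nn_integral_noteq_infinite) auto
      then show ?thesis by eventually_elim (use ennpowr_eq_top_iff in \<open>auto simp: less_top[symmetric]\<close>)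
    qed
    have inner: "\<psi> x * (\<integral>\<^sup>+r\<in>{0<..}. ennreal (r powr (-2)) * g (x, r) \<partial>lborel)
      \<le> ennreal ((pi + 2 * pi powr (1/4)) * n powr (1/2)) * ennpowr (\<psi> x) (4/3)" if "\<psi> x < top" for x
    proof (cases "\<psi> x = 0")
      case False
      with that obtain \<beta> where \<beta>: "\<psi> x = ennreal \<beta>" "0 < \<beta>" by (cases "\<psi> x") auto
      \<comment> \<open>The splitting radius balances the two bounds: both \<beta> \<rho> and
        n^(3/4) \<rho>^(-1/2) equal \<beta>^(1/3) n^(1/2).\<close>
      define \<rho> where "\<rho> = \<beta> powr (-2/3) * n powr (1/2)"
      have \<rho>: "0 < \<rho>" using \<beta> n by (simp add: \<rho>_def)
      have g1: "g (x, r) \<le> ennreal (\<beta> * (pi * r\<^sup>2))" if "0 < r" for r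
      proof -
        have "g (x, r) \<le> (\<integral>\<^sup>+y. ennreal \<beta> * indicator (cball x r) y \<partial>lborel)"
          unfolding g_def by (intro nn_integral_mono) (auto simp: \<beta> split: split_indicator)
        also have "\<dots> = ennreal (\<beta> * (pi * r\<^sup>2))"
          using that \<beta> by (subst nn_integral_cmult_indicator) (auto simp: emeasure_cball_R2 ennreal_mult)
        finally show ?thesis .
      qed
      have g2: "g (x, r) \<le> ennreal (n powr (3/4) * (pi * r\<^sup>2) powr (1/4))" if "0 < r" for r
      proof -
        have "g (x, r) \<le> (\<integral>\<^sup>+y. ennpowr (ennpowr (\<psi> y) (4/3)) (3/4) * ennpowr (indicator (cball x r) y) (1/4) \<partial>lborel)"
          unfolding g_def by (intro nn_integral_mono) (auto simp: ennpowr_ennpowr split: split_indicator)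
        also have "\<dots> \<le> ennpowr N (3/4) * ennpowr (\<integral>\<^sup>+y. indicator (cball x r) y \<partial>lborel) (1/4)"
          unfolding N_def by (rule nn_integral_Holder2) (auto intro!: borel_measurable_indicator)
        also have "\<dots> = ennreal (n powr (3/4) * (pi * r\<^sup>2) powr (1/4))"
          using that n by (simp add: emeasure_cball_R2 ennpowr_ennreal flip: ennreal_mult)
        finally show ?thesis .
      qed
      have "(\<integral>\<^sup>+r\<in>{0<..}. ennreal (r powr (-2)) * g (x, r) \<partial>lborel)
        \<le> (\<integral>\<^sup>+r. ennreal (\<beta> * pi) * indicator {0..\<rho>} r + ennreal (n powr (3/4) * pi powr (1/4)) * (ennreal (r powr (-3/2)) * indicator {\<rho>..} r) \<partial>lborel)"
      proof (rule nn_integral_mono)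
        fix r :: real
        show "ennreal (r powr (-2)) * g (x, r) * indicator {0<..} r
          \<le> ennreal (\<beta> * pi) * indicator {0..\<rho>} r + ennreal (n powr (3/4) * pi powr (1/4)) * (ennreal (r powr (-3/2)) * indicator {\<rho>..} r)"
        proof (cases "0 < r")
          case True
          show ?thesis
          proof (cases "r \<le> \<rho>")
            case rr: True
            have "ennreal (r powr (-2)) * g (x, r) \<le> ennreal (r powr (-2)) * ennreal (\<beta> * (pi * r\<^sup>2))"
              using g1[OF True] by (rule mult_left_mono) simp
            also have "\<dots> = ennreal (\<beta> * pi)"
              using True \<beta> by (simp add: powr_minus field_simps flip: ennreal_mult)
            finally show ?thesis using True rr by (auto intro: add_increasing2)
          next
            case rr: False
            have "ennreal (r powr (-2)) * g (x, r) \<le> ennreal (r powr (-2)) * ennreal (n powr (3/4) * (pi * r\<^sup>2) powr (1/4))"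
              using g2[OF True] by (rule mult_left_mono) simp
            also have "\<dots> = ennreal (r powr (-2) * (n powr (3/4) * (pi * r\<^sup>2) powr (1/4)))"
              by (rule ennreal_mult[symmetric]) auto
            also have "r powr (-2) * (n powr (3/4) * (pi * r\<^sup>2) powr (1/4)) = n powr (3/4) * pi powr (1/4) * r powr (-3/2)"
            proof -
              have "(r\<^sup>2) powr (1/4) = r powr (1/2)"
                using True powr_powr[of r 2 "1/4"] by simp
              moreover have "r powr (-2) * r powr (1/2) = r powr (-3/2)"
                using powr_add[of r "-2" "1/2"] by simp
              ultimately show ?thesis by (simp add: powr_mult)
            qed
            finally show ?thesis using True rr by (simp add: ennreal_mult)
          qed
        qed simp
      qed
      also have "\<dots> = ennreal (\<beta> * pi) * ennreal \<rho> + ennreal (n powr (3/4) * pi powr (1/4)) * ennreal (\<rho> powr (-1/2) / (1/2))"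
        using \<rho> nn_integral_powr_inf[of "-3/2" \<rho>] by (simp add: nn_integral_add nn_integral_cmult nn_integral_cmult_indicator)
      also have "\<dots> = ennreal (\<beta> * pi * \<rho> + n powr (3/4) * pi powr (1/4) * (\<rho> powr (-1/2) / (1/2)))"
        using \<beta> \<rho> by (simp flip: ennreal_mult ennreal_plus)
      finally have "\<psi> x * (\<integral>\<^sup>+r\<in>{0<..}. ennreal (r powr (-2)) * g (x, r) \<partial>lborel)
        \<le> ennreal \<beta> * ennreal (\<beta> * pi * \<rho> + n powr (3/4) * pi powr (1/4) * (\<rho> powr (-1/2) / (1/2)))"
        unfolding \<beta> by (rule mult_left_mono) simp
      also have "\<dots> = ennreal (\<beta> * (\<beta> * pi * \<rho> + n powr (3/4) * pi powr (1/4) * (\<rho> powr (-1/2) / (1/2))))"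
        using \<beta> \<rho> by (subst ennreal_mult) auto
      also have "\<beta> * (\<beta> * pi * \<rho> + n powr (3/4) * pi powr (1/4) * (\<rho> powr (-1/2) / (1/2)))
        = (pi + 2 * pi powr (1/4)) * n powr (1/2) * \<beta> powr (4/3)"
      proof -
        have "\<beta> * \<beta> * \<beta> powr (-2/3) = \<beta> powr (4/3)"
          using \<beta> powr_add[of \<beta> 2 "-2/3"] by (simp add: power2_eq_square)
        moreover have "\<beta> * \<rho> powr (-1/2) * n powr (3/4) = \<beta> powr (4/3) * n powr (1/2)"
        proof -
          have "\<rho> powr (-1/2) = \<beta> powr (1/3) * n powr (-1/4)"
            unfolding \<rho>_def by (simp only: powr_mult powr_powr) simp
          moreover have "\<beta> * \<beta> powr (1/3) = \<beta> powr (4/3)"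
            using \<beta> powr_add[of \<beta> 1 "1/3"] by simp
          moreover have "n powr (-1/4) * n powr (3/4) = n powr (1/2)"
            using powr_add[of n "-1/4" "3/4"] by simp
          ultimately show ?thesis by (simp add: mult.assoc[symmetric])
        qed
        ultimately have "\<beta> * \<beta> * \<rho> = \<beta> powr (4/3) * n powr (1/2)" "\<beta> * \<rho> powr (-1/2) * n powr (3/4) = \<beta> powr (4/3) * n powr (1/2)"
          by (simp_all add: \<rho>_def mult.assoc[symmetric])
        moreover have "\<beta> * (\<beta> * pi * \<rho> + n powr (3/4) * pi powr (1/4) * (\<rho> powr (-1/2) / (1/2)))
          = pi * (\<beta> * \<beta> * \<rho>) + 2 * pi powr (1/4) * (\<beta> * \<rho> powr (-1/2) * n powr (3/4))"
          by (simp add: distrib_left ac_simps)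
        ultimately show ?thesis by (simp add: distrib_right distrib_left ac_simps)
      qed
      finally show ?thesis
        using \<beta> by (simp add: ennpowr_ennreal ennreal_mult)
    qed simp
    have "2 * (\<integral>\<^sup>+x. \<psi> x * (\<integral>\<^sup>+r\<in>{0<..}. ennreal (r powr (-2)) * g (x, r) \<partial>lborel) \<partial>lborel)
      \<le> 2 * (\<integral>\<^sup>+x. ennreal ((pi + 2 * pi powr (1/4)) * n powr (1/2)) * ennpowr (\<psi> x) (4/3) \<partial>lborel)"
      using AEfin by (intro mult_left_mono nn_integral_mono_AE) (auto intro: inner)
    also have "\<dots> = 2 * (ennreal ((pi + 2 * pi powr (1/4)) * n powr (1/2)) * ennreal n)"
      by (simp add: nn_integral_cmult N_def[symmetric] n)
    also have "\<dots> = ennreal (2 * ((pi + 2 * pi powr (1/4)) * n powr (1/2) * n))"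
      using n by (simp add: ennreal_mult)
    also have "2 * ((pi + 2 * pi powr (1/4)) * n powr (1/2) * n) = hls_const * n powr (3/2)"
      using n powr_add[of n "1/2" 1] by (simp add: hls_const_def)
    also have "ennreal (hls_const * n powr (3/2)) = ennreal hls_const * ennpowr N (3/2)"
      using n by (simp add: ennpowr_ennreal ennreal_mult hls_const_def)
    finally show ?thesis using main unfolding N_def by (rule order.trans[rotated])
  qed
qed

lemma overlap_measurable [measurable]:
  fixes \<psi> \<eta> :: "real \<times> R2 \<Rightarrow> ennreal"
  assumes [measurable]: "\<psi> \<in> borel_measurable borel" "\<eta> \<in> borel_measurable borel"
    "f \<in> borel_measurable M" "g \<in> borel_measurable M" "r \<in> borel_measurable M"
  shows "(\<lambda>w. overlap (\<lambda>x. \<psi> (f w, x)) (\<lambda>x. \<eta> (g w, x)) (r w)) \<in> borel_measurable M"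
  unfolding overlap_def by measurable

text \<open>The indicator of dist x y \<le> r is not positive definite, so a mixed pair cannot be
  separated directly. It is compared with the overlap area V of two discs of radius r, which is: the
  integral of the product of disc averages. If dist x y \<le> r, the disc of radius r/2 about the
  midpoint gives V \<ge> \<pi> r^2/4; in general V \<le> \<pi> r^2, and V vanishes beyond distance
  2r.\<close>

lemma overlap_polarization:
  fixes \<psi> \<eta> :: "R2 \<Rightarrow> ennreal"
  assumes [measurable]: "\<psi> \<in> borel_measurable borel" "\<eta> \<in> borel_measurable borel" and r: "0 < r"
  shows "overlap \<psi> \<eta> r \<le> 2 * (overlap \<psi> \<psi> (2 * r) + overlap \<eta> \<eta> (2 * r))"
proof -
  define \<mu> where "\<mu> f w = (\<integral>\<^sup>+x. f x * indicator {y. dist w y \<le> r} x \<partial>lborel)" for f :: "R2 \<Rightarrow> ennreal" and w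
  define V where "V x y = (\<integral>\<^sup>+w. indicator {y. dist w y \<le> r} x * indicator {y. dist w y \<le> r} y \<partial>lborel :: ennreal)" for x y :: R2
  have [measurable]: "\<mu> f \<in> borel_measurable borel" if [measurable]: "f \<in> borel_measurable borel" for f
    unfolding \<mu>_def by measurable
  have V_lower: "ennreal (pi * r\<^sup>2 / 4) * indicator {y. dist x y \<le> r} y \<le> V x y" for x y
  proof (cases "dist x y \<le> r")
    case True
    define m where "m = midpoint x y"
    have "ennreal (pi * r\<^sup>2 / 4) = (\<integral>\<^sup>+w. indicator (cball m (r/2)) w \<partial>lborel)"
      using r by (simp add: emeasure_cball_R2 power_divide)
    also have "\<dots> \<le> V x y"
      unfolding V_def
    proof (rule nn_integral_mono)
      fix w
      have "dist w x \<le> r \<and> dist w y \<le> r" if "w \<in> cball m (r/2)"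
      proof -
        have "dist m x \<le> r / 2" "dist m y \<le> r / 2" "dist w m \<le> r / 2"
          using that True by (auto simp: m_def dist_midpoint dist_commute)
        then show ?thesis
          using dist_triangle[of w x m] dist_triangle[of w y m] by linarith
      qed
      then show "indicator (cball m (r/2)) w \<le> (indicator {y. dist w y \<le> r} x * indicator {y. dist w y \<le> r} y :: ennreal)"
        by (auto split: split_indicator)
    qed
    finally show ?thesis using True by simp
  qed simp
  have V_upper: "V x y \<le> ennreal (pi * r\<^sup>2) * indicator {y. dist x y \<le> 2 * r} y" for x y
  proof (cases "dist x y \<le> 2 * r")
    case True
    have "V x y \<le> (\<integral>\<^sup>+w. indicator (cball x r) w \<partial>lborel)"
      unfolding V_def by (intro nn_integral_mono) (auto split: split_indicator simp: dist_commute)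
    then show ?thesis using True r by (simp add: emeasure_cball_R2)
  next
    case False
    have "indicator {y. dist w y \<le> r} x * indicator {y. dist w y \<le> r} y = (0 :: ennreal)" for w
      using dist_triangle[of x y w] False by (auto split: split_indicator simp: dist_commute)
    then have "V x y = 0" unfolding V_def by (simp only: nn_integral_const mult_zero_left)
    then show ?thesis by simp
  qed
  have product: "(\<integral>\<^sup>+w. \<mu> f w * \<mu> h w \<partial>lborel) = (\<integral>\<^sup>+x. \<integral>\<^sup>+y. f x * h y * V x y \<partial>lborel \<partial>lborel)"
    if [measurable]: "f \<in> borel_measurable borel" "h \<in> borel_measurable borel" for f h
  proof -
    let ?k = "\<lambda>w x y. f x * h y * (indicator {y. dist w y \<le> r} x * indicator {y. dist w y \<le> r} y)"
    have "(\<integral>\<^sup>+w. \<mu> f w * \<mu> h w \<partial>lborel) = (\<integral>\<^sup>+w. \<integral>\<^sup>+x. \<integral>\<^sup>+y. ?k w x y \<partial>lborel \<partial>lborel \<partial>lborel)"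
    proof (rule nn_integral_cong)
      fix w
      have "\<mu> f w * \<mu> h w = (\<integral>\<^sup>+x. f x * indicator {y. dist w y \<le> r} x * \<mu> h w \<partial>lborel)"
        unfolding \<mu>_def[of f] by (rule nn_integral_multc[symmetric]) measurable
      also have "\<dots> = (\<integral>\<^sup>+x. \<integral>\<^sup>+y. ?k w x y \<partial>lborel \<partial>lborel)"
        unfolding \<mu>_def by (intro nn_integral_cong, subst nn_integral_cmult[symmetric]) (auto simp: ac_simps)
      finally show "\<mu> f w * \<mu> h w = (\<integral>\<^sup>+x. \<integral>\<^sup>+y. ?k w x y \<partial>lborel \<partial>lborel)" .
    qed
    also have "\<dots> = (\<integral>\<^sup>+x. \<integral>\<^sup>+w. \<integral>\<^sup>+y. ?k w x y \<partial>lborel \<partial>lborel \<partial>lborel)"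
      by (rule lborel_Fubini) measurable
    also have "\<dots> = (\<integral>\<^sup>+x. \<integral>\<^sup>+y. \<integral>\<^sup>+w. ?k w x y \<partial>lborel \<partial>lborel \<partial>lborel)"
      by (intro nn_integral_cong lborel_Fubini) measurable
    also have "\<dots> = (\<integral>\<^sup>+x. \<integral>\<^sup>+y. f x * h y * V x y \<partial>lborel \<partial>lborel)"
      unfolding V_def by (intro nn_integral_cong nn_integral_cmult) measurable
    finally show ?thesis .
  qed
  have square: "(\<integral>\<^sup>+w. (\<mu> f w)\<^sup>2 \<partial>lborel) \<le> ennreal (pi * r\<^sup>2) * overlap f f (2 * r)"
    if [measurable]: "f \<in> borel_measurable borel" for f
  proof -
    have "(\<integral>\<^sup>+w. (\<mu> f w)\<^sup>2 \<partial>lborel) \<le> (\<integral>\<^sup>+x. \<integral>\<^sup>+y. f x * f y * (ennreal (pi * r\<^sup>2) * indicator {y. dist x y \<le> 2 * r} y) \<partial>lborel \<partial>lborel)"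
      unfolding power2_eq_square[of "\<mu> f _"] product[OF that that]
      by (intro nn_integral_mono mult_left_mono V_upper) auto
    also have "\<dots> = ennreal (pi * r\<^sup>2) * overlap f f (2 * r)"
      unfolding overlap_def by (simp add: nn_integral_cmult[symmetric] ac_simps)
    finally show ?thesis .
  qed
  have "ennreal (pi * r\<^sup>2 / 4) * overlap \<psi> \<eta> r = (\<integral>\<^sup>+x. \<integral>\<^sup>+y. \<psi> x * \<eta> y * (ennreal (pi * r\<^sup>2 / 4) * indicator {y. dist x y \<le> r} y) \<partial>lborel \<partial>lborel)"
    unfolding overlap_def by (simp add: nn_integral_cmult[symmetric] ac_simps)
  also have "\<dots> \<le> (\<integral>\<^sup>+w. \<mu> \<psi> w * \<mu> \<eta> w \<partial>lborel)"
    unfolding product[OF assms(1,2)] by (intro nn_integral_mono mult_left_mono V_lower) auto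
  finally have "2 * (ennreal (pi * r\<^sup>2 / 4) * overlap \<psi> \<eta> r) \<le> 2 * (\<integral>\<^sup>+w. \<mu> \<psi> w * \<mu> \<eta> w \<partial>lborel)"
    by (rule mult_left_mono) simp
  also have "\<dots> = (\<integral>\<^sup>+w. 2 * (\<mu> \<psi> w * \<mu> \<eta> w) \<partial>lborel)"
    by (rule nn_integral_cmult[symmetric]) measurable
  also have "\<dots> \<le> (\<integral>\<^sup>+w. (\<mu> \<psi> w)\<^sup>2 + (\<mu> \<eta> w)\<^sup>2 \<partial>lborel)"
    by (intro nn_integral_mono ennreal_two_mult_le)
  also have "\<dots> = (\<integral>\<^sup>+w. (\<mu> \<psi> w)\<^sup>2 \<partial>lborel) + (\<integral>\<^sup>+w. (\<mu> \<eta> w)\<^sup>2 \<partial>lborel)"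
    by (rule nn_integral_add) auto
  also have "\<dots> \<le> ennreal (pi * r\<^sup>2) * overlap \<psi> \<psi> (2 * r) + ennreal (pi * r\<^sup>2) * overlap \<eta> \<eta> (2 * r)"
    by (intro add_mono square) auto
  finally have "2 * (ennreal (pi * r\<^sup>2 / 4) * overlap \<psi> \<eta> r) \<le> ennreal (pi * r\<^sup>2) * (overlap \<psi> \<psi> (2 * r) + overlap \<eta> \<eta> (2 * r))"
    by (simp only: distrib_left)
  also have "ennreal (pi * r\<^sup>2) = ennreal (pi * r\<^sup>2 / 2) * 2"
    using ennreal_mult[of "pi * r\<^sup>2 / 2" 2] by simp
  also have "2 * (ennreal (pi * r\<^sup>2 / 4) * overlap \<psi> \<eta> r) = ennreal (pi * r\<^sup>2 / 2) * overlap \<psi> \<eta> r"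
  proof -
    have "2 * ennreal (pi * r\<^sup>2 / 4) = ennreal (pi * r\<^sup>2 / 2)"
      using ennreal_mult[of 2 "pi * r\<^sup>2 / 4"] by simp
    then show ?thesis by (simp add: mult.assoc[symmetric])
  qed
  finally show ?thesis
    using r unfolding mult.assoc by (subst (asm) ennreal_mult_le_mult_iff) auto
qed

text \<open>Substituting y = x + (s - t) v turns the velocity cutoff into the condition dist x y
  \<le> R |s - t|, with factor 1/(s - t)^2. Polarization then leaves two terms in each of which both
  copies of \<psi> stand at the same time, so the other time variable acts merely as a radius.
  Rescaling it produces r^(-2) dr, that is, the layered kernel 1/|x - y|, and
  \<open>layered_HLS\<close> applies at each time.\<close>

lemma averaging_ball:
  fixes \<psi> :: "real \<times> R2 \<Rightarrow> ennreal"
  assumes [measurable]: "\<psi> \<in> borel_measurable borel" "I \<in> sets borel" and R: "0 < R"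
  shows "(\<integral>\<^sup>+t\<in>I. (\<integral>\<^sup>+s\<in>I. (\<integral>\<^sup>+z. indicator {v. norm v \<le> R} (snd z) * (\<psi> (t, fst z) * \<psi> (s, fst z + (s - t) *\<^sub>R snd z)) \<partial>lborel) \<partial>lborel) \<partial>lborel)
    \<le> ennreal (16 * R * hls_const) * (\<integral>\<^sup>+t\<in>I. ennpowr (\<integral>\<^sup>+x. ennpowr (\<psi> (t, x)) (4/3) \<partial>lborel) (3/2) \<partial>lborel)"
proof -
  let ?\<Theta> = "\<lambda>t. overlap (\<lambda>x. \<psi> (t, x)) (\<lambda>x. \<psi> (t, x))"
  let ?N = "\<lambda>t. ennpowr (\<integral>\<^sup>+x. ennpowr (\<psi> (t, x)) (4/3) \<partial>lborel) (3/2)"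
  have scale: "(\<integral>\<^sup>+z. indicator {v. norm v \<le> R} (snd z) * (\<psi> (t, fst z) * \<psi> (s, fst z + (s - t) *\<^sub>R snd z)) \<partial>lborel)
    = ennreal (1/(s - t)\<^sup>2) * overlap (\<lambda>x. \<psi> (t, x)) (\<lambda>x. \<psi> (s, x)) (R * \<bar>s - t\<bar>)" if "s \<noteq> t" for s t
  proof -
    have "(\<integral>\<^sup>+z. indicator {v. norm v \<le> R} (snd z) * (\<psi> (t, fst z) * \<psi> (s, fst z + (s - t) *\<^sub>R snd z)) \<partial>lborel)
      = (\<integral>\<^sup>+x. \<integral>\<^sup>+v. indicator {v. norm v \<le> R} v * (\<psi> (t, x) * \<psi> (s, x + (s - t) *\<^sub>R v)) \<partial>lborel \<partial>lborel)"
    proof (subst nn_integral_lborel_pair)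
      have [measurable]: "(\<lambda>z. indicator {v. norm v \<le> R} (snd z) :: ennreal) \<in> borel_measurable (borel :: (R2 \<times> R2) measure)"
      proof -
        have "(\<lambda>z :: R2 \<times> R2. indicator {v. norm v \<le> R} (snd z) :: ennreal) = (\<lambda>z. if norm (snd z) \<le> R then 1 else 0)"
          by (auto simp: fun_eq_iff)
        then show ?thesis by simp
      qed
      show "(\<lambda>z. indicator {v. norm v \<le> R} (snd z) * (\<psi> (t, fst z) * \<psi> (s, fst z + (s - t) *\<^sub>R snd z))) \<in> borel_measurable borel"
        by measurable
    qed simp
    also have "\<dots> = (\<integral>\<^sup>+x. \<integral>\<^sup>+v. \<psi> (t, x) * \<psi> (s, x + (s - t) *\<^sub>R rot 0 v) * indicator {y. dist x y \<le> R * \<bar>s - t\<bar>} (x + (s - t) *\<^sub>R rot 0 v) \<partial>lborel \<partial>lborel)"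
      using that by (intro nn_integral_cong) (auto simp: rot_def dist_norm split: split_indicator)
    also have "\<dots> = (\<integral>\<^sup>+x. ennreal (1/(s - t)\<^sup>2) * (\<integral>\<^sup>+y. \<psi> (t, x) * \<psi> (s, y) * indicator {y. dist x y \<le> R * \<bar>s - t\<bar>} y \<partial>lborel) \<partial>lborel)"
      using that by (intro nn_integral_cong nn_integral_rot_shift[of "\<lambda>y. \<psi> (t, _) * \<psi> (s, y) * indicator {y. dist _ y \<le> R * \<bar>s - t\<bar>} y"]) auto
    finally show ?thesis by (simp add: overlap_def nn_integral_cmult)
  qed
  define k where "k t s = ennreal (1/(s - t)\<^sup>2) * ?\<Theta> t (2 * (R * \<bar>s - t\<bar>)) * indicator I s * indicator I t" for t s
  have inner: "(\<integral>\<^sup>+s. ennreal (1/(s - t)\<^sup>2) * ?\<Theta> t (2 * (R * \<bar>s - t\<bar>)) \<partial>lborel) \<le> ennreal (4 * R * hls_const) * ?N t" for t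
  proof -
    let ?f = "\<lambda>\<sigma>. ennreal (1/\<sigma>\<^sup>2) * ?\<Theta> t (2 * (R * \<bar>\<sigma>\<bar>))"
    have "(\<integral>\<^sup>+s. ?f (s + (-t)) \<partial>lborel) = (\<integral>\<^sup>+\<sigma>. ?f \<sigma> \<partial>lborel)"
      by (rule nn_integral_lborel_shift) measurable
    also have "\<dots> \<le> (\<integral>\<^sup>+\<sigma>. ?f \<sigma> * indicator {0<..} \<sigma> + ?f (- \<sigma>) * indicator {0<..} (- \<sigma>) \<partial>lborel)"
      by (intro nn_integral_mono) (auto split: split_indicator)
    also have "\<dots> = (\<integral>\<^sup>+\<sigma>. ?f \<sigma> * indicator {0<..} \<sigma> \<partial>lborel) + (\<integral>\<^sup>+\<sigma>. ?f (- \<sigma>) * indicator {0<..} (- \<sigma>) \<partial>lborel)"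
      by (rule nn_integral_add) measurable
    also have "(\<integral>\<^sup>+\<sigma>. ?f (- \<sigma>) * indicator {0<..} (- \<sigma>) \<partial>lborel) = (\<integral>\<^sup>+\<sigma>. ?f \<sigma> * indicator {0<..} \<sigma> \<partial>lborel)"
      using nn_integral_real_affine[of "\<lambda>\<sigma>. ?f \<sigma> * indicator {0<..} \<sigma>" "-1" 0] by simp
    \<comment> \<open>The substitution r = 2 R \<sigma> has Jacobian 1/(2R) and turns 1/\<sigma>^2
      into 4 R^2/r^2. With the two signs of \<sigma> the total factor is 4R.\<close>
    also have "(\<integral>\<^sup>+\<sigma>. ?f \<sigma> * indicator {0<..} \<sigma> \<partial>lborel) = ennreal (1/(2*R)) * (\<integral>\<^sup>+r. ?f (r/(2*R)) * indicator {0<..} (r/(2*R)) \<partial>lborel)"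
      using nn_integral_real_affine[of "\<lambda>\<sigma>. ?f \<sigma> * indicator {0<..} \<sigma>" "1/(2*R)" 0] R by simp
    also have "(\<integral>\<^sup>+r. ?f (r/(2*R)) * indicator {0<..} (r/(2*R)) \<partial>lborel)
        = (\<integral>\<^sup>+r. ennreal (4*R\<^sup>2) * (ennreal (r powr (-2)) * ?\<Theta> t r * indicator {0<..} r) \<partial>lborel)"
    proof (rule nn_integral_cong)
      fix r :: real
      show "?f (r/(2*R)) * indicator {0<..} (r/(2*R)) = ennreal (4*R\<^sup>2) * (ennreal (r powr (-2)) * ?\<Theta> t r * indicator {0<..} r)"
      proof (cases "0 < r")
        case True
        have "ennreal (1/(r/(2*R))\<^sup>2) = ennreal (4*R\<^sup>2) * ennreal (r powr (-2))"
          using True by (simp add: powr_minus_divide power_divide power_mult_distrib flip: ennreal_mult)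
        moreover have "2 * (R * \<bar>r/(2*R)\<bar>) = r" using R True by simp
        ultimately show ?thesis using True R by (simp add: mult.assoc)
      qed (use R in \<open>simp add: zero_less_divide_iff\<close>)
    qed
    also have "\<dots> = ennreal (4*R\<^sup>2) * (\<integral>\<^sup>+r\<in>{0<..}. ennreal (r powr (-2)) * ?\<Theta> t r \<partial>lborel)"
      by (rule nn_integral_cmult) measurable
    finally have "(\<integral>\<^sup>+s. ?f (s + (-t)) \<partial>lborel) \<le> 2 * (ennreal (1/(2*R)) * (ennreal (4*R\<^sup>2) * (\<integral>\<^sup>+r\<in>{0<..}. ennreal (r powr (-2)) * ?\<Theta> t r \<partial>lborel)))"
      by (simp only: mult_2)
    also have "\<dots> = ennreal (4*R) * (\<integral>\<^sup>+r\<in>{0<..}. ennreal (r powr (-2)) * ?\<Theta> t r \<partial>lborel)"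
    proof -
      have "ennreal (1/(2*R)) * ennreal (4*R\<^sup>2) = ennreal (2*R)"
        using R by (subst ennreal_mult[symmetric]) (auto simp: power2_eq_square)
      moreover have "2 * ennreal (2*R) = ennreal (4*R)"
        using ennreal_mult[of 2 "2*R"] R by simp
      moreover have "p * (q * (r * X)) = (p * (q * r)) * X" for p q r X :: ennreal
        by (simp only: mult.assoc)
      ultimately show ?thesis by (simp only:)
    qed
    also have "\<dots> \<le> ennreal (4*R) * (ennreal hls_const * ?N t)"
      by (intro mult_left_mono layered_HLS) auto
    also have "\<dots> = ennreal (4 * R * hls_const) * ?N t"
      using R by (simp add: hls_const_def ennreal_mult mult.assoc)
    finally show ?thesis by simp
  qed
  have km: "(\<lambda>p. k (fst p) (snd p)) \<in> borel_measurable borel"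
    unfolding k_def by measurable
  have km' [measurable]: "(\<lambda>s. k t s) \<in> borel_measurable borel" "(\<lambda>s. k s t) \<in> borel_measurable borel" for t
    unfolding k_def by measurable
  have [measurable]: "(\<lambda>t. \<integral>\<^sup>+s. k t s \<partial>lborel) \<in> borel_measurable borel" "(\<lambda>t. \<integral>\<^sup>+s. k s t \<partial>lborel) \<in> borel_measurable borel"
    unfolding k_def by measurable
  have "(\<integral>\<^sup>+t\<in>I. (\<integral>\<^sup>+s\<in>I. (\<integral>\<^sup>+z. indicator {v. norm v \<le> R} (snd z) * (\<psi> (t, fst z) * \<psi> (s, fst z + (s - t) *\<^sub>R snd z)) \<partial>lborel) \<partial>lborel) \<partial>lborel)
    \<le> (\<integral>\<^sup>+t. (\<integral>\<^sup>+s. 2 * (k t s + k s t) \<partial>lborel) \<partial>lborel)"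
  proof (rule nn_integral_mono)
    fix t
    show "(\<integral>\<^sup>+s\<in>I. (\<integral>\<^sup>+z. indicator {v. norm v \<le> R} (snd z) * (\<psi> (t, fst z) * \<psi> (s, fst z + (s - t) *\<^sub>R snd z)) \<partial>lborel) \<partial>lborel) * indicator I t
      \<le> (\<integral>\<^sup>+s. 2 * (k t s + k s t) \<partial>lborel)"
    proof (cases "t \<in> I")
      case True
      have "(\<integral>\<^sup>+s\<in>I. (\<integral>\<^sup>+z. indicator {v. norm v \<le> R} (snd z) * (\<psi> (t, fst z) * \<psi> (s, fst z + (s - t) *\<^sub>R snd z)) \<partial>lborel) \<partial>lborel)
        \<le> (\<integral>\<^sup>+s. 2 * (k t s + k s t) \<partial>lborel)"
      proof (rule nn_integral_mono_AE)
        have "AE s in lborel. s \<noteq> t" by (rule AE_lborel_singleton)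
        then show "AE s in lborel. (\<integral>\<^sup>+z. indicator {v. norm v \<le> R} (snd z) * (\<psi> (t, fst z) * \<psi> (s, fst z + (s - t) *\<^sub>R snd z)) \<partial>lborel) * indicator I s
          \<le> 2 * (k t s + k s t)"
        proof eventually_elim
          case (elim s)
          show ?case
          proof (cases "s \<in> I")
            case sI: True
            have "(\<integral>\<^sup>+z. indicator {v. norm v \<le> R} (snd z) * (\<psi> (t, fst z) * \<psi> (s, fst z + (s - t) *\<^sub>R snd z)) \<partial>lborel)
              \<le> ennreal (1/(s - t)\<^sup>2) * (2 * (?\<Theta> t (2 * (R * \<bar>s - t\<bar>)) + ?\<Theta> s (2 * (R * \<bar>s - t\<bar>))))"
              unfolding scale[OF elim] using elim R by (intro mult_left_mono overlap_polarization) auto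
            also have "\<dots> = 2 * (k t s + k s t)"
              using True sI by (simp add: k_def distrib_left ac_simps abs_minus_commute power2_commute)
            finally show ?thesis using sI by simp
          qed simp
        qed
      qed
      then show ?thesis using True by simp
    qed simp
  qed
  also have "\<dots> = 2 * ((\<integral>\<^sup>+t. \<integral>\<^sup>+s. k t s \<partial>lborel \<partial>lborel) + (\<integral>\<^sup>+t. \<integral>\<^sup>+s. k s t \<partial>lborel \<partial>lborel))"
    by (simp add: nn_integral_cmult nn_integral_add)
  also have "(\<integral>\<^sup>+t. \<integral>\<^sup>+s. k s t \<partial>lborel \<partial>lborel) = (\<integral>\<^sup>+t. \<integral>\<^sup>+s. k t s \<partial>lborel \<partial>lborel)"
    by (rule lborel_Fubini[OF km])
  \<comment> \<open>The constant 4 is the 2 of the polarization times the two equal contributions of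
    t and s; with the 4R above it makes 16R.\<close>
  also have "2 * ((\<integral>\<^sup>+t. \<integral>\<^sup>+s. k t s \<partial>lborel \<partial>lborel) + (\<integral>\<^sup>+t. \<integral>\<^sup>+s. k t s \<partial>lborel \<partial>lborel)) = 4 * (\<integral>\<^sup>+t. \<integral>\<^sup>+s. k t s \<partial>lborel \<partial>lborel)"
    by (simp only: mult_2[symmetric] mult.assoc[symmetric]) simp
  also have "\<dots> \<le> 4 * (\<integral>\<^sup>+t. (ennreal (4 * R * hls_const) * ?N t) * indicator I t \<partial>lborel)"
  proof (intro mult_left_mono nn_integral_mono)
    fix t
    have "(\<integral>\<^sup>+s. k t s \<partial>lborel) \<le> (\<integral>\<^sup>+s. ennreal (1/(s - t)\<^sup>2) * ?\<Theta> t (2 * (R * \<bar>s - t\<bar>)) * indicator I t \<partial>lborel)"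
      unfolding k_def by (intro nn_integral_mono) (auto split: split_indicator)
    also have "\<dots> = (\<integral>\<^sup>+s. ennreal (1/(s - t)\<^sup>2) * ?\<Theta> t (2 * (R * \<bar>s - t\<bar>)) \<partial>lborel) * indicator I t"
      by (rule nn_integral_multc) measurable
    also have "\<dots> \<le> (ennreal (4 * R * hls_const) * ?N t) * indicator I t"
      by (intro mult_right_mono inner) auto
    finally show "(\<integral>\<^sup>+s. k t s \<partial>lborel) \<le> (ennreal (4 * R * hls_const) * ?N t) * indicator I t" .
  qed auto
  also have "\<dots> = 4 * ennreal (4 * R * hls_const) * (\<integral>\<^sup>+t\<in>I. ?N t \<partial>lborel)"
    by (simp add: nn_integral_cmult mult.assoc)
  also have "4 * ennreal (4 * R * hls_const) = ennreal (16 * R * hls_const)"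
    using ennreal_mult[of 4 "4 * R * hls_const"] R by (simp add: hls_const_def mult.assoc)
  finally show ?thesis .
qed

text \<open>The weight \<langle>v\<rangle>^(-2a) is dominated by balls of radius R with density 2a
  R^(-2a-1). The bound for a ball grows like 16R, so the remaining integral is that of R^(-2a) over
  R \<ge> 1, with value 1/(2a - 1); this is where a > 1/2 enters.\<close>

lemma averaging:
  fixes \<psi> :: "real \<times> R2 \<Rightarrow> ennreal"
  assumes [measurable]: "\<psi> \<in> borel_measurable borel" "I \<in> sets borel" and a: "1/2 < a"
  shows "(\<integral>\<^sup>+t\<in>I. (\<integral>\<^sup>+s\<in>I. (\<integral>\<^sup>+z. jw (-(2*a)) (snd z) * (\<psi> (t, fst z) * \<psi> (s, fst z + (s - t) *\<^sub>R snd z)) \<partial>lborel) \<partial>lborel) \<partial>lborel)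
    \<le> ennreal (32 * a * hls_const / (2 * a - 1)) * (\<integral>\<^sup>+t\<in>I. ennpowr (\<integral>\<^sup>+x. ennpowr (\<psi> (t, x)) (4/3) \<partial>lborel) (3/2) \<partial>lborel)"
proof -
  let ?X = "\<integral>\<^sup>+t\<in>I. ennpowr (\<integral>\<^sup>+x. ennpowr (\<psi> (t, x)) (4/3) \<partial>lborel) (3/2) \<partial>lborel"
  define w where "w R = ennreal (2*a * R powr (-(2*a)-1)) * indicator {1..} R" for R
  define cutoff where "cutoff R v = (if norm v \<le> R then 1 else 0 :: ennreal)" for R and v :: R2
  define k where "k t s z = \<psi> (t, fst z) * \<psi> (s, fst z + (s - t) *\<^sub>R snd z)" for t s and z :: "R2 \<times> R2"
  have [measurable]: "w \<in> borel_measurable borel" unfolding w_def by measurable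
  let ?F = "\<lambda>R t s z. w R * (cutoff R (snd z) * k t s z)"
  have pt: "jw (-(2*a)) v \<le> (\<integral>\<^sup>+R. w R * cutoff R v \<partial>lborel)" for v
  proof -
    have "jw (-(2*a)) v \<le> ennreal (2*a) * (\<integral>\<^sup>+R\<in>{1..}. ennreal (R powr (-(2*a)-1)) * indicator {R. norm v \<le> R} R \<partial>lborel)"
      using a by (intro jw_layer_cake) auto
    also have "\<dots> = (\<integral>\<^sup>+R. ennreal (2*a) * (ennreal (R powr (-(2*a)-1)) * indicator {R. norm v \<le> R} R * indicator {1..} R) \<partial>lborel)"
      by (rule nn_integral_cmult[symmetric]) measurable
    also have "\<dots> = (\<integral>\<^sup>+R. w R * cutoff R v \<partial>lborel)"
      using a by (intro nn_integral_cong) (auto simp: w_def cutoff_def ennreal_mult split: split_indicator)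
    finally show ?thesis .
  qed
  have "(\<integral>\<^sup>+t\<in>I. (\<integral>\<^sup>+s\<in>I. (\<integral>\<^sup>+z. jw (-(2*a)) (snd z) * k t s z \<partial>lborel) \<partial>lborel) \<partial>lborel)
    \<le> (\<integral>\<^sup>+t\<in>I. (\<integral>\<^sup>+s\<in>I. (\<integral>\<^sup>+z. (\<integral>\<^sup>+R. ?F R t s z \<partial>lborel) \<partial>lborel) \<partial>lborel) \<partial>lborel)"
  proof (intro nn_integral_mono mult_right_mono)
    fix t s :: real and z :: "R2 \<times> R2"
    have "jw (-(2*a)) (snd z) * k t s z \<le> (\<integral>\<^sup>+R. w R * cutoff R (snd z) \<partial>lborel) * k t s z"
      by (intro mult_right_mono pt) auto
    also have "\<dots> = (\<integral>\<^sup>+R. ?F R t s z \<partial>lborel)"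
      unfolding cutoff_def by (subst nn_integral_multc[symmetric]) (auto simp: mult.assoc)
    finally show "jw (-(2*a)) (snd z) * k t s z \<le> (\<integral>\<^sup>+R. ?F R t s z \<partial>lborel)" .
  qed auto
  also have "\<dots> = (\<integral>\<^sup>+t\<in>I. (\<integral>\<^sup>+s. (\<integral>\<^sup>+R. (\<integral>\<^sup>+z. ?F R t s z \<partial>lborel) * indicator I s \<partial>lborel) \<partial>lborel) \<partial>lborel)"
  proof (intro nn_integral_cong arg_cong2[where f = "(*)"] refl)
    fix t s :: real
    have "(\<integral>\<^sup>+z. (\<integral>\<^sup>+R. ?F R t s z \<partial>lborel) \<partial>lborel) = (\<integral>\<^sup>+R. (\<integral>\<^sup>+z. ?F R t s z \<partial>lborel) \<partial>lborel)"
      unfolding cutoff_def k_def by (rule lborel_Fubini) measurable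
    also have "\<dots> * indicator I s = (\<integral>\<^sup>+R. (\<integral>\<^sup>+z. ?F R t s z \<partial>lborel) * indicator I s \<partial>lborel)"
      unfolding cutoff_def k_def by (rule nn_integral_multc[symmetric]) measurable
    finally show "(\<integral>\<^sup>+z. (\<integral>\<^sup>+R. ?F R t s z \<partial>lborel) \<partial>lborel) * indicator I s = (\<integral>\<^sup>+R. (\<integral>\<^sup>+z. ?F R t s z \<partial>lborel) * indicator I s \<partial>lborel)" .
  qed
  also have "\<dots> = (\<integral>\<^sup>+t. (\<integral>\<^sup>+R. (\<integral>\<^sup>+s\<in>I. (\<integral>\<^sup>+z. ?F R t s z \<partial>lborel) \<partial>lborel) * indicator I t \<partial>lborel) \<partial>lborel)"
  proof (intro nn_integral_cong)
    fix t :: real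
    have "(\<integral>\<^sup>+s. (\<integral>\<^sup>+R. (\<integral>\<^sup>+z. ?F R t s z \<partial>lborel) * indicator I s \<partial>lborel) \<partial>lborel) = (\<integral>\<^sup>+R. (\<integral>\<^sup>+s\<in>I. (\<integral>\<^sup>+z. ?F R t s z \<partial>lborel) \<partial>lborel) \<partial>lborel)"
      unfolding cutoff_def k_def by (rule lborel_Fubini) measurable
    also have "\<dots> * indicator I t = (\<integral>\<^sup>+R. (\<integral>\<^sup>+s\<in>I. (\<integral>\<^sup>+z. ?F R t s z \<partial>lborel) \<partial>lborel) * indicator I t \<partial>lborel)"
      unfolding cutoff_def k_def by (rule nn_integral_multc[symmetric]) measurable
    finally show "(\<integral>\<^sup>+s. (\<integral>\<^sup>+R. (\<integral>\<^sup>+z. ?F R t s z \<partial>lborel) * indicator I s \<partial>lborel) \<partial>lborel) * indicator I t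
      = (\<integral>\<^sup>+R. (\<integral>\<^sup>+s\<in>I. (\<integral>\<^sup>+z. ?F R t s z \<partial>lborel) \<partial>lborel) * indicator I t \<partial>lborel)" .
  qed
  also have "\<dots> = (\<integral>\<^sup>+R. (\<integral>\<^sup>+t\<in>I. (\<integral>\<^sup>+s\<in>I. (\<integral>\<^sup>+z. ?F R t s z \<partial>lborel) \<partial>lborel) \<partial>lborel) \<partial>lborel)"
    unfolding cutoff_def k_def by (rule lborel_Fubini) measurable
  also have "\<dots> = (\<integral>\<^sup>+R. w R * (\<integral>\<^sup>+t\<in>I. (\<integral>\<^sup>+s\<in>I. (\<integral>\<^sup>+z. cutoff R (snd z) * k t s z \<partial>lborel) \<partial>lborel) \<partial>lborel) \<partial>lborel)"
    unfolding cutoff_def k_def by (simp add: nn_integral_cmult mult.assoc)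
  also have "\<dots> \<le> (\<integral>\<^sup>+R. w R * (ennreal (16 * R * hls_const) * ?X) \<partial>lborel)"
  proof (rule nn_integral_mono)
    fix R :: real
    show "w R * (\<integral>\<^sup>+t\<in>I. (\<integral>\<^sup>+s\<in>I. (\<integral>\<^sup>+z. cutoff R (snd z) * k t s z \<partial>lborel) \<partial>lborel) \<partial>lborel) \<le> w R * (ennreal (16 * R * hls_const) * ?X)"
    proof (cases "1 \<le> R")
      case True
      have ind: "cutoff R v = indicator {v. norm v \<le> R} v" for v by (simp add: cutoff_def)
      show ?thesis
        unfolding ind k_def using True by (intro mult_left_mono averaging_ball) auto
    qed (simp add: w_def)
  qed
  also have "\<dots> = (\<integral>\<^sup>+R. (ennreal (32 * a * hls_const) * ?X) * (ennreal (R powr (-(2*a))) * indicator {1..} R) \<partial>lborel)"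
  proof (rule nn_integral_cong)
    fix R :: real
    have "ennreal (2*a * R powr (-(2*a)-1)) * ennreal (16 * R * hls_const) = ennreal (32 * a * hls_const) * ennreal (R powr (-(2*a)))" if "1 \<le> R"
    proof -
      have "R powr (-(2*a)-1) * R = R powr (-(2*a))"
        using that powr_add[of R "-(2*a)-1" 1] by simp
      then have "2*a * R powr (-(2*a)-1) * (16 * R * hls_const) = 32 * a * hls_const * R powr (-(2*a))"
        by (simp add: ac_simps)
      then show ?thesis using that a by (simp add: hls_const_def flip: ennreal_mult)
    qed
    moreover have "p * (q * X) = (r * X) * t" if "p * q = r * t" for p q r t X :: ennreal
    proof -
      have "p * (q * X) = (p * q) * X" by (simp only: mult.assoc)
      then show ?thesis by (simp only: that ac_simps)
    qed
    ultimately show "w R * (ennreal (16 * R * hls_const) * ?X) = (ennreal (32 * a * hls_const) * ?X) * (ennreal (R powr (-(2*a))) * indicator {1..} R)"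
      unfolding w_def by (cases "1 \<le> R") (simp_all only: atLeast_iff indicator_simps mult_1_right mult_zero_right mult_zero_left not_False_eq_True)
  qed
  also have "\<dots> = (ennreal (32 * a * hls_const) * ?X) * (\<integral>\<^sup>+R\<in>{1..}. ennreal (R powr (-(2*a))) \<partial>lborel)"
    by (rule nn_integral_cmult) measurable
  also have "(\<integral>\<^sup>+R\<in>{1..}. ennreal (R powr (-(2*a))) \<partial>lborel) = ennreal (1 / (2*a - 1))"
    using nn_integral_powr_inf[of "-(2*a)" 1] a by simp
  also have "(ennreal (32 * a * hls_const) * ?X) * ennreal (1 / (2*a - 1)) = ennreal (32 * a * hls_const / (2*a - 1)) * ?X"
  proof -
    have "ennreal (32 * a * hls_const) * ennreal (1 / (2*a - 1)) = ennreal (32 * a * hls_const / (2*a - 1))"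
      using a by (simp add: hls_const_def flip: ennreal_mult)
    moreover have "(r * X) * t = (r * t) * X" for r t X :: ennreal
      by (simp only: ac_simps)
    ultimately show ?thesis by (simp only:)
  qed
  finally show ?thesis by (simp add: k_def)
qed

text \<open>Integrating B against F over v first gives a function \<psi>(t, x), and what is left is
  the density of a transported function tested with \<psi>. Thus \<open>TT_star\<close> meets
  exactly the correlation in \<open>averaging\<close>. Cauchy-Schwarz in v and Hoelder in x put
  \<psi> into L^(4/3)_x, from L^2 for B and L^4_x L^2_v for F; F is bounded uniformly in time, which
  gives the length of the interval.\<close>

theorem loss_estimate:
  fixes A B :: "R2 \<times> R2 \<Rightarrow> ennreal" and F :: "real \<times> R2 \<times> R2 \<Rightarrow> ennreal"
  assumes [measurable]: "A \<in> borel_measurable borel" "B \<in> borel_measurable borel" "F \<in> borel_measurable borel"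
    and a: "1/2 < a" and bc: "b \<le> c"
    and F: "AE t in lborel. t \<in> {b..c} \<longrightarrow> L42 F t \<le> C"
  shows "(\<integral>\<^sup>+t\<in>{b..c}. (\<integral>\<^sup>+x. \<integral>\<^sup>+v. B (x - t *\<^sub>R v, v) * F (t, x, v) *
      (\<integral>\<^sup>+u. jw (-a) u * A (x - t *\<^sub>R u, u) \<partial>lborel) \<partial>lborel \<partial>lborel) \<partial>lborel)
    \<le> ennpowr (ennreal (32 * a * hls_const / (2 * a - 1)) * ennreal (c - b)) (1/2) * C * (L2norm A * L2norm B)"
proof -
  define \<psi> where "\<psi> y = (\<integral>\<^sup>+v. B (snd y - fst y *\<^sub>R v, v) * F (fst y, snd y, v) \<partial>lborel)" for y
  have [measurable]: "\<psi> \<in> borel_measurable borel" unfolding \<psi>_def by measurable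
  define \<phi> where "\<phi> w = jw (-a) (snd (snd w)) * \<psi> (fst w, fst (snd w))" for w :: "real \<times> R2 \<times> R2"
  have [measurable]: "\<phi> \<in> borel_measurable borel" unfolding \<phi>_def by measurable
  let ?N = "\<lambda>t. \<integral>\<^sup>+x. ennpowr (\<psi> (t, x)) (4/3) \<partial>lborel"
  let ?K = "ennreal (32 * a * hls_const / (2 * a - 1))"
  have inner: "(\<integral>\<^sup>+x. \<integral>\<^sup>+v. B (x - t *\<^sub>R v, v) * F (t, x, v) * (\<integral>\<^sup>+u. jw (-a) u * A (x - t *\<^sub>R u, u) \<partial>lborel) \<partial>lborel \<partial>lborel)
    = (\<integral>\<^sup>+z. A (fst z - t *\<^sub>R snd z, snd z) * \<phi> (t, z) \<partial>lborel)" for t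
  proof -
    have "(\<integral>\<^sup>+x. \<integral>\<^sup>+v. B (x - t *\<^sub>R v, v) * F (t, x, v) * (\<integral>\<^sup>+u. jw (-a) u * A (x - t *\<^sub>R u, u) \<partial>lborel) \<partial>lborel \<partial>lborel)
      = (\<integral>\<^sup>+x. \<psi> (t, x) * (\<integral>\<^sup>+u. jw (-a) u * A (x - t *\<^sub>R u, u) \<partial>lborel) \<partial>lborel)"
      by (simp add: \<psi>_def nn_integral_multc)
    also have "\<dots> = (\<integral>\<^sup>+x. \<integral>\<^sup>+u. A (x - t *\<^sub>R u, u) * \<phi> (t, x, u) \<partial>lborel \<partial>lborel)"
      by (simp add: \<phi>_def nn_integral_cmult[symmetric] ac_simps)
    also have "\<dots> = (\<integral>\<^sup>+z. A (fst z - t *\<^sub>R snd z, snd z) * \<phi> (t, z) \<partial>lborel)"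
      by (subst nn_integral_lborel_pair) auto
    finally show ?thesis .
  qed
  have N: "?N t \<le> ennpowr (L2norm B * L42 F t) (4/3)" for t
  proof -
    let ?\<beta> = "\<lambda>x. \<integral>\<^sup>+v. (B (x - t *\<^sub>R v, v))\<^sup>2 \<partial>lborel" and ?\<kappa> = "\<lambda>x. \<integral>\<^sup>+v. (F (t, x, v))\<^sup>2 \<partial>lborel"
    have "?N t \<le> (\<integral>\<^sup>+x. ennpowr (ennpowr (?\<beta> x) (1/2) * ennpowr (?\<kappa> x) (1/2)) (4/3) \<partial>lborel)"
    proof (intro nn_integral_mono ennpowr_mono)
      fix x
      show "\<psi> (t, x) \<le> ennpowr (?\<beta> x) (1/2) * ennpowr (?\<kappa> x) (1/2)"
        using nn_integral_Cauchy_Schwarz[of "\<lambda>v. B (x - t *\<^sub>R v, v)" lborel "\<lambda>v. F (t, x, v)"] by (simp add: \<psi>_def)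
    qed simp
    also have "\<dots> = (\<integral>\<^sup>+x. ennpowr (?\<beta> x) (2/3) * ennpowr ((?\<kappa> x)\<^sup>2) (1/3) \<partial>lborel)"
      by (simp add: ennpowr_mult ennpowr_ennpowr flip: ennpowr_2)
    also have "\<dots> \<le> ennpowr (\<integral>\<^sup>+x. ?\<beta> x \<partial>lborel) (2/3) * ennpowr (\<integral>\<^sup>+x. (?\<kappa> x)\<^sup>2 \<partial>lborel) (1/3)"
      by (rule nn_integral_Holder2) auto
    also have "(\<integral>\<^sup>+x. ?\<beta> x \<partial>lborel) = (\<integral>\<^sup>+z. (B z)\<^sup>2 \<partial>lborel)"
      using nn_integral_transport[of "\<lambda>z. (B z)\<^sup>2" "-t"] nn_integral_lborel_pair[of "\<lambda>z. (B z)\<^sup>2"] by simp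
    finally show ?thesis
      by (simp add: L2norm_def L42_def ennpowr_mult ennpowr_ennpowr)
  qed
  have N': "(\<integral>\<^sup>+t\<in>{b..c}. ennpowr (?N t) (3/2) \<partial>lborel) \<le> ennreal (c - b) * (L2norm B * C)\<^sup>2"
  proof -
    have "(\<integral>\<^sup>+t\<in>{b..c}. ennpowr (?N t) (3/2) \<partial>lborel) \<le> (\<integral>\<^sup>+t. (L2norm B * C)\<^sup>2 * indicator {b..c} t \<partial>lborel)"
    proof (rule nn_integral_mono_AE)
      show "AE t in lborel. ennpowr (?N t) (3/2) * indicator {b..c} t \<le> (L2norm B * C)\<^sup>2 * indicator {b..c} t"
        using F
      proof eventually_elim
        case (elim t)
        have "ennpowr (?N t) (3/2) \<le> ennpowr (ennpowr (L2norm B * L42 F t) (4/3)) (3/2)"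
          by (intro ennpowr_mono N) simp
        also have "\<dots> = (L2norm B * L42 F t)\<^sup>2" by (simp add: ennpowr_ennpowr ennpowr_2)
        finally have "ennpowr (?N t) (3/2) \<le> (L2norm B * L42 F t)\<^sup>2" .
        moreover have "(L2norm B * L42 F t)\<^sup>2 \<le> (L2norm B * C)\<^sup>2" if "t \<in> {b..c}"
          using elim that by (intro power_mono mult_left_mono) auto
        ultimately show ?case by (auto split: split_indicator intro: order.trans)
      qed
    qed
    also have "\<dots> = (L2norm B * C)\<^sup>2 * ennreal (c - b)"
      using bc by (subst nn_integral_cmult_indicator) auto
    finally show ?thesis by (simp add: mult.commute)
  qed
  have Y: "(\<integral>\<^sup>+t\<in>{b..c}. (\<integral>\<^sup>+s\<in>{b..c}. (\<integral>\<^sup>+z. \<phi> (t, z) * \<phi> (s, fst z + (s - t) *\<^sub>R snd z, snd z) \<partial>lborel) \<partial>lborel) \<partial>lborel)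
    \<le> ?K * (ennreal (c - b) * (L2norm B * C)\<^sup>2)"
  proof -
    have "\<phi> (t, z) * \<phi> (s, fst z + (s - t) *\<^sub>R snd z, snd z)
      = jw (-(2*a)) (snd z) * (\<psi> (t, fst z) * \<psi> (s, fst z + (s - t) *\<^sub>R snd z))" for t s z
    proof -
      have "jw (-(2*a)) (snd z) = jw (-a) (snd z) * jw (-a) (snd z)"
        by (simp add: jw_mult)
      then show ?thesis by (simp add: \<phi>_def ac_simps)
    qed
    then have "(\<integral>\<^sup>+t\<in>{b..c}. (\<integral>\<^sup>+s\<in>{b..c}. (\<integral>\<^sup>+z. \<phi> (t, z) * \<phi> (s, fst z + (s - t) *\<^sub>R snd z, snd z) \<partial>lborel) \<partial>lborel) \<partial>lborel)
      \<le> ?K * (\<integral>\<^sup>+t\<in>{b..c}. ennpowr (?N t) (3/2) \<partial>lborel)"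
      using averaging[of \<psi> "{b..c}" a] a by simp
    also have "\<dots> \<le> ?K * (ennreal (c - b) * (L2norm B * C)\<^sup>2)"
      using N' by (intro mult_left_mono) auto
    finally show ?thesis .
  qed
  have "(\<integral>\<^sup>+t\<in>{b..c}. (\<integral>\<^sup>+z. A (fst z - t *\<^sub>R snd z, snd z) * \<phi> (t, z) \<partial>lborel) \<partial>lborel)
    \<le> L2norm A * ennpowr (\<integral>\<^sup>+t\<in>{b..c}. (\<integral>\<^sup>+s\<in>{b..c}. (\<integral>\<^sup>+z. \<phi> (t, z) * \<phi> (s, fst z + (s - t) *\<^sub>R snd z, snd z) \<partial>lborel) \<partial>lborel) \<partial>lborel) (1/2)"
    unfolding L2norm_def by (rule TT_star) auto
  also have "\<dots> \<le> L2norm A * ennpowr (?K * (ennreal (c - b) * (L2norm B * C)\<^sup>2)) (1/2)"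
    using Y by (intro mult_left_mono ennpowr_mono) auto
  also have "\<dots> = ennpowr (?K * ennreal (c - b)) (1/2) * C * (L2norm A * L2norm B)"
    by (simp add: ennpowr_mult ennpowr_half_sq ac_simps)
  finally show ?thesis unfolding inner .
qed

section \<open>The iteration in time\<close>

lemma AE_lborel_pair:
  fixes P :: "'a::euclidean_space \<times> 'b::euclidean_space \<Rightarrow> bool"
  assumes "AE p in lborel. P p"
  shows "AE x in lborel. AE y in lborel. P (x, y)"
  using lborel_pair.AE_pair[of P] assms unfolding lborel_prod by simp

text \<open>In the coordinates of \<open>nQ_relative\<close> the outgoing velocity is an invertible
  affine function of z for almost every angle, so it falls into a null set for almost no z.\<close>

lemma nQ_null:
  assumes [measurable]: "Z \<in> sets borel" and Z: "emeasure lborel Z = 0"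
  shows "nQ (indicator Z) (\<lambda>_. 1) v = 0"
proof -
  have [measurable]: "(indicator Z :: R2 \<Rightarrow> ennreal) \<in> borel_measurable borel"
    by (rule borel_measurable_indicator) fact
  have "nQ (indicator Z) (\<lambda>_. 1) v = (\<integral>\<^sup>+\<theta>\<in>{0..2*pi}. (\<integral>\<^sup>+z. indicator Z (v + cos \<theta> *\<^sub>R rot \<theta> z) * 1 \<partial>lborel) \<partial>lborel)"
    by (rule nQ_relative) auto
  also have "\<dots> = (\<integral>\<^sup>+(\<theta>::real). 0 \<partial>lborel)"
  proof (rule nn_integral_cong_AE)
    show "AE \<theta> in lborel. (\<integral>\<^sup>+z. indicator Z (v + cos \<theta> *\<^sub>R rot \<theta> z) * 1 \<partial>lborel) * indicator {0..2*pi} \<theta> = (0::ennreal)"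
      using AE_angle
    proof eventually_elim
      case (elim \<theta>)
      then show ?case
        using nn_integral_rot_shift[of "indicator Z" "cos \<theta>" v \<theta>] Z by simp
    qed
  qed
  finally show ?thesis by simp
qed

text \<open>The second outgoing velocity is handled by the symmetry of \<open>nQ\<close>. The
  purpose is to evaluate functions known only up to null sets of velocities at the outgoing
  velocities of a collision.\<close>

lemma AE_collision:
  assumes Z: "Z \<in> sets borel" "emeasure lborel Z = 0"
  shows "AE \<theta> in lborel. \<theta> \<in> {0..2*pi} \<longrightarrow> (AE u in lborel. post_v (circle_pt \<theta>) v u \<notin> Z \<and> post_u (circle_pt \<theta>) v u \<notin> Z)"
proof -
  have [measurable]: "(indicator Z :: R2 \<Rightarrow> ennreal) \<in> borel_measurable borel"
    by (rule borel_measurable_indicator) fact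
  have 1: "nQ (indicator Z) (\<lambda>_. 1) v = 0" "nQ (\<lambda>_. 1) (indicator Z) v = 0"
    using nQ_null[OF Z] nQ_commute[of "indicator Z" "\<lambda>_. 1" v] by simp_all
  have m: "(\<lambda>\<theta>. (\<integral>\<^sup>+u. indicator Z (post_v (circle_pt \<theta>) v u) * (1::ennreal) \<partial>lborel) * indicator {0..2*pi} \<theta>) \<in> borel_measurable lborel"
    "(\<lambda>\<theta>. (\<integral>\<^sup>+u. (1::ennreal) * indicator Z (post_u (circle_pt \<theta>) v u) \<partial>lborel) * indicator {0..2*pi} \<theta>) \<in> borel_measurable lborel"
    by measurable
  have "AE \<theta> in lborel. (\<integral>\<^sup>+u. indicator Z (post_v (circle_pt \<theta>) v u) * (1::ennreal) \<partial>lborel) * indicator {0..2*pi} \<theta> = 0"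
    "AE \<theta> in lborel. (\<integral>\<^sup>+u. (1::ennreal) * indicator Z (post_u (circle_pt \<theta>) v u) \<partial>lborel) * indicator {0..2*pi} \<theta> = 0"
    using 1 nn_integral_0_iff_AE[OF m(1)] nn_integral_0_iff_AE[OF m(2)] by (simp_all only: nQ_def)
  then show ?thesis
  proof eventually_elim
    case (elim \<theta>)
    show ?case
    proof
      assume \<theta>: "\<theta> \<in> {0..2*pi}"
      have "AE u in lborel. indicator Z (post_v (circle_pt \<theta>) v u) = (0::ennreal)"
        "AE u in lborel. indicator Z (post_u (circle_pt \<theta>) v u) = (0::ennreal)"
        using elim \<theta> by (simp_all add: nn_integral_0_iff_AE)
      then show "AE u in lborel. post_v (circle_pt \<theta>) v u \<notin> Z \<and> post_u (circle_pt \<theta>) v u \<notin> Z"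
        by eventually_elim (auto simp: indicator_def split: if_splits)
    qed
  qed
qed

lemma AE_collision_prop:
  assumes "AE v in lborel. P v"
  shows "AE \<theta> in lborel. \<theta> \<in> {0..2*pi} \<longrightarrow> (AE u in lborel. P (post_v (circle_pt \<theta>) v u) \<and> P (post_u (circle_pt \<theta>) v u))"
proof -
  obtain Z where Z: "{v. \<not> P v} \<subseteq> Z" "emeasure lborel Z = 0" "Z \<in> sets borel"
    using AE_E[OF assms] by auto
  show ?thesis
    using AE_collision[OF Z(3,2), of v]
  proof eventually_elim
    case (elim \<theta>)
    show ?case
    proof
      assume "\<theta> \<in> {0..2*pi}"
      with elim have "AE u in lborel. post_v (circle_pt \<theta>) v u \<notin> Z \<and> post_u (circle_pt \<theta>) v u \<notin> Z" by simp
      then show "AE u in lborel. P (post_v (circle_pt \<theta>) v u) \<and> P (post_u (circle_pt \<theta>) v u)"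
        by eventually_elim (use Z(1) in auto)
    qed
  qed
qed

text \<open>An exceptional null set of velocities is not met by almost every collision, so a bound
  valid almost everywhere suffices.\<close>

lemma nQ_mono_AE:
  assumes "AE v in lborel. p v \<le> p' v"
  shows "nQ p q v \<le> nQ p' q v"
  unfolding nQ_def
proof (rule nn_integral_mono_AE)
  show "AE \<theta> in lborel. (\<integral>\<^sup>+u. p (post_v (circle_pt \<theta>) v u) * q (post_u (circle_pt \<theta>) v u) \<partial>lborel) * indicator {0..2*pi} \<theta>
    \<le> (\<integral>\<^sup>+u. p' (post_v (circle_pt \<theta>) v u) * q (post_u (circle_pt \<theta>) v u) \<partial>lborel) * indicator {0..2*pi} \<theta>"
    using AE_collision_prop[OF assms, of v]
  proof eventually_elim
    case (elim \<theta>)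
    show ?case
    proof (cases "\<theta> \<in> {0..2*pi}")
      case True
      with elim have "AE u in lborel. p (post_v (circle_pt \<theta>) v u) \<le> p' (post_v (circle_pt \<theta>) v u)" by auto
      then have "(\<integral>\<^sup>+u. p (post_v (circle_pt \<theta>) v u) * q (post_u (circle_pt \<theta>) v u) \<partial>lborel)
        \<le> (\<integral>\<^sup>+u. p' (post_v (circle_pt \<theta>) v u) * q (post_u (circle_pt \<theta>) v u) \<partial>lborel)"
        by (intro nn_integral_mono_AE, elim eventually_mono) (rule mult_right_mono, auto)
      then show ?thesis by (rule mult_right_mono) simp
    qed simp
  qed
qed

lemma L2norm_power2: "(L2norm A)\<^sup>2 = (\<integral>\<^sup>+z. (A z)\<^sup>2 \<partial>lborel)"
  by (simp add: L2norm_def sq_ennpowr_half)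

text \<open>Coefficient of the square root of the step length. The summands belong to the gain term,
  to the loss term with the density of a solution, and to the loss term with the density of the
  difference.\<close>

definition small_const :: "real \<Rightarrow> ennreal \<Rightarrow> ennreal \<Rightarrow> ennreal"
  where "small_const a C D = coll_const a * C * 4 + ennreal (2 * pi) * D
    + ennreal (2 * pi) * (ennpowr (ennreal (32 * a * hls_const / (2 * a - 1))) (1/2) * C)"

lemma small_const_finite:
  "1/2 < a \<Longrightarrow> C < top \<Longrightarrow> D < top \<Longrightarrow> small_const a C D < top"
  by (simp add: small_const_def ennreal_mult_less_top coll_const_finite ennpowr_less_top_iff)

text \<open>The bound for N is linear in w and w is dominated by the transported A, so testing with
  A gives three expressions quadratic in A. Two are \<open>gain_estimate\<close> and
  \<open>loss_estimate\<close>; in the third the flow preserves the L^2 norm, and Cauchy-Schwarz in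
  time applied to n gives D sqrt (c - b).\<close>

lemma collision_step:
  fixes N k w :: "real \<times> R2 \<times> R2 \<Rightarrow> ennreal" and \<rho> :: "real \<times> R2 \<Rightarrow> ennreal" and n :: "real \<Rightarrow> ennreal"
    and A :: "R2 \<times> R2 \<Rightarrow> ennreal"
  assumes [measurable]: "N \<in> borel_measurable borel" "k \<in> borel_measurable borel" "w \<in> borel_measurable borel"
      "\<rho> \<in> borel_measurable borel" "n \<in> borel_measurable borel" "A \<in> borel_measurable borel"
    and a: "1/2 < a" "a \<le> 1" and bc: "0 \<le> b" "b \<le> c"
    and N: "AE t in lborel. t \<in> {b..c} \<longrightarrow> (AE x in lborel. AE v in lborel. N (t, x, v)
        \<le> nQ (\<lambda>v. w (t, x, v)) (\<lambda>v. k (t, x, v)) v + ennreal (2 * pi) * (w (t, x, v) * \<rho> (t, x))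
          + ennreal (2 * pi) * (k (t, x, v) * (\<integral>\<^sup>+u. w (t, x, u) \<partial>lborel)))"
    and w: "AE t in lborel. t \<in> {b..c} \<longrightarrow> (AE x in lborel. AE v in lborel. w (t, x, v) \<le> jw (-a) v * A (x - t *\<^sub>R v, v))"
    and k: "AE t in lborel. t \<in> {b..c} \<longrightarrow> L42 (\<lambda>p. jw a (snd (snd p)) * k p) t \<le> C"
    and \<rho>: "AE t in lborel. t \<in> {b..c} \<longrightarrow> (AE x in lborel. \<rho> (t, x) \<le> n t)"
    and n: "ennpowr (\<integral>\<^sup>+t\<in>{b..c}. (n t)\<^sup>2 \<partial>lborel) (1/2) \<le> D"
  shows "(\<integral>\<^sup>+t\<in>{b..c}. (\<integral>\<^sup>+x. \<integral>\<^sup>+v. A (x - t *\<^sub>R v, v) * (jw a v * N (t, x, v)) \<partial>lborel \<partial>lborel) \<partial>lborel)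
    \<le> small_const a C D * ennreal (sqrt (c - b)) * (L2norm A)\<^sup>2"
proof -
  define F where "F = (\<lambda>p. jw a (snd (snd p)) * k p)"
  have [measurable]: "F \<in> borel_measurable borel" unfolding F_def by measurable
  have kF: "k (t, x, v) = jw (-a) v * F (t, x, v)" for t x v by (simp add: F_def)
  let ?A = "\<lambda>t x v. A (x - t *\<^sub>R v, v)"
  let ?G1 = "\<lambda>t. \<integral>\<^sup>+x. \<integral>\<^sup>+v. ?A t x v * jw a v * nQ (\<lambda>v. jw (-a) v * ?A t x v) (\<lambda>v. jw (-a) v * F (t, x, v)) v \<partial>lborel \<partial>lborel"
  let ?G3 = "\<lambda>t. \<integral>\<^sup>+x. \<integral>\<^sup>+v. ?A t x v * F (t, x, v) * (\<integral>\<^sup>+u. jw (-a) u * ?A t x u \<partial>lborel) \<partial>lborel \<partial>lborel"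
  have [measurable]: "?G1 \<in> borel_measurable borel" unfolding nQ_def by measurable
  have slice: "(\<integral>\<^sup>+x. \<integral>\<^sup>+v. ?A t x v * (jw a v * N (t, x, v)) \<partial>lborel \<partial>lborel)
      \<le> ?G1 t + ennreal (2 * pi) * (n t * (L2norm A)\<^sup>2) + ennreal (2 * pi) * ?G3 t"
    if N: "AE x in lborel. AE v in lborel. N (t, x, v)
        \<le> nQ (\<lambda>v. w (t, x, v)) (\<lambda>v. k (t, x, v)) v + ennreal (2 * pi) * (w (t, x, v) * \<rho> (t, x))
          + ennreal (2 * pi) * (k (t, x, v) * (\<integral>\<^sup>+u. w (t, x, u) \<partial>lborel))"
      and w: "AE x in lborel. AE v in lborel. w (t, x, v) \<le> jw (-a) v * ?A t x v"
      and \<rho>: "AE x in lborel. \<rho> (t, x) \<le> n t" for t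
  proof -
    have [measurable]: "(\<lambda>y. nQ (\<lambda>v. jw (-a) v * A (fst y - t *\<^sub>R v, v)) (\<lambda>v. jw (-a) v * F (t, fst y, v)) (snd y)) \<in> borel_measurable borel"
      unfolding nQ_def by measurable
    have [measurable]: "(\<lambda>v. nQ (\<lambda>v. jw (-a) v * A (x - t *\<^sub>R v, v)) (\<lambda>v. jw (-a) v * F (t, x, v)) v) \<in> borel_measurable borel" for x
      unfolding nQ_def by measurable
    have [measurable]: "(\<lambda>x. \<integral>\<^sup>+v. ?A t x v * jw a v * nQ (\<lambda>v. jw (-a) v * ?A t x v) (\<lambda>v. jw (-a) v * F (t, x, v)) v \<partial>lborel) \<in> borel_measurable borel"
      unfolding nQ_def by measurable
    have "(\<integral>\<^sup>+x. \<integral>\<^sup>+v. ?A t x v * (jw a v * N (t, x, v)) \<partial>lborel \<partial>lborel)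
      \<le> (\<integral>\<^sup>+x. (\<integral>\<^sup>+v. ?A t x v * jw a v * nQ (\<lambda>v. jw (-a) v * ?A t x v) (\<lambda>v. jw (-a) v * F (t, x, v)) v \<partial>lborel)
          + ennreal (2 * pi) * (n t * (\<integral>\<^sup>+v. (?A t x v)\<^sup>2 \<partial>lborel))
          + ennreal (2 * pi) * (\<integral>\<^sup>+v. ?A t x v * F (t, x, v) * (\<integral>\<^sup>+u. jw (-a) u * ?A t x u \<partial>lborel) \<partial>lborel) \<partial>lborel)"
    proof (rule nn_integral_mono_AE)
      show "AE x in lborel. (\<integral>\<^sup>+v. ?A t x v * (jw a v * N (t, x, v)) \<partial>lborel)
        \<le> (\<integral>\<^sup>+v. ?A t x v * jw a v * nQ (\<lambda>v. jw (-a) v * ?A t x v) (\<lambda>v. jw (-a) v * F (t, x, v)) v \<partial>lborel)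
          + ennreal (2 * pi) * (n t * (\<integral>\<^sup>+v. (?A t x v)\<^sup>2 \<partial>lborel))
          + ennreal (2 * pi) * (\<integral>\<^sup>+v. ?A t x v * F (t, x, v) * (\<integral>\<^sup>+u. jw (-a) u * ?A t x u \<partial>lborel) \<partial>lborel)"
        using N w \<rho>
      proof eventually_elim
        case (elim x)
        let ?M = "\<integral>\<^sup>+u. jw (-a) u * ?A t x u \<partial>lborel"
        have M: "(\<integral>\<^sup>+u. w (t, x, u) \<partial>lborel) \<le> ?M"
          using elim(2) by (rule nn_integral_mono_AE)
        have Q: "nQ (\<lambda>v. w (t, x, v)) (\<lambda>v. k (t, x, v)) v \<le> nQ (\<lambda>v. jw (-a) v * ?A t x v) (\<lambda>v. jw (-a) v * F (t, x, v)) v" for v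
          unfolding kF[symmetric] using elim(2) by (rule nQ_mono_AE)
        have "(\<integral>\<^sup>+v. ?A t x v * (jw a v * N (t, x, v)) \<partial>lborel)
          \<le> (\<integral>\<^sup>+v. ?A t x v * jw a v * nQ (\<lambda>v. jw (-a) v * ?A t x v) (\<lambda>v. jw (-a) v * F (t, x, v)) v
            + ennreal (2 * pi) * (n t * (?A t x v)\<^sup>2) + ennreal (2 * pi) * (?A t x v * F (t, x, v) * ?M) \<partial>lborel)"
        proof (rule nn_integral_mono_AE)
          show "AE v in lborel. ?A t x v * (jw a v * N (t, x, v))
            \<le> ?A t x v * jw a v * nQ (\<lambda>v. jw (-a) v * ?A t x v) (\<lambda>v. jw (-a) v * F (t, x, v)) v
              + ennreal (2 * pi) * (n t * (?A t x v)\<^sup>2) + ennreal (2 * pi) * (?A t x v * F (t, x, v) * ?M)"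
            using elim(1,2)
          proof eventually_elim
            case (elim v)
            have "N (t, x, v) \<le> nQ (\<lambda>v. jw (-a) v * ?A t x v) (\<lambda>v. jw (-a) v * F (t, x, v)) v
              + ennreal (2 * pi) * ((jw (-a) v * ?A t x v) * n t) + ennreal (2 * pi) * ((jw (-a) v * F (t, x, v)) * ?M)"
              using elim(1)
              by (rule order.trans) (intro add_mono mult_mono Q M elim \<open>\<rho> (t, x) \<le> n t\<close> order.refl; simp add: kF)
            then have "?A t x v * (jw a v * N (t, x, v)) \<le> ?A t x v * (jw a v * (nQ (\<lambda>v. jw (-a) v * ?A t x v) (\<lambda>v. jw (-a) v * F (t, x, v)) v
              + ennreal (2 * pi) * ((jw (-a) v * ?A t x v) * n t) + ennreal (2 * pi) * ((jw (-a) v * F (t, x, v)) * ?M)))"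
              by (intro mult_left_mono) auto
            also have "\<dots> = ?A t x v * jw a v * nQ (\<lambda>v. jw (-a) v * ?A t x v) (\<lambda>v. jw (-a) v * F (t, x, v)) v
              + (jw a v * jw (-a) v) * (ennreal (2 * pi) * (n t * (?A t x v)\<^sup>2)) + (jw a v * jw (-a) v) * (ennreal (2 * pi) * (?A t x v * F (t, x, v) * ?M))"
              by (simp only: distrib_left power2_eq_square ac_simps)
            finally show ?case by simp
          qed
        qed
        also have "\<dots> = (\<integral>\<^sup>+v. ?A t x v * jw a v * nQ (\<lambda>v. jw (-a) v * ?A t x v) (\<lambda>v. jw (-a) v * F (t, x, v)) v \<partial>lborel)
          + ennreal (2 * pi) * (n t * (\<integral>\<^sup>+v. (?A t x v)\<^sup>2 \<partial>lborel))
          + ennreal (2 * pi) * (\<integral>\<^sup>+v. ?A t x v * F (t, x, v) * ?M \<partial>lborel)"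
          by (subst nn_integral_add, measurable, subst nn_integral_add, measurable) (simp add: nn_integral_cmult)
        finally show ?case .
      qed
    qed
    also have "\<dots> = ?G1 t + ennreal (2 * pi) * (n t * (\<integral>\<^sup>+x. \<integral>\<^sup>+v. (?A t x v)\<^sup>2 \<partial>lborel \<partial>lborel)) + ennreal (2 * pi) * ?G3 t"
      by (subst nn_integral_add, measurable, subst nn_integral_add, measurable) (simp add: nn_integral_cmult)
    also have "(\<integral>\<^sup>+x. \<integral>\<^sup>+v. (?A t x v)\<^sup>2 \<partial>lborel \<partial>lborel) = (L2norm A)\<^sup>2"
      using nn_integral_transport[of "\<lambda>z. (A z)\<^sup>2" "-t"] nn_integral_lborel_pair[of "\<lambda>z. (A z)\<^sup>2"] by (simp add: L2norm_power2)
    finally show ?thesis .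
  qed
  let ?S = "ennreal (sqrt (c - b))"
  have "(\<integral>\<^sup>+t\<in>{b..c}. (\<integral>\<^sup>+x. \<integral>\<^sup>+v. A (x - t *\<^sub>R v, v) * (jw a v * N (t, x, v)) \<partial>lborel \<partial>lborel) \<partial>lborel)
    \<le> (\<integral>\<^sup>+t. ?G1 t * indicator {b..c} t + (ennreal (2 * pi) * (L2norm A)\<^sup>2) * (n t * indicator {b..c} t) + ennreal (2 * pi) * (?G3 t * indicator {b..c} t) \<partial>lborel)"
  proof (rule nn_integral_mono_AE)
    show "AE t in lborel. (\<integral>\<^sup>+x. \<integral>\<^sup>+v. A (x - t *\<^sub>R v, v) * (jw a v * N (t, x, v)) \<partial>lborel \<partial>lborel) * indicator {b..c} t
      \<le> ?G1 t * indicator {b..c} t + (ennreal (2 * pi) * (L2norm A)\<^sup>2) * (n t * indicator {b..c} t) + ennreal (2 * pi) * (?G3 t * indicator {b..c} t)"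
      using N w \<rho>
    proof eventually_elim
      case (elim t)
      show ?case
      proof (cases "t \<in> {b..c}")
        case True
        then show ?thesis using slice[of t] elim by (simp add: ac_simps)
      qed simp
    qed
  qed
  also have "\<dots> = (\<integral>\<^sup>+t\<in>{b..c}. ?G1 t \<partial>lborel) + (ennreal (2 * pi) * (L2norm A)\<^sup>2) * (\<integral>\<^sup>+t\<in>{b..c}. n t \<partial>lborel)
      + ennreal (2 * pi) * (\<integral>\<^sup>+t\<in>{b..c}. ?G3 t \<partial>lborel)"
    by (subst nn_integral_add, measurable, subst nn_integral_add, measurable) (simp add: nn_integral_cmult)
  also have "\<dots> \<le> coll_const a * C * ennreal (4 * sqrt (c - b)) * (L2norm A * L2norm A)
      + (ennreal (2 * pi) * (L2norm A)\<^sup>2) * (D * ?S)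
      + ennreal (2 * pi) * (ennpowr (ennreal (32 * a * hls_const / (2 * a - 1)) * ennreal (c - b)) (1/2) * C * (L2norm A * L2norm A))"
  proof (intro add_mono mult_left_mono)
    show "(\<integral>\<^sup>+t\<in>{b..c}. ?G1 t \<partial>lborel) \<le> coll_const a * C * ennreal (4 * sqrt (c - b)) * (L2norm A * L2norm A)"
      by (rule gain_estimate) (use a bc k in \<open>auto simp: F_def\<close>)
    show "(\<integral>\<^sup>+t\<in>{b..c}. ?G3 t \<partial>lborel) \<le> ennpowr (ennreal (32 * a * hls_const / (2 * a - 1)) * ennreal (c - b)) (1/2) * C * (L2norm A * L2norm A)"
      by (rule loss_estimate) (use a bc k in \<open>auto simp: F_def\<close>)
    have "(\<integral>\<^sup>+t\<in>{b..c}. n t \<partial>lborel) = (\<integral>\<^sup>+t. (n t * indicator {b..c} t) * indicator {b..c} t \<partial>lborel)"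
      by (intro nn_integral_cong) (auto split: split_indicator)
    also have "\<dots> \<le> ennpowr (\<integral>\<^sup>+t. (n t * indicator {b..c} t)\<^sup>2 \<partial>lborel) (1/2) * ennpowr (\<integral>\<^sup>+t. (indicator {b..c} t)\<^sup>2 \<partial>lborel) (1/2)"
      by (rule nn_integral_Cauchy_Schwarz) measurable
    also have "(\<integral>\<^sup>+t. (n t * indicator {b..c} t)\<^sup>2 \<partial>lborel) = (\<integral>\<^sup>+t\<in>{b..c}. (n t)\<^sup>2 \<partial>lborel)"
      by (intro nn_integral_cong) (auto split: split_indicator)
    also have "(\<integral>\<^sup>+t. (indicator {b..c} t)\<^sup>2 \<partial>lborel) = (\<integral>\<^sup>+t. indicator {b..c} t \<partial>lborel)"
      by (intro nn_integral_cong) (auto split: split_indicator)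
    also have "ennpowr (\<integral>\<^sup>+t. indicator {b..c} t \<partial>lborel) (1/2) = ?S"
      using bc by (simp add: ennpowr_ennreal powr_half_sqrt)
    finally show "(\<integral>\<^sup>+t\<in>{b..c}. n t \<partial>lborel) \<le> D * ?S"
      using mult_right_mono[OF n, of ?S] by (rule order.trans) simp
  qed auto
  also have "\<dots> = small_const a C D * ?S * (L2norm A)\<^sup>2"
  proof -
    have "ennpowr (ennreal (c - b)) (1/2) = ?S"
      using bc by (simp add: ennpowr_ennreal powr_half_sqrt)
    moreover have "ennreal (4 * sqrt (c - b)) = 4 * ?S"
      using bc by (simp add: ennreal_mult)
    ultimately show ?thesis
      by (simp add: small_const_def ennpowr_mult power2_eq_square distrib_right distrib_left ac_simps)
  qed
  finally show ?thesis .
qed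

text \<open>Once the integral over earlier times is null, the squared norm of the dominating
  function on the next step is at most half of itself, hence zero by finiteness. The step length
  depends on the constants alone, so the induction reaches T.\<close>

theorem iteration_vanishes:
  fixes N k w :: "real \<times> R2 \<times> R2 \<Rightarrow> ennreal" and \<rho> :: "real \<times> R2 \<Rightarrow> ennreal" and n :: "real \<Rightarrow> ennreal"
  assumes [measurable]: "N \<in> borel_measurable borel" "k \<in> borel_measurable borel" "w \<in> borel_measurable borel"
      "\<rho> \<in> borel_measurable borel" "n \<in> borel_measurable borel"
    and a: "1/2 < a" "a \<le> 1" and T: "0 < T"
    and N: "AE t in lborel. t \<in> {0..T} \<longrightarrow> (AE x in lborel. AE v in lborel. N (t, x, v)
        \<le> nQ (\<lambda>v. w (t, x, v)) (\<lambda>v. k (t, x, v)) v + ennreal (2 * pi) * (w (t, x, v) * \<rho> (t, x))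
          + ennreal (2 * pi) * (k (t, x, v) * (\<integral>\<^sup>+u. w (t, x, u) \<partial>lborel)))"
    and w: "AE t in lborel. t \<in> {0..T} \<longrightarrow> (AE x in lborel. AE v in lborel.
        w (t, x, v) \<le> (\<integral>\<^sup>+s\<in>{0..t}. N (s, x - (t - s) *\<^sub>R v, v) \<partial>lborel))"
    and k: "AE t in lborel. t \<in> {0..T} \<longrightarrow> L42 (\<lambda>p. jw a (snd (snd p)) * k p) t \<le> C" and C: "C < top"
    and \<rho>: "AE t in lborel. t \<in> {0..T} \<longrightarrow> (AE x in lborel. \<rho> (t, x) \<le> n t)"
    and n: "(\<integral>\<^sup>+t\<in>{0..T}. (n t)\<^sup>2 \<partial>lborel) < top"
    and fin: "L2norm (\<lambda>z. jw a (snd z) * (\<integral>\<^sup>+s\<in>{0..T}. N (s, fst z + s *\<^sub>R snd z, snd z) \<partial>lborel)) < top"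
  shows "AE z in lborel. (\<integral>\<^sup>+s\<in>{0..T}. N (s, fst z + s *\<^sub>R snd z, snd z) \<partial>lborel) = 0"
proof -
  define I where "I c z = (\<integral>\<^sup>+s\<in>{0..c}. N (s, fst z + s *\<^sub>R snd z, snd z) \<partial>lborel)" for c z
  define A where "A c z = jw a (snd z) * I c z" for c z
  have [measurable]: "I c \<in> borel_measurable borel" for c unfolding I_def by measurable
  have [measurable]: "A c \<in> borel_measurable borel" for c unfolding A_def by measurable
  define D where "D = ennpowr (\<integral>\<^sup>+t\<in>{0..T}. (n t)\<^sup>2 \<partial>lborel) (1/2)"
  have "small_const a C D < top"
    using a C n by (intro small_const_finite) (auto simp: D_def ennpowr_less_top_iff)
  then obtain m where m: "small_const a C D = ennreal m" "0 \<le> m" by (cases "small_const a C D") auto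
  \<comment> \<open>With \<tau> = T/K this gives \<tau> (2m + 1)^2 \<le> 1 and so m sqrt \<tau>
    \<le> 1/2; the added 1 keeps K positive when m = 0.\<close>
  obtain K :: nat where K: "T * (2 * m + 1)\<^sup>2 \<le> real K"
    using real_arch_simple by blast
  have "0 < T * (2 * m + 1)\<^sup>2" using T m by simp
  then have K0: "0 < real K" using K by linarith
  define \<tau> where "\<tau> = T / real K"
  have \<tau>: "0 < \<tau>" "\<tau> * real K = T" using T K0 by (simp_all add: \<tau>_def)
  have small: "m * sqrt \<tau> \<le> 1/2"
  proof -
    have "\<tau> * (2 * m + 1)\<^sup>2 \<le> 1" using K K0 by (simp add: \<tau>_def field_simps)
    then have "sqrt (\<tau> * (2 * m + 1)\<^sup>2) \<le> sqrt 1" by (rule real_sqrt_le_mono)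
    then have "sqrt \<tau> * (2 * m + 1) \<le> 1" using m by (simp add: real_sqrt_mult)
    then have "sqrt \<tau> + 2 * (m * sqrt \<tau>) \<le> 1" by (simp add: algebra_simps)
    moreover have "0 \<le> sqrt \<tau>" using \<tau> by simp
    ultimately show ?thesis by linarith
  qed
  have Imono: "I b z \<le> I c z" if "b \<le> c" for b c z
    unfolding I_def using that by (intro nn_integral_mono) (auto split: split_indicator)
  have sub: "AE t in lborel. t \<in> {b..c} \<longrightarrow> P t" if "AE t in lborel. t \<in> {0..T} \<longrightarrow> P t" "0 \<le> b" "c \<le> T" for b c P
    using that(1) by eventually_elim (use that(2,3) in auto)
  have "j \<le> K \<Longrightarrow> AE z in lborel. I (\<tau> * real j) z = 0" for j
  proof (induction j)
    case 0
    have "I 0 z = 0" for z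
    proof -
      have "I 0 z = (\<integral>\<^sup>+(s::real). 0 \<partial>lborel)"
        unfolding I_def
      proof (rule nn_integral_cong_AE)
        show "AE s in lborel. N (s, fst z + s *\<^sub>R snd z, snd z) * indicator {0..0} s = 0"
          using AE_lborel_singleton[of "0::real"] by eventually_elim simp
      qed
      then show ?thesis by simp
    qed
    then show ?case by simp
  next
    case (Suc j)
    define b where "b = \<tau> * real j"
    define c where "c = \<tau> * real (Suc j)"
    have bc: "0 \<le> b" "b \<le> c" "c - b = \<tau>" using \<tau> by (auto simp: b_def c_def algebra_simps)
    have "\<tau> * real (Suc j) \<le> \<tau> * real K" using \<tau> Suc.prems by (intro mult_left_mono) auto
    then have cT: "c \<le> T" using \<tau> by (simp add: c_def)
    have Ib: "AE z in lborel. I b z = 0" using Suc by (simp add: b_def)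
    define J where "J z = (\<integral>\<^sup>+s\<in>{b..c}. N (s, fst z + s *\<^sub>R snd z, snd z) \<partial>lborel)" for z
    have [measurable]: "J \<in> borel_measurable borel" unfolding J_def by measurable
    have split: "I c z \<le> I b z + J z" for z
    proof -
      have "I c z \<le> (\<integral>\<^sup>+s. N (s, fst z + s *\<^sub>R snd z, snd z) * indicator {0..b} s + N (s, fst z + s *\<^sub>R snd z, snd z) * indicator {b..c} s \<partial>lborel)"
        unfolding I_def by (intro nn_integral_mono) (auto split: split_indicator)
      also have "\<dots> = I b z + J z"
        unfolding I_def J_def by (rule nn_integral_add) measurable
      finally show ?thesis .
    qed
    \<comment> \<open>One factor is kept whole as the test function. In the other the part before
      time b vanishes by the induction hypothesis, so only the new interval remains.\<close>
    have "(L2norm (A c))\<^sup>2 = (\<integral>\<^sup>+z. A c z * (jw a (snd z) * I c z) \<partial>lborel)"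
      unfolding L2norm_power2 by (simp add: power2_eq_square A_def[symmetric])
    also have "\<dots> \<le> (\<integral>\<^sup>+z. A c z * (jw a (snd z) * J z) \<partial>lborel)"
    proof (rule nn_integral_mono_AE)
      show "AE z in lborel. A c z * (jw a (snd z) * I c z) \<le> A c z * (jw a (snd z) * J z)"
        using Ib
      proof eventually_elim
        case (elim z)
        then show ?case using split[of z] by (intro mult_left_mono) auto
      qed
    qed
    also have "\<dots> = (\<integral>\<^sup>+z. \<integral>\<^sup>+t. A c z * (jw a (snd z) * N (t, fst z + t *\<^sub>R snd z, snd z)) * indicator {b..c} t \<partial>lborel \<partial>lborel)"
      unfolding J_def by (simp add: nn_integral_cmult[symmetric] mult.assoc)
    also have "\<dots> = (\<integral>\<^sup>+t. \<integral>\<^sup>+z. A c z * (jw a (snd z) * N (t, fst z + t *\<^sub>R snd z, snd z)) * indicator {b..c} t \<partial>lborel \<partial>lborel)"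
      by (rule lborel_Fubini[symmetric]) measurable
    also have "\<dots> = (\<integral>\<^sup>+t\<in>{b..c}. (\<integral>\<^sup>+x. \<integral>\<^sup>+v. A c (x - t *\<^sub>R v, v) * (jw a v * N (t, x, v)) \<partial>lborel \<partial>lborel) \<partial>lborel)"
    proof (rule nn_integral_cong)
      fix t
      have "(\<integral>\<^sup>+z. A c z * (jw a (snd z) * N (t, fst z + t *\<^sub>R snd z, snd z)) * indicator {b..c} t \<partial>lborel)
        = (\<integral>\<^sup>+z. A c z * (jw a (snd z) * N (t, fst z + t *\<^sub>R snd z, snd z)) \<partial>lborel) * indicator {b..c} t"
        by (rule nn_integral_multc) measurable
      also have "(\<integral>\<^sup>+z. A c z * (jw a (snd z) * N (t, fst z + t *\<^sub>R snd z, snd z)) \<partial>lborel)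
        = (\<integral>\<^sup>+z. A c (fst z - t *\<^sub>R snd z, snd z) * (jw a (snd z) * N (t, z)) \<partial>lborel)"
        using nn_integral_transport_pair[of "\<lambda>z. A c (fst z - t *\<^sub>R snd z, snd z) * (jw a (snd z) * N (t, z))" t] by simp
      also have "\<dots> = (\<integral>\<^sup>+x. \<integral>\<^sup>+v. A c (x - t *\<^sub>R v, v) * (jw a v * N (t, x, v)) \<partial>lborel \<partial>lborel)"
        by (subst nn_integral_lborel_pair) auto
      finally show "(\<integral>\<^sup>+z. A c z * (jw a (snd z) * N (t, fst z + t *\<^sub>R snd z, snd z)) * indicator {b..c} t \<partial>lborel)
        = (\<integral>\<^sup>+x. \<integral>\<^sup>+v. A c (x - t *\<^sub>R v, v) * (jw a v * N (t, x, v)) \<partial>lborel \<partial>lborel) * indicator {b..c} t" .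
    qed
    also have "\<dots> \<le> small_const a C D * ennreal (sqrt (c - b)) * (L2norm (A c))\<^sup>2"
    proof (rule collision_step[where k = k and w = w and \<rho> = \<rho> and n = n])
      show "AE t in lborel. t \<in> {b..c} \<longrightarrow> (AE x in lborel. AE v in lborel. N (t, x, v)
        \<le> nQ (\<lambda>v. w (t, x, v)) (\<lambda>v. k (t, x, v)) v + ennreal (2 * pi) * (w (t, x, v) * \<rho> (t, x))
          + ennreal (2 * pi) * (k (t, x, v) * (\<integral>\<^sup>+u. w (t, x, u) \<partial>lborel)))"
        by (rule sub[OF N bc(1) cT])
      show "AE t in lborel. t \<in> {b..c} \<longrightarrow> L42 (\<lambda>p. jw a (snd (snd p)) * k p) t \<le> C"
        by (rule sub[OF k bc(1) cT])
      show "AE t in lborel. t \<in> {b..c} \<longrightarrow> (AE x in lborel. \<rho> (t, x) \<le> n t)"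
        by (rule sub[OF \<rho> bc(1) cT])
      show "ennpowr (\<integral>\<^sup>+t\<in>{b..c}. (n t)\<^sup>2 \<partial>lborel) (1/2) \<le> D"
        unfolding D_def using bc cT by (intro ennpowr_mono nn_integral_mono) (auto split: split_indicator)
      show "AE t in lborel. t \<in> {b..c} \<longrightarrow> (AE x in lborel. AE v in lborel. w (t, x, v) \<le> jw (-a) v * A c (x - t *\<^sub>R v, v))"
        using sub[OF w bc(1) cT]
      proof eventually_elim
        case (elim t)
        show ?case
        proof
          assume t: "t \<in> {b..c}"
          \<comment> \<open>The upper limit t is enlarged to c, which makes the dominating function
            independent of t apart from the transport.\<close>
          have bd: "(\<integral>\<^sup>+s\<in>{0..t}. N (s, x - (t - s) *\<^sub>R v, v) \<partial>lborel) \<le> jw (-a) v * A c (x - t *\<^sub>R v, v)" for x v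
          proof -
            have "(\<integral>\<^sup>+s\<in>{0..t}. N (s, x - (t - s) *\<^sub>R v, v) \<partial>lborel) = I t (x - t *\<^sub>R v, v)"
              unfolding I_def by (simp add: algebra_simps)
            also have "\<dots> \<le> I c (x - t *\<^sub>R v, v)" using t by (intro Imono) simp
            finally show ?thesis by (simp add: A_def)
          qed
          have "AE x in lborel. AE v in lborel. w (t, x, v) \<le> (\<integral>\<^sup>+s\<in>{0..t}. N (s, x - (t - s) *\<^sub>R v, v) \<partial>lborel)"
            using elim t by simp
          then show "AE x in lborel. AE v in lborel. w (t, x, v) \<le> jw (-a) v * A c (x - t *\<^sub>R v, v)"
            by (elim eventually_mono) (rule order.trans[OF _ bd])
        qed
      qed
    qed (use a bc in auto)
    also have "\<dots> \<le> ennreal (1/2) * (L2norm (A c))\<^sup>2"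
    proof (rule mult_right_mono)
      have "small_const a C D * ennreal (sqrt (c - b)) = ennreal (m * sqrt \<tau>)"
        using m \<tau> by (simp add: bc(3) ennreal_mult)
      also have "\<dots> \<le> ennreal (1/2)" using small by (rule ennreal_leI)
      finally show "small_const a C D * ennreal (sqrt (c - b)) \<le> ennreal (1/2)" .
    qed simp
    finally have half: "(L2norm (A c))\<^sup>2 \<le> ennreal (1/2) * (L2norm (A c))\<^sup>2" .
    have "L2norm (A c) \<le> L2norm (A T)"
      unfolding L2norm_def A_def using cT by (intro ennpowr_mono nn_integral_mono power_mono mult_left_mono Imono) auto
    also have "L2norm (A T) < top"
      using fin by (simp add: A_def[abs_def] I_def)
    finally obtain r where r: "L2norm (A c) = ennreal r" "0 \<le> r" by (cases "L2norm (A c)") auto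
    have "r\<^sup>2 \<le> 1/2 * r\<^sup>2"
      using half r by (simp only: ennreal_power ennreal_mult[symmetric] ennreal_le_iff zero_le_power2 mult_nonneg_nonneg)
    then have "r = 0" by simp
    then have "(\<integral>\<^sup>+z. (A c z)\<^sup>2 \<partial>lborel) = 0"
      using r by (simp flip: L2norm_power2)
    then have "AE z in lborel. (A c z)\<^sup>2 = 0"
      by (subst (asm) nn_integral_0_iff_AE) auto
    then have "AE z in lborel. I c z = 0"
      by eventually_elim (auto simp: A_def power2_eq_square less_imp_neq[symmetric])
    then show ?case by (simp add: c_def)
  qed
  from this[of K] show ?thesis using \<tau> by (simp add: I_def)
qed

section \<open>Borel representatives\<close>

lemma lebesgue_measurable_AE:
  fixes g g' :: "'a::euclidean_space \<Rightarrow> real"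
  assumes "g' \<in> borel_measurable borel" "AE x in lborel. g x = g' x"
  shows "g \<in> borel_measurable lebesgue"
proof (rule borel_measurable_AE)
  show "g' \<in> borel_measurable lebesgue" using assms(1) by (simp add: measurable_completion)
  show "AE x in lebesgue. g' x = g x"
    using assms(2) unfolding AE_completion_iff by (auto elim: eventually_mono)
qed

lemma integral_lebesgue_AE:
  fixes g g' :: "'a::euclidean_space \<Rightarrow> real"
  assumes "g' \<in> borel_measurable borel" "AE x in lborel. g x = g' x"
  shows "integral\<^sup>L lebesgue g = integral\<^sup>L lborel g'"
    and "integrable lebesgue g \<longleftrightarrow> integrable lborel g'"
proof -
  have g: "g \<in> borel_measurable lebesgue" by (rule lebesgue_measurable_AE[OF assms])
  have g': "g' \<in> borel_measurable lebesgue" using assms(1) by (simp add: measurable_completion)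
  have ae: "AE x in lebesgue. g x = g' x" using assms(2) by (rule AE_completion)
  show "integral\<^sup>L lebesgue g = integral\<^sup>L lborel g'"
    using integral_cong_AE[OF g g' ae] integral_completion[of g' lborel] assms(1) by simp
  show "integrable lebesgue g \<longleftrightarrow> integrable lborel g'"
    using integrable_cong_AE[OF g g' ae] integrable_completion[of g' lborel] assms(1) by simp
qed

lemma AE_lebesgue_on_iff:
  assumes "S \<in> sets lebesgue"
  shows "(AE x in lebesgue_on S. P x) \<longleftrightarrow> (AE x in lborel. x \<in> S \<longrightarrow> P x)"
  using assms by (simp add: AE_restrict_space_iff AE_completion_iff)

lemma nn_integral_lebesgue_on:
  assumes "S \<in> sets lebesgue"
  shows "(\<integral>\<^sup>+x. f x \<partial>lebesgue_on S) = (\<integral>\<^sup>+x\<in>S. f x \<partial>lborel)"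
  using assms by (simp add: nn_integral_restrict_space nn_integral_completion)

lemma AE_null_cover:
  fixes P :: "'a::euclidean_space \<Rightarrow> bool"
  assumes "AE x in lborel. P x"
  obtains Z where "Z \<in> sets borel" "(\<integral>\<^sup>+x. indicator Z x \<partial>lborel) = 0" "\<And>x. x \<notin> Z \<Longrightarrow> P x"
proof -
  obtain Z where "{x. \<not> P x} \<subseteq> Z" "emeasure lborel Z = 0" "Z \<in> sets borel"
    using AE_E[OF assms] by auto
  then show thesis by (intro that[of Z]) auto
qed

text \<open>Collision terms at (t, x, v) integrate over other velocities at the same (t, x). A null
  set of phase space-time must therefore have null velocity slices at almost every point, with the
  slice variable independent of the third coordinate of the point.\<close>

lemma AE_regroup:
  fixes P :: "real \<times> R2 \<times> R2 \<Rightarrow> bool"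
  assumes "AE p in lborel. P p"
  shows "AE p in (lborel :: (real \<times> R2 \<times> R2) measure). AE v in lborel. P (fst p, fst (snd p), v)"
    and "AE y in lborel. AE v in lborel. P (fst y, snd y, v)"
proof -
  obtain Z where Z: "Z \<in> sets borel" "(\<integral>\<^sup>+x. indicator Z x \<partial>lborel) = 0" "\<And>x. x \<notin> Z \<Longrightarrow> P x"
    using AE_null_cover[OF assms] by blast
  have [measurable]: "(indicator Z :: _ \<Rightarrow> ennreal) \<in> borel_measurable borel"
    using Z(1) by (rule borel_measurable_indicator)
  define h where "h y = (\<integral>\<^sup>+v. indicator Z (fst y, snd y, v) \<partial>lborel :: ennreal)" for y :: "real \<times> R2"
  have hm [measurable]: "h \<in> borel_measurable borel" unfolding h_def by measurable
  have "(\<integral>\<^sup>+p. indicator Z p \<partial>lborel) = (\<integral>\<^sup>+t. \<integral>\<^sup>+z. indicator Z (t, z) \<partial>lborel \<partial>lborel)"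
    by (rule nn_integral_lborel_pair) measurable
  also have "\<dots> = (\<integral>\<^sup>+t. \<integral>\<^sup>+x. h (t, x) \<partial>lborel \<partial>lborel)"
    unfolding h_def by (intro nn_integral_cong, subst nn_integral_lborel_pair) auto
  also have "\<dots> = (\<integral>\<^sup>+y. h y \<partial>lborel)"
    by (rule nn_integral_lborel_pair[symmetric]) measurable
  finally have h0: "(\<integral>\<^sup>+y. h y \<partial>lborel) = 0" using Z(2) by simp
  have good: "AE v in lborel. P (fst y, snd y, v)" if "h y = 0" for y
  proof -
    have "AE v in lborel. indicator Z (fst y, snd y, v) = (0 :: ennreal)"
      using that unfolding h_def by (subst (asm) nn_integral_0_iff_AE) auto
    then show ?thesis by eventually_elim (auto intro: Z(3) simp: indicator_def split: if_splits)
  qed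
  have "AE y in lborel. h y = 0" using h0 by (subst (asm) nn_integral_0_iff_AE) auto
  then show "AE y in lborel. AE v in lborel. P (fst y, snd y, v)"
    by eventually_elim (rule good)
  have "(\<integral>\<^sup>+p. h (fst p, fst (snd p)) \<partial>(lborel :: (real \<times> R2 \<times> R2) measure))
     = (\<integral>\<^sup>+t. \<integral>\<^sup>+z. h (t, fst z) \<partial>(lborel :: (R2 \<times> R2) measure) \<partial>lborel)"
    by (subst nn_integral_lborel_pair) auto
  \<comment> \<open>The discarded velocity coordinate contributes the infinite measure of the plane;
    it multiplies an integral that is zero, and the product is zero.\<close>
  also have "\<dots> = (\<integral>\<^sup>+t. \<integral>\<^sup>+x. h (t, x) * emeasure lborel (UNIV :: R2 set) \<partial>lborel \<partial>lborel)"
    by (intro nn_integral_cong, subst nn_integral_lborel_pair) auto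
  also have "\<dots> = (\<integral>\<^sup>+t. \<integral>\<^sup>+x. h (t, x) \<partial>lborel \<partial>lborel) * emeasure lborel (UNIV :: R2 set)"
    by (simp add: nn_integral_multc del: emeasure_lborel_UNIV)
  also have "(\<integral>\<^sup>+t. \<integral>\<^sup>+x. h (t, x) \<partial>lborel \<partial>lborel) = 0"
    using h0 nn_integral_lborel_pair[of h] by simp
  finally have "(\<integral>\<^sup>+p. h (fst p, fst (snd p)) \<partial>(lborel :: (real \<times> R2 \<times> R2) measure)) = 0"
    by simp
  then have "AE p in (lborel :: (real \<times> R2 \<times> R2) measure). h (fst p, fst (snd p)) = 0"
    by (subst (asm) nn_integral_0_iff_AE) auto
  then show "AE p in (lborel :: (real \<times> R2 \<times> R2) measure). AE v in lborel. P (fst p, fst (snd p), v)"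
  proof (rule eventually_mono)
    fix p :: "real \<times> R2 \<times> R2"
    assume "h (fst p, fst (snd p)) = 0"
    then show "AE v in lborel. P (fst p, fst (snd p), v)"
      using good[of "(fst p, fst (snd p))"] by simp
  qed
qed

lemma AE_slices:
  fixes P :: "real \<times> R2 \<times> R2 \<Rightarrow> bool"
  assumes "AE p in lborel. P p"
  shows "AE t in lborel. AE z in lborel. P (t, z)" "AE t in lborel. AE x in lborel. AE v in lborel. P (t, x, v)"
proof -
  show *: "AE t in lborel. AE z in lborel. P (t, z)" using assms by (rule AE_lborel_pair)
  show "AE t in lborel. AE x in lborel. AE v in lborel. P (t, x, v)"
    using * by eventually_elim (drule AE_lborel_pair, simp)
qed

text \<open>For each s the shift by (t - s) v preserves the measure of phase space, so a null set in
  space-time meets almost every characteristic in a null set of times.\<close>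

lemma AE_transport:
  fixes P :: "real \<times> R2 \<times> R2 \<Rightarrow> bool"
  assumes "AE p in lborel. P p"
  shows "AE z in lborel. AE s in lborel. P (s, fst z - (t - s) *\<^sub>R snd z, snd z)"
proof -
  obtain Z where Z: "Z \<in> sets borel" "(\<integral>\<^sup>+x. indicator Z x \<partial>lborel) = 0" "\<And>x. x \<notin> Z \<Longrightarrow> P x"
    using AE_null_cover[OF assms] by blast
  have [measurable]: "(indicator Z :: _ \<Rightarrow> ennreal) \<in> borel_measurable borel"
    using Z(1) by (rule borel_measurable_indicator)
  let ?h = "\<lambda>s z. indicator Z (s, fst z - (t - s) *\<^sub>R snd z, snd z) :: ennreal"
  have "(\<integral>\<^sup>+z. \<integral>\<^sup>+s. ?h s z \<partial>lborel \<partial>lborel) = (\<integral>\<^sup>+s. \<integral>\<^sup>+z. ?h s z \<partial>lborel \<partial>lborel)"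
    by (rule lborel_Fubini) measurable
  also have "\<dots> = (\<integral>\<^sup>+s. \<integral>\<^sup>+z. indicator Z (s, z) \<partial>lborel \<partial>lborel)"
  proof (rule nn_integral_cong)
    fix s
    show "(\<integral>\<^sup>+z. ?h s z \<partial>lborel) = (\<integral>\<^sup>+z. indicator Z (s, z) \<partial>lborel)"
      using nn_integral_transport_pair[of "\<lambda>z. indicator Z (s, z)" "s - t"] by (simp add: algebra_simps)
  qed
  also have "\<dots> = 0"
    using Z(2) nn_integral_lborel_pair[of "indicator Z :: real \<times> R2 \<times> R2 \<Rightarrow> ennreal"] by simp
  finally have "AE z in lborel. (\<integral>\<^sup>+s. ?h s z \<partial>lborel) = 0"
    by (subst (asm) nn_integral_0_iff_AE) auto
  then show ?thesis
  proof eventually_elim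
    case (elim z)
    then have "AE s in lborel. ?h s z = 0" by (subst (asm) nn_integral_0_iff_AE) auto
    then show ?case by eventually_elim (auto intro: Z(3) simp: indicator_def split: if_splits)
  qed
qed

lemma borel_representative:
  fixes f :: "real \<Rightarrow> R2 \<Rightarrow> R2 \<Rightarrow> real"
  assumes "(\<lambda>(t, x, v). f t x v) \<in> borel_measurable (lebesgue_on ({0..T} \<times> (UNIV :: (R2 \<times> R2) set)))"
  obtains f' where "f' \<in> borel_measurable borel"
    "AE p in lborel. fst p \<in> {0..T} \<longrightarrow> f (fst p) (fst (snd p)) (snd (snd p)) = f' p"
proof -
  let ?D = "{0..T} \<times> (UNIV :: (R2 \<times> R2) set)"
  have "?D \<in> sets borel" by (intro borel_closed closed_Times) auto
  then have "?D \<inter> space lebesgue \<in> sets lebesgue" by auto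
  then have "(\<lambda>p. indicator ?D p *\<^sub>R (case p of (t, x, v) \<Rightarrow> f t x v)) \<in> borel_measurable lebesgue"
    using assms by (simp add: borel_measurable_restrict_space_iff)
  then obtain f' where f': "f' \<in> borel_measurable lborel"
    "AE p in lborel. indicator ?D p *\<^sub>R (case p of (t, x, v) \<Rightarrow> f t x v) = f' p"
    using completion_ex_borel_measurable_real[of _ lborel] by blast
  show thesis
  proof
    show "f' \<in> borel_measurable borel" using f'(1) by simp
    show "AE p in lborel. fst p \<in> {0..T} \<longrightarrow> f (fst p) (fst (snd p)) (snd (snd p)) = f' p"
      using f'(2) by eventually_elim (auto simp: indicator_def case_prod_unfold split: if_splits)
  qed
qed

section \<open>Borel versions of the density and of the gain term\<close>

definition bdens :: "(real \<times> R2 \<times> R2 \<Rightarrow> real) \<Rightarrow> real \<times> R2 \<Rightarrow> real"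
  where "bdens f y = (LINT v|lborel. f (fst y, snd y, v))"

definition bgain_integrand :: "(R2 \<Rightarrow> real) \<Rightarrow> R2 \<Rightarrow> real \<times> R2 \<Rightarrow> real"
  where "bgain_integrand h v w = indicator {0..2*pi} (fst w) * (h (post_v (circle_pt (fst w)) v (snd w)) * h (post_u (circle_pt (fst w)) v (snd w)))"

text \<open>Integrals of jointly Borel functions over \<open>lborel\<close> are Borel in the
  remaining variables, which provides the measurability in (t, x, v) needed for Tonelli. The angular
  range is put into the integrand as an indicator.\<close>

definition bgain :: "(real \<times> R2 \<times> R2 \<Rightarrow> real) \<Rightarrow> real \<times> R2 \<times> R2 \<Rightarrow> real"
  where "bgain f p = (LINT \<theta>|lborel. LINT u|lborel. bgain_integrand (\<lambda>v. f (fst p, fst (snd p), v)) (snd (snd p)) (\<theta>, u))"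

lemma bdens_measurable [measurable]:
  assumes [measurable]: "f \<in> borel_measurable borel"
  shows "bdens f \<in> borel_measurable borel"
  unfolding bdens_def by measurable

lemma bgain_measurable [measurable]:
  assumes [measurable]: "f \<in> borel_measurable borel"
  shows "bgain f \<in> borel_measurable borel"
  unfolding bgain_def bgain_integrand_def by measurable

lemma bgain_integrand_measurable [measurable]:
  assumes [measurable]: "h \<in> borel_measurable borel"
  shows "bgain_integrand h v \<in> borel_measurable borel"
  unfolding bgain_integrand_def by measurable

lemma spatial_density_representative:
  assumes "f' \<in> borel_measurable borel" "AE v in lborel. f x v = f' (t, x, v)"
  shows "spatial_density f x = bdens f' (t, x)"
    and "integrable lebesgue (f x) \<longleftrightarrow> integrable lborel (\<lambda>v. f' (t, x, v))"
  using integral_lebesgue_AE[of "\<lambda>v. f' (t, x, v)" "f x"] assms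
  by (simp_all add: spatial_density_def bdens_def)

text \<open>Outgoing velocities avoid the exceptional set for almost every angle and partner
  velocity. The agreement is needed in two forms: angle by angle for the iterated integral in
  \<open>Qplus\<close>, and on the product space for absolute convergence.\<close>

lemma gain_representative:
  fixes f :: "R2 \<Rightarrow> R2 \<Rightarrow> real"
  assumes [measurable]: "f' \<in> borel_measurable borel" and ae: "AE v in lborel. f x v = f' (t, x, v)"
  shows "Qplus f f x v = bgain f' (t, x, v)"
    and "integrable (lebesgue_on ({0..2 * pi} \<times> (UNIV :: R2 set)))
         (\<lambda>(\<theta>, u). f x (post_v (circle_pt \<theta>) v u) * f x (post_u (circle_pt \<theta>) v u))
       \<longleftrightarrow> integrable lborel (bgain_integrand (\<lambda>v. f' (t, x, v)) v)"
proof -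
  define h where "h = (\<lambda>v. f' (t, x, v))"
  have [measurable]: "h \<in> borel_measurable borel" unfolding h_def by measurable
  obtain Z where Z: "Z \<in> sets borel" "(\<integral>\<^sup>+x. indicator Z x \<partial>lborel) = 0" "\<And>v. v \<notin> Z \<Longrightarrow> f x v = h v"
    using AE_null_cover[OF ae] unfolding h_def by blast
  have [measurable]: "(indicator Z :: _ \<Rightarrow> ennreal) \<in> borel_measurable borel"
    using Z(1) by (rule borel_measurable_indicator)
  have Z0: "emeasure lborel Z = 0" using Z by simp
  have inner: "AE \<theta> in lborel. \<theta> \<in> {0..2*pi} \<longrightarrow>
      (AE u in lborel. f x (post_v (circle_pt \<theta>) v u) * f x (post_u (circle_pt \<theta>) v u) = bgain_integrand h v (\<theta>, u))"
    using AE_collision[OF Z(1) Z0, of v]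
  proof eventually_elim
    case (elim \<theta>)
    show ?case
    proof
      assume \<theta>: "\<theta> \<in> {0..2*pi}"
      with elim have "AE u in lborel. post_v (circle_pt \<theta>) v u \<notin> Z \<and> post_u (circle_pt \<theta>) v u \<notin> Z" by simp
      then show "AE u in lborel. f x (post_v (circle_pt \<theta>) v u) * f x (post_u (circle_pt \<theta>) v u) = bgain_integrand h v (\<theta>, u)"
        by eventually_elim (use \<theta> in \<open>simp add: bgain_integrand_def Z(3)\<close>)
    qed
  qed
  have int: "AE \<theta> in lborel. indicator {0..2*pi} \<theta> * (LINT u|lebesgue. f x (post_v (circle_pt \<theta>) v u) * f x (post_u (circle_pt \<theta>) v u))
    = (LINT u|lborel. bgain_integrand h v (\<theta>, u))"
    using inner
  proof eventually_elim
    case (elim \<theta>)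
    show ?case
    proof (cases "\<theta> \<in> {0..2*pi}")
      case True
      with elim show ?thesis by (simp add: integral_lebesgue_AE(1)[of "\<lambda>u. bgain_integrand h v (\<theta>, u)"])
    qed (simp add: bgain_integrand_def)
  qed
  have "Qplus f f x v = (LINT \<theta>|lebesgue. indicator {0..2*pi} \<theta> *\<^sub>R (LINT u|lebesgue. f x (post_v (circle_pt \<theta>) v u) * f x (post_u (circle_pt \<theta>) v u)))"
    unfolding Qplus_def by (rule integral_restrict_space) auto
  also have "\<dots> = (LINT \<theta>|lborel. LINT u|lborel. bgain_integrand h v (\<theta>, u))"
    by (rule integral_lebesgue_AE(1)) (use int in auto)
  finally show "Qplus f f x v = bgain f' (t, x, v)"
    by (simp add: bgain_def h_def)
  have joint: "AE w in lborel. indicator ({0..2 * pi} \<times> (UNIV :: R2 set)) w *\<^sub>R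
      (case w of (\<theta>, u) \<Rightarrow> f x (post_v (circle_pt \<theta>) v u) * f x (post_u (circle_pt \<theta>) v u)) = bgain_integrand h v w"
  proof -
    let ?i = "\<lambda>w. indicator {0..2*pi} (fst w) * (indicator Z (post_v (circle_pt (fst w)) v (snd w)) + indicator Z (post_u (circle_pt (fst w)) v (snd w))) :: ennreal"
    have "(\<integral>\<^sup>+w. ?i w \<partial>lborel) = (\<integral>\<^sup>+\<theta>. \<integral>\<^sup>+u. ?i (\<theta>, u) \<partial>lborel \<partial>lborel)"
      by (rule nn_integral_lborel_pair) measurable
    also have "\<dots> = (\<integral>\<^sup>+(\<theta>::real). 0 \<partial>lborel)"
    proof (rule nn_integral_cong_AE)
      show "AE \<theta> in lborel. (\<integral>\<^sup>+u. ?i (\<theta>, u) \<partial>lborel) = 0"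
        using AE_collision[OF Z(1) Z0, of v]
      proof eventually_elim
        case (elim \<theta>)
        show ?case
        proof (cases "\<theta> \<in> {0..2*pi}")
          case True
          with elim have "AE u in lborel. ?i (\<theta>, u) = 0" by (auto elim: eventually_mono)
          then show ?thesis by (subst nn_integral_0_iff_AE) auto
        qed simp
      qed
    qed
    finally have "(\<integral>\<^sup>+w. ?i w \<partial>lborel) = 0" by simp
    then have "AE w in lborel. ?i w = 0" by (subst (asm) nn_integral_0_iff_AE) auto
    then show ?thesis
    proof eventually_elim
      case (elim w)
      then show ?case
        by (cases w) (auto simp: bgain_integrand_def indicator_def Z(3) split: if_splits)
    qed
  qed
  have D: "{0..2 * pi} \<times> (UNIV :: R2 set) \<in> sets lebesgue"
    using borel_closed[OF closed_Times[of "{0..2*pi}" "UNIV :: R2 set"]] by auto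
  show "integrable (lebesgue_on ({0..2 * pi} \<times> (UNIV :: R2 set)))
         (\<lambda>(\<theta>, u). f x (post_v (circle_pt \<theta>) v u) * f x (post_u (circle_pt \<theta>) v u))
       \<longleftrightarrow> integrable lborel (bgain_integrand (\<lambda>v. f' (t, x, v)) v)"
    using integral_lebesgue_AE(2)[OF _ joint] D by (simp add: integrable_restrict_space h_def)
qed

section \<open>Differences of gain terms and triangle inequalities in mixed norms\<close>

lemma nQ_pair:
  assumes [measurable]: "p \<in> borel_measurable borel" "q \<in> borel_measurable borel"
  shows "nQ p q v = (\<integral>\<^sup>+w. indicator {0..2*pi} (fst w) * (p (post_v (circle_pt (fst w)) v (snd w)) * q (post_u (circle_pt (fst w)) v (snd w))) \<partial>lborel)"
proof -
  have [measurable]: "(\<lambda>w :: real \<times> R2. indicator {0..2*pi} (fst w) :: ennreal) \<in> borel_measurable borel"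
    by measurable
  show ?thesis
    unfolding nQ_def by (subst nn_integral_lborel_pair) (auto simp: nn_integral_cmult mult.commute)
qed

lemma nQ_add_right:
  assumes [measurable]: "p \<in> borel_measurable borel" "q \<in> borel_measurable borel" "r \<in> borel_measurable borel"
  shows "nQ p (\<lambda>v. q v + r v) v = nQ p q v + nQ p r v"
  unfolding nQ_def by (simp add: distrib_left distrib_right nn_integral_add)

text \<open>Bilinearity gives h1 h1' - h2 h2' = (h1 - h2) h1' + h2 (h1' - h2'), where the primes
  denote evaluation at the second outgoing velocity. The symmetry of \<open>nQ\<close> moves the
  difference into the first slot of both terms. Integrability on the product space lets the two
  iterated integrals be subtracted under one integral sign.\<close>

lemma gain_difference:
  fixes h1 h2 :: "R2 \<Rightarrow> real"
  assumes [measurable]: "h1 \<in> borel_measurable borel" "h2 \<in> borel_measurable borel"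
    and int: "integrable lborel (bgain_integrand h1 v)" "integrable lborel (bgain_integrand h2 v)"
  shows "ennreal \<bar>(LINT \<theta>|lborel. LINT u|lborel. bgain_integrand h1 v (\<theta>, u)) - (LINT \<theta>|lborel. LINT u|lborel. bgain_integrand h2 v (\<theta>, u))\<bar>
    \<le> nQ (\<lambda>v. ennreal \<bar>h1 v - h2 v\<bar>) (\<lambda>v. ennreal \<bar>h1 v\<bar> + ennreal \<bar>h2 v\<bar>) v"
proof -
  let ?w = "\<lambda>v. ennreal \<bar>h1 v - h2 v\<bar>" and ?a = "\<lambda>v. ennreal \<bar>h1 v\<bar>" and ?b = "\<lambda>v. ennreal \<bar>h2 v\<bar>"
  have fub: "(LINT \<theta>|lborel. LINT u|lborel. bgain_integrand h v (\<theta>, u)) = integral\<^sup>L lborel (bgain_integrand h v)"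
    if "integrable lborel (bgain_integrand h v)" for h
    using lborel_pair.integral_fst'[of "bgain_integrand h v"] that by (simp add: lborel_prod)
  have "ennreal \<bar>(LINT \<theta>|lborel. LINT u|lborel. bgain_integrand h1 v (\<theta>, u)) - (LINT \<theta>|lborel. LINT u|lborel. bgain_integrand h2 v (\<theta>, u))\<bar>
    = ennreal (norm (LINT w|lborel. bgain_integrand h1 v w - bgain_integrand h2 v w))"
    using int by (simp add: fub)
  also have "\<dots> \<le> (\<integral>\<^sup>+w. ennreal (norm (bgain_integrand h1 v w - bgain_integrand h2 v w)) \<partial>lborel)"
    using int by (intro integral_norm_bound_ennreal Bochner_Integration.integrable_diff)
  also have "\<dots> \<le> (\<integral>\<^sup>+w. indicator {0..2*pi} (fst w) * (?w (post_v (circle_pt (fst w)) v (snd w)) * ?a (post_u (circle_pt (fst w)) v (snd w)))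
      + indicator {0..2*pi} (fst w) * (?b (post_v (circle_pt (fst w)) v (snd w)) * ?w (post_u (circle_pt (fst w)) v (snd w))) \<partial>lborel)"
  proof (rule nn_integral_mono)
    fix w :: "real \<times> R2"
    let ?x = "post_v (circle_pt (fst w)) v (snd w)" and ?y = "post_u (circle_pt (fst w)) v (snd w)"
    have "h1 ?x * h1 ?y - h2 ?x * h2 ?y = (h1 ?x - h2 ?x) * h1 ?y + h2 ?x * (h1 ?y - h2 ?y)"
      by (simp add: algebra_simps)
    then have "\<bar>h1 ?x * h1 ?y - h2 ?x * h2 ?y\<bar> \<le> \<bar>h1 ?x - h2 ?x\<bar> * \<bar>h1 ?y\<bar> + \<bar>h2 ?x\<bar> * \<bar>h1 ?y - h2 ?y\<bar>"
      using abs_triangle_ineq[of "(h1 ?x - h2 ?x) * h1 ?y" "h2 ?x * (h1 ?y - h2 ?y)"] by (simp add: abs_mult)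
    then have "ennreal \<bar>h1 ?x * h1 ?y - h2 ?x * h2 ?y\<bar> \<le> ?w ?x * ?a ?y + ?b ?x * ?w ?y"
      by (simp add: ennreal_leI flip: ennreal_mult ennreal_plus)
    then show "ennreal (norm (bgain_integrand h1 v w - bgain_integrand h2 v w))
      \<le> indicator {0..2*pi} (fst w) * (?w ?x * ?a ?y) + indicator {0..2*pi} (fst w) * (?b ?x * ?w ?y)"
      by (auto simp: bgain_integrand_def split: split_indicator)
  qed
  also have "\<dots> = nQ ?w ?a v + nQ ?b ?w v"
    by (subst nn_integral_add) (auto simp: nQ_pair)
  also have "nQ ?b ?w v = nQ ?w ?b v"
    by (rule nQ_commute) measurable
  also have "nQ ?w ?a v + nQ ?w ?b v = nQ ?w (\<lambda>v. ?a v + ?b v) v"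
    by (rule nQ_add_right[symmetric]) measurable
  finally show ?thesis .
qed

text \<open>The square of the time integral is a double integral over two times; Tonelli and
  Cauchy-Schwarz in z at each pair of times bound it by a product.\<close>

lemma minkowski_L2:
  fixes g :: "real \<times> R2 \<times> R2 \<Rightarrow> ennreal"
  assumes [measurable]: "g \<in> borel_measurable borel"
  shows "L2norm (\<lambda>z. \<integral>\<^sup>+s. g (s, z) \<partial>lborel) \<le> (\<integral>\<^sup>+s. L2norm (\<lambda>z. g (s, z)) \<partial>lborel)"
proof -
  have [measurable]: "(\<lambda>s. L2norm (\<lambda>z. g (s, z))) \<in> borel_measurable borel"
    unfolding L2norm_def by measurable
  have "(L2norm (\<lambda>z. \<integral>\<^sup>+s. g (s, z) \<partial>lborel))\<^sup>2 = (\<integral>\<^sup>+z. \<integral>\<^sup>+s. \<integral>\<^sup>+s'. g (s, z) * g (s', z) \<partial>lborel \<partial>lborel \<partial>lborel)"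
    unfolding L2norm_power2 by (intro nn_integral_cong nn_integral_power2) measurable
  also have "\<dots> = (\<integral>\<^sup>+s. \<integral>\<^sup>+z. \<integral>\<^sup>+s'. g (s, z) * g (s', z) \<partial>lborel \<partial>lborel \<partial>lborel)"
    by (rule lborel_Fubini) measurable
  also have "\<dots> = (\<integral>\<^sup>+s. \<integral>\<^sup>+s'. \<integral>\<^sup>+z. g (s, z) * g (s', z) \<partial>lborel \<partial>lborel \<partial>lborel)"
    by (intro nn_integral_cong lborel_Fubini) measurable
  also have "\<dots> \<le> (\<integral>\<^sup>+s. \<integral>\<^sup>+s'. L2norm (\<lambda>z. g (s, z)) * L2norm (\<lambda>z. g (s', z)) \<partial>lborel \<partial>lborel)"
    unfolding L2norm_def by (intro nn_integral_mono nn_integral_Cauchy_Schwarz) auto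
  also have "\<dots> = (\<integral>\<^sup>+s. L2norm (\<lambda>z. g (s, z)) \<partial>lborel)\<^sup>2"
    by (rule nn_integral_power2[symmetric]) measurable
  finally have "ennpowr ((L2norm (\<lambda>z. \<integral>\<^sup>+s. g (s, z) \<partial>lborel))\<^sup>2) (1/2) \<le> ennpowr ((\<integral>\<^sup>+s. L2norm (\<lambda>z. g (s, z)) \<partial>lborel)\<^sup>2) (1/2)"
    by (intro ennpowr_mono) auto
  then show ?thesis by (simp only: ennpowr_half_sq)
qed

text \<open>The weight depends on the velocity alone, which is constant along characteristics, so
  the flow preserves the weighted L^2 norm and Minkowski's inequality applies.\<close>

lemma duhamel_L2:
  fixes h :: "real \<times> R2 \<times> R2 \<Rightarrow> ennreal"
  assumes [measurable]: "h \<in> borel_measurable borel" "I \<in> sets borel"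
  shows "L2norm (\<lambda>z. jw a (snd z) * (\<integral>\<^sup>+s\<in>I. h (s, fst z + s *\<^sub>R snd z, snd z) \<partial>lborel))
    \<le> (\<integral>\<^sup>+s\<in>I. L2norm (\<lambda>z. jw a (snd z) * h (s, z)) \<partial>lborel)"
proof -
  let ?g = "\<lambda>s z. jw a (snd z) * h (s, fst z + s *\<^sub>R snd z, snd z) * indicator I s"
  have "(\<lambda>z. jw a (snd z) * (\<integral>\<^sup>+s\<in>I. h (s, fst z + s *\<^sub>R snd z, snd z) \<partial>lborel)) = (\<lambda>z. \<integral>\<^sup>+s. ?g s z \<partial>lborel)"
    by (simp add: nn_integral_cmult mult.assoc)
  then have "L2norm (\<lambda>z. jw a (snd z) * (\<integral>\<^sup>+s\<in>I. h (s, fst z + s *\<^sub>R snd z, snd z) \<partial>lborel)) = L2norm (\<lambda>z. \<integral>\<^sup>+s. ?g s z \<partial>lborel)"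
    by simp
  also have "\<dots> \<le> (\<integral>\<^sup>+s. L2norm (?g s) \<partial>lborel)"
    using minkowski_L2[of "\<lambda>p. ?g (fst p) (snd p)"] by simp
  also have "\<dots> = (\<integral>\<^sup>+s\<in>I. L2norm (\<lambda>z. jw a (snd z) * h (s, z)) \<partial>lborel)"
  proof (rule nn_integral_cong)
    fix s
    show "L2norm (?g s) = L2norm (\<lambda>z. jw a (snd z) * h (s, z)) * indicator I s"
      using nn_integral_transport_pair[of "\<lambda>z. (jw a (snd z) * h (s, z))\<^sup>2" s]
      by (auto simp: L2norm_def split: split_indicator)
  qed
  finally show ?thesis .
qed

lemma ennreal_sum_power2_le: "(x + y)\<^sup>2 \<le> 2 * (x\<^sup>2 + (y::ennreal)\<^sup>2)"
proof -
  have "(x + y)\<^sup>2 = x\<^sup>2 + 2 * (x * y) + y\<^sup>2"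
    by (simp add: power2_sum ac_simps)
  also have "\<dots> \<le> x\<^sup>2 + (x\<^sup>2 + y\<^sup>2) + y\<^sup>2"
    by (intro add_mono ennreal_two_mult_le order.refl)
  also have "\<dots> = 2 * (x\<^sup>2 + y\<^sup>2)"
    by (simp add: mult_2 distrib_left ac_simps)
  finally show ?thesis .
qed

lemma L2norm_add_finite:
  assumes [measurable]: "A \<in> borel_measurable borel" "B \<in> borel_measurable borel"
    and "L2norm A < top" "L2norm B < top"
  shows "L2norm (\<lambda>z. A z + B z) < top"
proof -
  have "(\<integral>\<^sup>+z. (A z + B z)\<^sup>2 \<partial>lborel) \<le> (\<integral>\<^sup>+z. 2 * ((A z)\<^sup>2 + (B z)\<^sup>2) \<partial>lborel)"
    by (intro nn_integral_mono ennreal_sum_power2_le)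
  also have "\<dots> = 2 * ((\<integral>\<^sup>+z. (A z)\<^sup>2 \<partial>lborel) + (\<integral>\<^sup>+z. (B z)\<^sup>2 \<partial>lborel))"
    by (simp add: nn_integral_cmult nn_integral_add)
  also have "\<dots> < top"
    using assms(3,4) by (simp add: L2norm_def ennpowr_less_top_iff ennreal_mult_less_top)
  finally show ?thesis by (simp add: L2norm_def ennpowr_less_top_iff)
qed

lemma L2norm_mono: "(\<And>z. A z \<le> B z) \<Longrightarrow> L2norm A \<le> L2norm B"
  unfolding L2norm_def by (intro ennpowr_mono nn_integral_mono power_mono) auto

text \<open>The inequality (x + y)^2 \<le> 2 (x^2 + y^2) is used inside the velocity integral and
  again outside, whence 8 = 4 * 2. The purpose is a finite bound for |f| + |g|, so this crude
  constant is enough.\<close>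

lemma L42_add:
  assumes [measurable]: "F \<in> borel_measurable borel" "G \<in> borel_measurable borel"
  shows "L42 (\<lambda>p. F p + G p) t \<le> ennpowr (8 * (ennpowr (L42 F t) 4 + ennpowr (L42 G t) 4)) (1/4)"
proof -
  let ?\<alpha> = "\<lambda>x. \<integral>\<^sup>+v. (F (t, x, v))\<^sup>2 \<partial>lborel" and ?\<beta> = "\<lambda>x. \<integral>\<^sup>+v. (G (t, x, v))\<^sup>2 \<partial>lborel"
  have four: "ennpowr (L42 F t) 4 = (\<integral>\<^sup>+x. (\<integral>\<^sup>+v. (F (t, x, v))\<^sup>2 \<partial>lborel)\<^sup>2 \<partial>lborel)" for F
    by (simp add: L42_def ennpowr_ennpowr)
  have "(\<integral>\<^sup>+x. (\<integral>\<^sup>+v. (F (t, x, v) + G (t, x, v))\<^sup>2 \<partial>lborel)\<^sup>2 \<partial>lborel) \<le> (\<integral>\<^sup>+x. 8 * ((?\<alpha> x)\<^sup>2 + (?\<beta> x)\<^sup>2) \<partial>lborel)"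
  proof (rule nn_integral_mono)
    fix x
    have "(\<integral>\<^sup>+v. (F (t, x, v) + G (t, x, v))\<^sup>2 \<partial>lborel) \<le> (\<integral>\<^sup>+v. 2 * ((F (t, x, v))\<^sup>2 + (G (t, x, v))\<^sup>2) \<partial>lborel)"
      by (intro nn_integral_mono ennreal_sum_power2_le)
    also have "\<dots> = 2 * (?\<alpha> x + ?\<beta> x)"
      by (simp add: nn_integral_cmult nn_integral_add)
    finally have "(\<integral>\<^sup>+v. (F (t, x, v) + G (t, x, v))\<^sup>2 \<partial>lborel)\<^sup>2 \<le> (2 * (?\<alpha> x + ?\<beta> x))\<^sup>2"
      by (rule power_mono) simp
    also have "\<dots> = 4 * (?\<alpha> x + ?\<beta> x)\<^sup>2"
      by (simp only: power_mult_distrib) simp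
    also have "\<dots> \<le> 4 * (2 * ((?\<alpha> x)\<^sup>2 + (?\<beta> x)\<^sup>2))"
      by (intro mult_left_mono ennreal_sum_power2_le) simp
    also have "\<dots> = 8 * ((?\<alpha> x)\<^sup>2 + (?\<beta> x)\<^sup>2)"
      by (simp add: mult.assoc[symmetric])
    finally show "(\<integral>\<^sup>+v. (F (t, x, v) + G (t, x, v))\<^sup>2 \<partial>lborel)\<^sup>2 \<le> 8 * ((?\<alpha> x)\<^sup>2 + (?\<beta> x)\<^sup>2)" .
  qed
  also have "\<dots> = 8 * (ennpowr (L42 F t) 4 + ennpowr (L42 G t) 4)"
    unfolding four by (simp add: nn_integral_cmult nn_integral_add)
  finally have "ennpowr (\<integral>\<^sup>+x. (\<integral>\<^sup>+v. (F (t, x, v) + G (t, x, v))\<^sup>2 \<partial>lborel)\<^sup>2 \<partial>lborel) (1/4)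
    \<le> ennpowr (8 * (ennpowr (L42 F t) 4 + ennpowr (L42 G t) 4)) (1/4)"
    by (intro ennpowr_mono) auto
  then show ?thesis by (simp add: L42_def)
qed

text \<open>The essential supremum exceeds c exactly when the superlevel set at height c has
  positive measure, and that measure is Borel in t by Tonelli.\<close>

lemma esssup_measurable:
  fixes h :: "real \<times> R2 \<Rightarrow> ennreal"
  assumes [measurable]: "h \<in> borel_measurable borel"
  shows "(\<lambda>t. esssup lebesgue (\<lambda>x. h (t, x))) \<in> borel_measurable borel"
proof (rule borel_measurableI_greater)
  fix c :: ennreal
  have hm: "(\<lambda>x. h (t, x)) \<in> borel_measurable lebesgue" for t
    by (rule measurable_completion) measurable
  have "c < esssup lebesgue (\<lambda>x. h (t, x)) \<longleftrightarrow> (\<integral>\<^sup>+x. (if c < h (t, x) then 1 else 0) \<partial>lborel) \<noteq> 0" for t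
  proof
    assume *: "c < esssup lebesgue (\<lambda>x. h (t, x))"
    show "(\<integral>\<^sup>+x. (if c < h (t, x) then 1 else 0) \<partial>lborel) \<noteq> 0"
    proof
      assume "(\<integral>\<^sup>+x. (if c < h (t, x) then 1 else 0) \<partial>lborel) = 0"
      then have "AE x in lborel. (if c < h (t, x) then 1 else (0::ennreal)) = 0"
        by (subst (asm) nn_integral_0_iff_AE) auto
      then have "AE x in lborel. h (t, x) \<le> c"
        by eventually_elim (auto split: if_splits)
      then have "esssup lebesgue (\<lambda>x. h (t, x)) \<le> c"
        by (intro esssup_I hm AE_completion)
      with * show False by simp
    qed
  next
    assume *: "(\<integral>\<^sup>+x. (if c < h (t, x) then 1 else 0) \<partial>lborel) \<noteq> 0"
    show "c < esssup lebesgue (\<lambda>x. h (t, x))"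
    proof (rule ccontr)
      assume "\<not> ?thesis"
      then have le: "esssup lebesgue (\<lambda>x. h (t, x)) \<le> c" by simp
      have "AE x in lebesgue. h (t, x) \<le> esssup lebesgue (\<lambda>x. h (t, x))" by (rule esssup_AE)
      then have "AE x in lborel. h (t, x) \<le> esssup lebesgue (\<lambda>x. h (t, x))"
        by (simp add: AE_completion_iff)
      then have "AE x in lborel. (if c < h (t, x) then 1 else (0::ennreal)) = 0"
        by eventually_elim (use le in auto)
      then have "(\<integral>\<^sup>+x. (if c < h (t, x) then 1 else 0) \<partial>lborel) = 0"
        by (subst nn_integral_0_iff_AE) auto
      with * show False by simp
    qed
  qed
  then have "{t \<in> space borel. c < esssup lebesgue (\<lambda>x. h (t, x))} = {t \<in> space borel. (\<integral>\<^sup>+x. (if c < h (t, x) then 1 else 0) \<partial>lborel) \<noteq> 0}"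
    by simp
  also have "\<dots> \<in> sets borel" by measurable
  finally show "{t \<in> space borel. c < esssup lebesgue (\<lambda>x. h (t, x))} \<in> sets borel" .
qed

section \<open>Mild solutions\<close>

definition bloss :: "(real \<times> R2 \<times> R2 \<Rightarrow> real) \<Rightarrow> real \<times> R2 \<times> R2 \<Rightarrow> real"
  where "bloss f p = 2 * pi * f p * bdens f (fst p, fst (snd p))"

lemma bloss_measurable [measurable]:
  assumes [measurable]: "f \<in> borel_measurable borel"
  shows "bloss f \<in> borel_measurable borel"
  unfolding bloss_def by measurable

text \<open>A solution seen through a jointly Borel representative \<open>f'\<close>, with its norm
  bounds stated for almost every time. The original \<open>f\<close> is retained because Duhamel's
  formula refers to it at every time, and its collision terms are identified with those of
  \<open>f'\<close> almost everywhere. The function n majorises the density at each time.\<close>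

locale borel_solution =
  fixes a T C :: real and f :: "real \<Rightarrow> R2 \<Rightarrow> R2 \<Rightarrow> real" and f' :: "real \<times> R2 \<times> R2 \<Rightarrow> real" and n :: "real \<Rightarrow> ennreal"
  assumes f'_measurable [measurable]: "f' \<in> borel_measurable borel"
    and n_measurable [measurable]: "n \<in> borel_measurable borel"
    and representative: "AE p in lborel. fst p \<in> {0..T} \<longrightarrow> f (fst p) (fst (snd p)) (snd (snd p)) = f' p
      \<and> Qplus (f (fst p)) (f (fst p)) (fst (snd p)) (snd (snd p)) = bgain f' p
      \<and> Qminus (f (fst p)) (f (fst p)) (fst (snd p)) (snd (snd p)) = bloss f' p"
    and gain_integrable: "AE p in lborel. fst p \<in> {0..T} \<longrightarrow> integrable lborel (bgain_integrand (\<lambda>v. f' (fst p, fst (snd p), v)) (snd (snd p)))"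
    and density_integrable: "AE y in lborel. fst y \<in> {0..T} \<longrightarrow> integrable lborel (\<lambda>v. f' (fst y, snd y, v))"
    and L42_bound: "AE t in lborel. t \<in> {0..T} \<longrightarrow> L42 (\<lambda>p. jw a (snd (snd p)) * ennreal \<bar>f' p\<bar>) t \<le> ennreal C"
    and L2_bound: "AE t in lborel. t \<in> {0..T} \<longrightarrow> L2norm (\<lambda>z. jw a (snd z) * ennreal \<bar>f' (t, z)\<bar>) \<le> ennreal C"
    and density_bound: "AE t in lborel. t \<in> {0..T} \<longrightarrow> (AE x in lborel. ennreal \<bar>bdens f' (t, x)\<bar> \<le> n t)"
    and density_L2: "(\<integral>\<^sup>+t\<in>{0..T}. (n t)\<^sup>2 \<partial>lborel) < top"
    and gain_L1L2: "(\<integral>\<^sup>+t\<in>{0..T}. L2norm (\<lambda>z. jw a (snd z) * ennreal \<bar>bgain f' (t, z)\<bar>) \<partial>lborel) < top"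

lemma Lp_2: "Lp 2 M h = ennpowr (\<integral>\<^sup>+z. (h z)\<^sup>2 \<partial>M) (1/2)"
  by (simp add: Lp_def ennpowr_2)

lemma ennreal_abs_japanese: "ennreal \<bar>japanese v powr a * r\<bar> = jw a v * ennreal \<bar>r\<bar>"
  by (simp add: abs_mult ennreal_mult)

text \<open>Tonelli gives agreement of \<open>f\<close> with its representative in almost every
  slice, in t as well as in (t, x). That transfers density, gain and all norms, because integrals
  over the completed measure ignore null sets.\<close>

lemma borel_solution_exists:
  assumes ms: "mild_solution T f0 f" and gb: "Qplus_bound a T f" and db: "density_bounds T f" and sb: "solution_bounds a T f"
  obtains f' n C where "borel_solution a T C f f' n"
proof -
  have D: "{0..T} \<times> (UNIV :: R2 set) \<in> sets lebesgue" "{0..T} \<times> (UNIV :: (R2 \<times> R2) set) \<in> sets lebesgue" "{0..T} \<in> sets lebesgue"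
    using borel_closed[OF closed_Times[of "{0..T}" "UNIV :: R2 set"]] borel_closed[OF closed_Times[of "{0..T}" "UNIV :: (R2 \<times> R2) set"]] by auto
  obtain f' where fm [measurable]: "f' \<in> borel_measurable borel"
    and rep: "AE p in lborel. fst p \<in> {0..T} \<longrightarrow> f (fst p) (fst (snd p)) (snd (snd p)) = f' p"
    using borel_representative[of f T] ms unfolding mild_solution_def by blast
  have regroup1: "AE p in (lborel :: (real \<times> R2 \<times> R2) measure). AE v in lborel. fst p \<in> {0..T} \<longrightarrow> f (fst p) (fst (snd p)) v = f' (fst p, fst (snd p), v)"
    using AE_regroup(1)[OF rep] by simp
  have regroup2: "AE y in lborel. AE v in lborel. fst y \<in> {0..T} \<longrightarrow> f (fst y) (snd y) v = f' (fst y, snd y, v)"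
    using AE_regroup(2)[OF rep] by simp
  have slices: "AE t in lborel. AE x in lborel. AE v in lborel. t \<in> {0..T} \<longrightarrow> f t x v = f' (t, x, v)"
    using AE_slices(2)[OF rep] by simp
  have slices': "AE t in lborel. AE z in lborel. t \<in> {0..T} \<longrightarrow> f t (fst z) (snd z) = f' (t, z)"
    using AE_slices(1)[OF rep] by simp
  \<comment> \<open>The supremum is taken of the Borel density, so that
    \<open>esssup_measurable\<close> makes n Borel; on almost every time in [0, T] it equals the
    norm of the original density.\<close>
  define n where "n t = esssup lebesgue (\<lambda>x. ennreal \<bar>bdens f' (t, x)\<bar>)" for t
  have nm [measurable]: "n \<in> borel_measurable borel"
    unfolding n_def by (rule esssup_measurable[of "\<lambda>y. ennreal \<bar>bdens f' y\<bar>"]) measurable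
  have representative: "AE p in lborel. fst p \<in> {0..T} \<longrightarrow> f (fst p) (fst (snd p)) (snd (snd p)) = f' p
      \<and> Qplus (f (fst p)) (f (fst p)) (fst (snd p)) (snd (snd p)) = bgain f' p
      \<and> Qminus (f (fst p)) (f (fst p)) (fst (snd p)) (snd (snd p)) = bloss f' p"
    using rep regroup1
  proof eventually_elim
    case (elim p)
    show ?case
    proof
      assume t: "fst p \<in> {0..T}"
      have ae: "AE v in lborel. f (fst p) (fst (snd p)) v = f' (fst p, fst (snd p), v)"
        using elim(2) t by simp
      show "f (fst p) (fst (snd p)) (snd (snd p)) = f' p
        \<and> Qplus (f (fst p)) (f (fst p)) (fst (snd p)) (snd (snd p)) = bgain f' p
        \<and> Qminus (f (fst p)) (f (fst p)) (fst (snd p)) (snd (snd p)) = bloss f' p"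
        using elim(1) t gain_representative(1)[where f' = f' and f = "f (fst p)" and x = "fst (snd p)" and t = "fst p", OF fm ae] spatial_density_representative(1)[where f' = f' and f = "f (fst p)" and x = "fst (snd p)" and t = "fst p", OF fm ae]
        by (simp add: Qminus_def bloss_def)
    qed
  qed
  have gain_int: "AE p in lborel. fst p \<in> {0..T} \<longrightarrow> integrable lborel (bgain_integrand (\<lambda>v. f' (fst p, fst (snd p), v)) (snd (snd p)))"
  proof -
    have "AE p in lborel. p \<in> {0..T} \<times> (UNIV :: (R2 \<times> R2) set) \<longrightarrow> (case p of (t, x, v) \<Rightarrow> integrable (lebesgue_on ({0..2 * pi} \<times> (UNIV :: R2 set)))
         (\<lambda>(\<theta>, u). f t x (post_v (circle_pt \<theta>) v u) * f t x (post_u (circle_pt \<theta>) v u)))"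
      using ms D(2) unfolding mild_solution_def by (simp only: AE_lebesgue_on_iff)
    then show ?thesis
      using regroup1
    proof eventually_elim
      case (elim p)
      show ?case
      proof
        assume t: "fst p \<in> {0..T}"
        have ae: "AE v in lborel. f (fst p) (fst (snd p)) v = f' (fst p, fst (snd p), v)"
          using elim(2) t by simp
        show "integrable lborel (bgain_integrand (\<lambda>v. f' (fst p, fst (snd p), v)) (snd (snd p)))"
          using elim(1) t gain_representative(2)[where f' = f' and f = "f (fst p)" and x = "fst (snd p)" and t = "fst p", OF fm ae] by (cases p) auto
      qed
    qed
  qed
  have dens_int: "AE y in lborel. fst y \<in> {0..T} \<longrightarrow> integrable lborel (\<lambda>v. f' (fst y, snd y, v))"
  proof -
    have "AE y in lborel. y \<in> {0..T} \<times> (UNIV :: R2 set) \<longrightarrow> (case y of (t, x) \<Rightarrow> integrable lebesgue (f t x))"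
      using ms D(1) unfolding mild_solution_def by (simp only: AE_lebesgue_on_iff)
    then show ?thesis
      using regroup2
    proof eventually_elim
      case (elim y)
      show ?case
      proof
        assume t: "fst y \<in> {0..T}"
        have ae: "AE v in lborel. f (fst y) (snd y) v = f' (fst y, snd y, v)"
          using elim(2) t by simp
        show "integrable lborel (\<lambda>v. f' (fst y, snd y, v))"
          using elim(1) t spatial_density_representative(2)[where f' = f' and f = "f (fst y)" and x = "snd y" and t = "fst y", OF fm ae] by (cases y) auto
      qed
    qed
  qed
  define H4 where "H4 t = Lp 4 lebesgue (\<lambda>x. Lp 2 lebesgue (\<lambda>v. ennreal \<bar>japanese v powr a * f t x v\<bar>))" for t
  define H2 where "H2 t = Lp 2 lebesgue (\<lambda>(x, v). ennreal \<bar>japanese v powr a * f t x v\<bar>)" for t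
  define c where "c = max (Linf (lebesgue_on {0..T}) H4) (Linf (lebesgue_on {0..T}) H2)"
  have "c < top"
    using sb unfolding solution_bounds_def c_def H4_def[symmetric] H2_def[symmetric] by simp
  then obtain C where C: "c = ennreal C" by (cases c) auto
  have esup: "AE t in lborel. t \<in> {0..T} \<longrightarrow> H t \<le> ennreal C" if "Linf (lebesgue_on {0..T}) H \<le> c" for H
  proof -
    have "AE t in lebesgue_on {0..T}. H t \<le> Linf (lebesgue_on {0..T}) H"
      unfolding Linf_def by (rule esssup_AE)
    then have "AE t in lebesgue_on {0..T}. H t \<le> ennreal C"
      by eventually_elim (use that C in auto)
    then show ?thesis using D(3) by (simp only: AE_lebesgue_on_iff)
  qed
  have esup4: "AE t in lborel. t \<in> {0..T} \<longrightarrow> H4 t \<le> ennreal C" and esup2: "AE t in lborel. t \<in> {0..T} \<longrightarrow> H2 t \<le> ennreal C"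
    by (rule esup, simp add: c_def)+
  have L42b: "AE t in lborel. t \<in> {0..T} \<longrightarrow> L42 (\<lambda>p. jw a (snd (snd p)) * ennreal \<bar>f' p\<bar>) t \<le> ennreal C"
    using slices esup4
  proof eventually_elim
    case (elim t)
    show ?case
    proof
      assume t: "t \<in> {0..T}"
      have "H4 t = ennpowr (\<integral>\<^sup>+x. (\<integral>\<^sup>+v. (ennreal \<bar>japanese v powr a * f t x v\<bar>)\<^sup>2 \<partial>lborel)\<^sup>2 \<partial>lborel) (1/4)"
        by (simp add: H4_def Lp_def[of 4] Lp_2 nn_integral_completion ennpowr_ennpowr ennpowr_2)
      also have "(\<integral>\<^sup>+x. (\<integral>\<^sup>+v. (ennreal \<bar>japanese v powr a * f t x v\<bar>)\<^sup>2 \<partial>lborel)\<^sup>2 \<partial>lborel)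
        = (\<integral>\<^sup>+x. (\<integral>\<^sup>+v. (jw a v * ennreal \<bar>f' (t, x, v)\<bar>)\<^sup>2 \<partial>lborel)\<^sup>2 \<partial>lborel)"
      proof (rule nn_integral_cong_AE)
        show "AE x in lborel. (\<integral>\<^sup>+v. (ennreal \<bar>japanese v powr a * f t x v\<bar>)\<^sup>2 \<partial>lborel)\<^sup>2 = (\<integral>\<^sup>+v. (jw a v * ennreal \<bar>f' (t, x, v)\<bar>)\<^sup>2 \<partial>lborel)\<^sup>2"
          using elim(1)
        proof eventually_elim
          case (elim x)
          have "(\<integral>\<^sup>+v. (ennreal \<bar>japanese v powr a * f t x v\<bar>)\<^sup>2 \<partial>lborel) = (\<integral>\<^sup>+v. (jw a v * ennreal \<bar>f' (t, x, v)\<bar>)\<^sup>2 \<partial>lborel)"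
          proof (rule nn_integral_cong_AE)
            show "AE v in lborel. (ennreal \<bar>japanese v powr a * f t x v\<bar>)\<^sup>2 = (jw a v * ennreal \<bar>f' (t, x, v)\<bar>)\<^sup>2"
              using elim by eventually_elim (use t in \<open>simp only: ennreal_abs_japanese simp_thms\<close>)
          qed
          then show ?case by simp
        qed
      qed
      finally have "H4 t = L42 (\<lambda>p. jw a (snd (snd p)) * ennreal \<bar>f' p\<bar>) t"
        by (simp add: L42_def)
      then show "L42 (\<lambda>p. jw a (snd (snd p)) * ennreal \<bar>f' p\<bar>) t \<le> ennreal C"
        using elim(2) t by simp
    qed
  qed
  have L2eq: "Lp 2 lebesgue (\<lambda>(x, v). ennreal \<bar>japanese v powr a * h x v\<bar>) = L2norm (\<lambda>z. jw a (snd z) * ennreal \<bar>h' z\<bar>)"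
    if "AE z in lborel. h (fst z) (snd z) = h' z" for h :: "R2 \<Rightarrow> R2 \<Rightarrow> real" and h'
  proof -
    have "(\<integral>\<^sup>+z. (case z of (x, v) \<Rightarrow> ennreal \<bar>japanese v powr a * h x v\<bar>)\<^sup>2 \<partial>lborel) = (\<integral>\<^sup>+z. (jw a (snd z) * ennreal \<bar>h' z\<bar>)\<^sup>2 \<partial>lborel)"
    proof (rule nn_integral_cong_AE)
      show "AE z in lborel. (case z of (x, v) \<Rightarrow> ennreal \<bar>japanese v powr a * h x v\<bar>)\<^sup>2 = (jw a (snd z) * ennreal \<bar>h' z\<bar>)\<^sup>2"
        using that by eventually_elim (simp only: case_prod_unfold ennreal_abs_japanese)
    qed
    then show ?thesis by (simp add: Lp_2 L2norm_def nn_integral_completion)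
  qed
  have L2b: "AE t in lborel. t \<in> {0..T} \<longrightarrow> L2norm (\<lambda>z. jw a (snd z) * ennreal \<bar>f' (t, z)\<bar>) \<le> ennreal C"
    using slices' esup2
  proof eventually_elim
    case (elim t)
    show ?case
    proof
      assume t: "t \<in> {0..T}"
      have "AE z in lborel. f t (fst z) (snd z) = f' (t, z)" using elim(1) t by simp
      then have "H2 t = L2norm (\<lambda>z. jw a (snd z) * ennreal \<bar>f' (t, z)\<bar>)"
        unfolding H2_def by (rule L2eq)
      then show "L2norm (\<lambda>z. jw a (snd z) * ennreal \<bar>f' (t, z)\<bar>) \<le> ennreal C"
        using elim(2) t by simp
    qed
  qed
  have dens_AE: "AE x in lborel. ennreal \<bar>bdens f' (t, x)\<bar> \<le> n t" for t
  proof -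
    have "AE x in lebesgue. ennreal \<bar>bdens f' (t, x)\<bar> \<le> n t"
      unfolding n_def by (rule esssup_AE)
    then show ?thesis by (simp add: AE_completion_iff)
  qed
  have dens_L2: "(\<integral>\<^sup>+t\<in>{0..T}. (n t)\<^sup>2 \<partial>lborel) < top"
  proof -
    define S where "S t = Linf lebesgue (\<lambda>x. ennreal \<bar>spatial_density (f t) x\<bar>)" for t
    have "Lp 2 (lebesgue_on {0..T}) S < top"
      using db unfolding density_bounds_def S_def[symmetric] by simp
    then have "(\<integral>\<^sup>+t\<in>{0..T}. (S t)\<^sup>2 \<partial>lborel) < top"
      using D(3) by (simp add: Lp_2 ennpowr_less_top_iff nn_integral_lebesgue_on)
    also have "(\<integral>\<^sup>+t\<in>{0..T}. (S t)\<^sup>2 \<partial>lborel) = (\<integral>\<^sup>+t\<in>{0..T}. (n t)\<^sup>2 \<partial>lborel)"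
    proof (rule nn_integral_cong_AE)
      show "AE t in lborel. (S t)\<^sup>2 * indicator {0..T} t = (n t)\<^sup>2 * indicator {0..T} t"
        using slices
      proof eventually_elim
        case (elim t)
        show ?case
        proof (cases "t \<in> {0..T}")
          case True
          have ae: "AE x in lborel. spatial_density (f t) x = bdens f' (t, x)"
            using elim
          proof eventually_elim
            case (elim x)
            then show ?case using True by (intro spatial_density_representative(1)[where f = "f t", OF fm]) simp
          qed
          have bm: "(\<lambda>x. bdens f' (t, x)) \<in> borel_measurable borel" by measurable
          have sm: "(\<lambda>x. spatial_density (f t) x) \<in> borel_measurable lebesgue"
            by (rule lebesgue_measurable_AE[OF bm ae])
          have "S t = n t"
            unfolding S_def n_def Linf_def
          proof (rule esssup_AE_cong)
            show "(\<lambda>x. ennreal \<bar>spatial_density (f t) x\<bar>) \<in> borel_measurable lebesgue"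
              using sm by measurable
            show "(\<lambda>x. ennreal \<bar>bdens f' (t, x)\<bar>) \<in> borel_measurable lebesgue"
              by (rule measurable_completion) measurable
            show "AE x in lebesgue. ennreal \<bar>spatial_density (f t) x\<bar> = ennreal \<bar>bdens f' (t, x)\<bar>"
              using AE_completion[OF ae] by eventually_elim simp
          qed
          then show ?thesis by simp
        qed simp
      qed
    qed
    finally show ?thesis .
  qed
  have gain_L1: "(\<integral>\<^sup>+t\<in>{0..T}. L2norm (\<lambda>z. jw a (snd z) * ennreal \<bar>bgain f' (t, z)\<bar>) \<partial>lborel) < top"
  proof -
    define S where "S t = Lp 2 lebesgue (\<lambda>(x, v). ennreal \<bar>japanese v powr a * Qplus (f t) (f t) x v\<bar>)" for t
    have "Lp 1 (lebesgue_on {0..T}) S < top"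
      using gb unfolding Qplus_bound_def S_def[symmetric] by simp
    then have "(\<integral>\<^sup>+t\<in>{0..T}. S t \<partial>lborel) < top"
      using D(3) by (simp add: Lp_def nn_integral_lebesgue_on)
    also have "(\<integral>\<^sup>+t\<in>{0..T}. S t \<partial>lborel) = (\<integral>\<^sup>+t\<in>{0..T}. L2norm (\<lambda>z. jw a (snd z) * ennreal \<bar>bgain f' (t, z)\<bar>) \<partial>lborel)"
    proof (rule nn_integral_cong_AE)
      show "AE t in lborel. S t * indicator {0..T} t = L2norm (\<lambda>z. jw a (snd z) * ennreal \<bar>bgain f' (t, z)\<bar>) * indicator {0..T} t"
        using AE_slices(1)[OF representative]
      proof eventually_elim
        case (elim t)
        show ?case
        proof (cases "t \<in> {0..T}")
          case True
          have "AE z in lborel. Qplus (f t) (f t) (fst z) (snd z) = bgain f' (t, z)"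
            using elim by eventually_elim (use True in simp)
          then have "S t = L2norm (\<lambda>z. jw a (snd z) * ennreal \<bar>bgain f' (t, z)\<bar>)"
            unfolding S_def by (rule L2eq)
          then show ?thesis by simp
        qed simp
      qed
    qed
    finally show ?thesis .
  qed
  have "borel_solution a T C f f' n"
    by (unfold_locales) (fact fm nm representative gain_int dens_int L42b L2b dens_L2 gain_L1 | use dens_AE in simp)+
  then show thesis by (rule that)
qed

definition bnet :: "(real \<times> R2 \<times> R2 \<Rightarrow> real) \<Rightarrow> (real \<times> R2 \<times> R2 \<Rightarrow> real) \<Rightarrow> real \<times> R2 \<times> R2 \<Rightarrow> ennreal"
  where "bnet f g p = ennreal \<bar>(bgain f p - bloss f p) - (bgain g p - bloss g p)\<bar>"

lemma bnet_measurable [measurable]: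
  assumes [measurable]: "f \<in> borel_measurable borel" "g \<in> borel_measurable borel"
  shows "bnet f g \<in> borel_measurable borel"
  unfolding bnet_def by measurable

text \<open>The transported initial datum is common to both solutions and cancels; absolute
  convergence allows the two Duhamel integrals to be subtracted. The time t is arbitrary in [0, T]:
  along almost every characteristic through time t the collision terms agree with their Borel
  versions for almost every earlier s.\<close>

lemma duhamel_difference:
  assumes f: "mild_solution T f0 f" "borel_solution a T C f f' n" and g: "mild_solution T f0 g" "borel_solution a T C' g g' n'"
    and t: "t \<in> {0..T}"
  shows "AE z in lborel. ennreal \<bar>f t (fst z) (snd z) - g t (fst z) (snd z)\<bar>
    \<le> (\<integral>\<^sup>+s\<in>{0..t}. bnet f' g' (s, fst z - (t - s) *\<^sub>R snd z, snd z) \<partial>lborel)"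
proof -
  have ms: "AE z in lborel. integrable (lebesgue_on {0..t}) (\<lambda>s. transport (t - s) (Qplus (h s) (h s)) (fst z) (snd z)) \<and>
       integrable (lebesgue_on {0..t}) (\<lambda>s. transport (t - s) (Qminus (h s) (h s)) (fst z) (snd z)) \<and>
       h t (fst z) (snd z) = transport t f0 (fst z) (snd z) +
         (LINT s|lebesgue_on {0..t}. transport (t - s) (\<lambda>y w. Qplus (h s) (h s) y w - Qminus (h s) (h s) y w) (fst z) (snd z))"
    if "mild_solution T f0 h" for h
  proof -
    have "AE z in lebesgue. case z of (x, v) \<Rightarrow> integrable (lebesgue_on {0..t}) (\<lambda>s. transport (t - s) (Qplus (h s) (h s)) x v) \<and>
       integrable (lebesgue_on {0..t}) (\<lambda>s. transport (t - s) (Qminus (h s) (h s)) x v) \<and>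
       h t x v = transport t f0 x v +
         (LINT s|lebesgue_on {0..t}. transport (t - s) (\<lambda>y w. Qplus (h s) (h s) y w - Qminus (h s) (h s) y w) x v)"
      using that t unfolding mild_solution_def by blast
    then show ?thesis unfolding AE_completion_iff case_prod_unfold .
  qed
  show ?thesis
    using ms[OF f(1)] ms[OF g(1)] AE_transport[OF borel_solution.representative[OF f(2)], of t] AE_transport[OF borel_solution.representative[OF g(2)], of t]
  proof eventually_elim
    case (elim z)
    let ?Pf = "\<lambda>s. transport (t - s) (Qplus (f s) (f s)) (fst z) (snd z)" and ?Mf = "\<lambda>s. transport (t - s) (Qminus (f s) (f s)) (fst z) (snd z)"
    let ?Pg = "\<lambda>s. transport (t - s) (Qplus (g s) (g s)) (fst z) (snd z)" and ?Mg = "\<lambda>s. transport (t - s) (Qminus (g s) (g s)) (fst z) (snd z)"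
    let ?L = "lebesgue_on {0..t}"
    have tr: "transport (t - s) (\<lambda>y w. Qplus (h s) (h s) y w - Qminus (h s) (h s) y w) (fst z) (snd z)
      = transport (t - s) (Qplus (h s) (h s)) (fst z) (snd z) - transport (t - s) (Qminus (h s) (h s)) (fst z) (snd z)" for h s
      by (simp add: transport_def)
    have i: "integrable ?L (\<lambda>s. (?Pf s - ?Mf s) - (?Pg s - ?Mg s))"
      using elim(1,2) by (intro Bochner_Integration.integrable_diff) auto
    have "f t (fst z) (snd z) - g t (fst z) (snd z) = (LINT s|?L. ?Pf s - ?Mf s) - (LINT s|?L. ?Pg s - ?Mg s)"
      using elim(1,2) unfolding tr by linarith
    also have "\<dots> = (LINT s|?L. (?Pf s - ?Mf s) - (?Pg s - ?Mg s))"
      using elim(1,2) by (intro Bochner_Integration.integral_diff[symmetric] Bochner_Integration.integrable_diff) auto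
    finally have "ennreal \<bar>f t (fst z) (snd z) - g t (fst z) (snd z)\<bar> = ennreal (norm (LINT s|?L. (?Pf s - ?Mf s) - (?Pg s - ?Mg s)))"
      by simp
    also have "\<dots> \<le> (\<integral>\<^sup>+s. ennreal (norm ((?Pf s - ?Mf s) - (?Pg s - ?Mg s))) \<partial>?L)"
      by (rule integral_norm_bound_ennreal[OF i])
    also have "\<dots> = (\<integral>\<^sup>+s\<in>{0..t}. ennreal (norm ((?Pf s - ?Mf s) - (?Pg s - ?Mg s))) \<partial>lborel)"
      by (rule nn_integral_lebesgue_on) simp
    also have "\<dots> = (\<integral>\<^sup>+s\<in>{0..t}. bnet f' g' (s, fst z - (t - s) *\<^sub>R snd z, snd z) \<partial>lborel)"
    proof (rule nn_integral_cong_AE)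
      show "AE s in lborel. ennreal (norm ((?Pf s - ?Mf s) - (?Pg s - ?Mg s))) * indicator {0..t} s
        = bnet f' g' (s, fst z - (t - s) *\<^sub>R snd z, snd z) * indicator {0..t} s"
        using elim(3,4)
      proof eventually_elim
        case (elim s)
        show ?case
        proof (cases "s \<in> {0..t}")
          case True
          then have "s \<in> {0..T}" using t by auto
          then show ?thesis using elim by (simp add: transport_def bnet_def)
        qed simp
      qed
    qed
    finally show ?case .
  qed
qed

section \<open>Uniqueness\<close>

text \<open>The loss terms are split as (F - G) \<rho> + G (\<rho> - \<sigma>), with \<rho> and
  \<sigma> the densities of f and g. The first product carries a density to be bounded in sup norm,
  the second the density of the difference. The gain terms are treated by
  \<open>gain_difference\<close>.\<close>

lemma bnet_pointwise:
  fixes f g :: "real \<times> R2 \<times> R2 \<Rightarrow> real"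
  assumes [measurable]: "f \<in> borel_measurable borel" "g \<in> borel_measurable borel"
    and gain: "integrable lborel (bgain_integrand (\<lambda>v. f (t, x, v)) v)" "integrable lborel (bgain_integrand (\<lambda>v. g (t, x, v)) v)"
    and dens: "integrable lborel (\<lambda>v. f (t, x, v))" "integrable lborel (\<lambda>v. g (t, x, v))"
  shows "bnet f g (t, x, v)
    \<le> nQ (\<lambda>v. ennreal \<bar>f (t, x, v) - g (t, x, v)\<bar>) (\<lambda>v. ennreal \<bar>f (t, x, v)\<bar> + ennreal \<bar>g (t, x, v)\<bar>) v
      + ennreal (2 * pi) * (ennreal \<bar>f (t, x, v) - g (t, x, v)\<bar> * ennreal \<bar>bdens f (t, x)\<bar>)
      + ennreal (2 * pi) * ((ennreal \<bar>f (t, x, v)\<bar> + ennreal \<bar>g (t, x, v)\<bar>) * (\<integral>\<^sup>+u. ennreal \<bar>f (t, x, u) - g (t, x, u)\<bar> \<partial>lborel))"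
proof -
  let ?F = "f (t, x, v)" and ?G = "g (t, x, v)" and ?\<rho> = "bdens f (t, x)" and ?\<sigma> = "bdens g (t, x)"
  have "bloss f (t, x, v) - bloss g (t, x, v) = 2 * pi * ((?F - ?G) * ?\<rho> + ?G * (?\<rho> - ?\<sigma>))"
    by (simp add: bloss_def algebra_simps)
  then have "\<bar>bloss f (t, x, v) - bloss g (t, x, v)\<bar> = 2 * pi * \<bar>(?F - ?G) * ?\<rho> + ?G * (?\<rho> - ?\<sigma>)\<bar>"
    by (simp add: abs_mult)
  also have "\<dots> \<le> 2 * pi * (\<bar>?F - ?G\<bar> * \<bar>?\<rho>\<bar> + \<bar>?G\<bar> * \<bar>?\<rho> - ?\<sigma>\<bar>)"
    using abs_triangle_ineq[of "(?F - ?G) * ?\<rho>" "?G * (?\<rho> - ?\<sigma>)"] by (intro mult_left_mono) (auto simp: abs_mult)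
  finally have loss: "\<bar>bloss f (t, x, v) - bloss g (t, x, v)\<bar> \<le> 2 * pi * (\<bar>?F - ?G\<bar> * \<bar>?\<rho>\<bar>) + 2 * pi * (\<bar>?G\<bar> * \<bar>?\<rho> - ?\<sigma>\<bar>)"
    by (simp add: distrib_left)
  have "ennreal \<bar>?\<rho> - ?\<sigma>\<bar> = ennreal (norm (LINT v|lborel. f (t, x, v) - g (t, x, v)))"
    using dens by (simp add: bdens_def)
  also have "\<dots> \<le> (\<integral>\<^sup>+u. ennreal \<bar>f (t, x, u) - g (t, x, u)\<bar> \<partial>lborel)"
    using integral_norm_bound_ennreal[of lborel "\<lambda>v. f (t, x, v) - g (t, x, v)"] dens by simp
  finally have \<rho>: "ennreal \<bar>?\<rho> - ?\<sigma>\<bar> \<le> (\<integral>\<^sup>+u. ennreal \<bar>f (t, x, u) - g (t, x, u)\<bar> \<partial>lborel)" .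
  have "bnet f g (t, x, v) \<le> ennreal (\<bar>bgain f (t, x, v) - bgain g (t, x, v)\<bar>
      + (2 * pi * (\<bar>?F - ?G\<bar> * \<bar>?\<rho>\<bar>) + 2 * pi * (\<bar>?G\<bar> * \<bar>?\<rho> - ?\<sigma>\<bar>)))"
    unfolding bnet_def using loss by (intro ennreal_leI) linarith
  also have "\<dots> = ennreal \<bar>bgain f (t, x, v) - bgain g (t, x, v)\<bar>
      + ennreal (2 * pi) * (ennreal \<bar>?F - ?G\<bar> * ennreal \<bar>?\<rho>\<bar>) + ennreal (2 * pi) * (ennreal \<bar>?G\<bar> * ennreal \<bar>?\<rho> - ?\<sigma>\<bar>)"
    by (simp add: ennreal_plus ennreal_mult add.assoc)
  also have "\<dots> \<le> nQ (\<lambda>v. ennreal \<bar>f (t, x, v) - g (t, x, v)\<bar>) (\<lambda>v. ennreal \<bar>f (t, x, v)\<bar> + ennreal \<bar>g (t, x, v)\<bar>) v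
      + ennreal (2 * pi) * (ennreal \<bar>?F - ?G\<bar> * ennreal \<bar>?\<rho>\<bar>)
      + ennreal (2 * pi) * ((ennreal \<bar>?F\<bar> + ennreal \<bar>?G\<bar>) * (\<integral>\<^sup>+u. ennreal \<bar>f (t, x, u) - g (t, x, u)\<bar> \<partial>lborel))"
  proof (intro add_mono mult_left_mono mult_mono \<rho>)
    show "ennreal \<bar>bgain f (t, x, v) - bgain g (t, x, v)\<bar>
      \<le> nQ (\<lambda>v. ennreal \<bar>f (t, x, v) - g (t, x, v)\<bar>) (\<lambda>v. ennreal \<bar>f (t, x, v)\<bar> + ennreal \<bar>g (t, x, v)\<bar>) v"
      using gain_difference[of "\<lambda>v. f (t, x, v)" "\<lambda>v. g (t, x, v)" v] gain by (simp add: bgain_def)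
  qed (auto intro: add_increasing)
  finally show ?thesis .
qed

context borel_solution
begin

text \<open>The gain part is the assumed weighted L^1_t L^2 bound. For the loss part, the density is
  bounded in x at each time by n and multiplies the weighted L^2 norm of the solution.\<close>

lemma net_L1L2:
  assumes T: "0 \<le> T"
  shows "L2norm (\<lambda>z. jw a (snd z) * (\<integral>\<^sup>+s\<in>{0..T}. ennreal \<bar>bgain f' (s, fst z + s *\<^sub>R snd z, snd z)\<bar> \<partial>lborel)) < top"
    and "L2norm (\<lambda>z. jw a (snd z) * (\<integral>\<^sup>+s\<in>{0..T}. ennreal \<bar>bloss f' (s, fst z + s *\<^sub>R snd z, snd z)\<bar> \<partial>lborel)) < top"
proof -
  show "L2norm (\<lambda>z. jw a (snd z) * (\<integral>\<^sup>+s\<in>{0..T}. ennreal \<bar>bgain f' (s, fst z + s *\<^sub>R snd z, snd z)\<bar> \<partial>lborel)) < top"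
    by (rule order.strict_trans1[OF duhamel_L2[of "\<lambda>p. ennreal \<bar>bgain f' p\<bar>"] gain_L1L2]) measurable
  have "L2norm (\<lambda>z. jw a (snd z) * (\<integral>\<^sup>+s\<in>{0..T}. ennreal \<bar>bloss f' (s, fst z + s *\<^sub>R snd z, snd z)\<bar> \<partial>lborel))
    \<le> (\<integral>\<^sup>+s\<in>{0..T}. L2norm (\<lambda>z. jw a (snd z) * ennreal \<bar>bloss f' (s, z)\<bar>) \<partial>lborel)"
    by (rule duhamel_L2[of "\<lambda>p. ennreal \<bar>bloss f' p\<bar>"]) measurable
  also have "\<dots> \<le> (\<integral>\<^sup>+s. ennreal (2 * pi) * ennreal C * (indicator {0..T} s + (n s)\<^sup>2 * indicator {0..T} s) \<partial>lborel)"
  proof (rule nn_integral_mono_AE)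
    show "AE s in lborel. L2norm (\<lambda>z. jw a (snd z) * ennreal \<bar>bloss f' (s, z)\<bar>) * indicator {0..T} s
      \<le> ennreal (2 * pi) * ennreal C * (indicator {0..T} s + (n s)\<^sup>2 * indicator {0..T} s)"
      using L2_bound density_bound
    proof eventually_elim
      case (elim s)
      show ?case
      proof (cases "s \<in> {0..T}")
        case True
        let ?h = "\<lambda>x v. jw a v * ennreal \<bar>f' (s, x, v)\<bar>"
        have "(\<integral>\<^sup>+z. (jw a (snd z) * ennreal \<bar>bloss f' (s, z)\<bar>)\<^sup>2 \<partial>lborel) = (\<integral>\<^sup>+x. \<integral>\<^sup>+v. (jw a v * ennreal \<bar>bloss f' (s, x, v)\<bar>)\<^sup>2 \<partial>lborel \<partial>lborel)"
          by (subst nn_integral_lborel_pair) auto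
        also have "\<dots> \<le> (\<integral>\<^sup>+x. \<integral>\<^sup>+v. (ennreal (2 * pi) * n s)\<^sup>2 * (?h x v)\<^sup>2 \<partial>lborel \<partial>lborel)"
        proof (rule nn_integral_mono_AE)
          have "AE x in lborel. ennreal \<bar>bdens f' (s, x)\<bar> \<le> n s" using elim True by simp
          then show "AE x in lborel. (\<integral>\<^sup>+v. (jw a v * ennreal \<bar>bloss f' (s, x, v)\<bar>)\<^sup>2 \<partial>lborel) \<le> (\<integral>\<^sup>+v. (ennreal (2 * pi) * n s)\<^sup>2 * (?h x v)\<^sup>2 \<partial>lborel)"
          proof eventually_elim
            case (elim x)
            show ?case
            proof (rule nn_integral_mono)
              fix v
              have "jw a v * ennreal \<bar>bloss f' (s, x, v)\<bar> = ennreal (2 * pi) * ennreal \<bar>bdens f' (s, x)\<bar> * ?h x v"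
                by (simp add: bloss_def abs_mult ennreal_mult ac_simps)
              also have "\<dots> \<le> ennreal (2 * pi) * n s * ?h x v"
                using elim by (intro mult_right_mono mult_left_mono) auto
              finally have "(jw a v * ennreal \<bar>bloss f' (s, x, v)\<bar>)\<^sup>2 \<le> (ennreal (2 * pi) * n s * ?h x v)\<^sup>2"
                by (rule power_mono) simp
              then show "(jw a v * ennreal \<bar>bloss f' (s, x, v)\<bar>)\<^sup>2 \<le> (ennreal (2 * pi) * n s)\<^sup>2 * (?h x v)\<^sup>2"
                by (simp only: power_mult_distrib)
            qed
          qed
        qed
        also have "\<dots> = (ennreal (2 * pi) * n s)\<^sup>2 * (\<integral>\<^sup>+z. (jw a (snd z) * ennreal \<bar>f' (s, z)\<bar>)\<^sup>2 \<partial>lborel)"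
          by (subst nn_integral_lborel_pair) (auto simp: nn_integral_cmult)
        finally have "L2norm (\<lambda>z. jw a (snd z) * ennreal \<bar>bloss f' (s, z)\<bar>)
          \<le> ennpowr ((ennreal (2 * pi) * n s)\<^sup>2 * (\<integral>\<^sup>+z. (jw a (snd z) * ennreal \<bar>f' (s, z)\<bar>)\<^sup>2 \<partial>lborel)) (1/2)"
          unfolding L2norm_def by (intro ennpowr_mono) auto
        also have "\<dots> = ennreal (2 * pi) * n s * L2norm (\<lambda>z. jw a (snd z) * ennreal \<bar>f' (s, z)\<bar>)"
          unfolding L2norm_def by (subst ennpowr_mult) (simp_all add: ennpowr_half_sq)
        also have "\<dots> \<le> ennreal (2 * pi) * (1 + (n s)\<^sup>2) * ennreal C"
        proof (intro mult_mono)
          \<comment> \<open>Square integrability in time is turned into integrability on the bounded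
            interval [0, T].\<close>
          show "n s \<le> 1 + (n s)\<^sup>2"
          proof (cases "n s \<le> 1")
            case False
            then have "n s * 1 \<le> n s * n s" by (intro mult_left_mono) auto
            then show ?thesis by (simp add: power2_eq_square add_increasing)
          qed (auto intro: add_increasing2)
          show "L2norm (\<lambda>z. jw a (snd z) * ennreal \<bar>f' (s, z)\<bar>) \<le> ennreal C" using elim True by simp
        qed auto
        finally show ?thesis using True by (simp add: ac_simps)
      qed simp
    qed
  qed
  also have "\<dots> = ennreal (2 * pi) * ennreal C * (ennreal T + (\<integral>\<^sup>+t\<in>{0..T}. (n t)\<^sup>2 \<partial>lborel))"
    using T by (subst nn_integral_cmult, measurable, subst nn_integral_add) auto
  also have "\<dots> < top"
    using density_L2 by (simp add: ennreal_mult_less_top)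
  finally show "L2norm (\<lambda>z. jw a (snd z) * (\<integral>\<^sup>+s\<in>{0..T}. ennreal \<bar>bloss f' (s, fst z + s *\<^sub>R snd z, snd z)\<bar> \<partial>lborel)) < top" .
qed

end

text \<open>This is the a priori finiteness without which the absorption in
  \<open>iteration_vanishes\<close> would be inconclusive.\<close>

lemma bnet_finite:
  assumes f: "borel_solution a T C f f' n" and g: "borel_solution a T C' g g' n'" and T: "0 \<le> T"
  shows "L2norm (\<lambda>z. jw a (snd z) * (\<integral>\<^sup>+s\<in>{0..T}. bnet f' g' (s, fst z + s *\<^sub>R snd z, snd z) \<partial>lborel)) < top"
proof -
  have [measurable]: "f' \<in> borel_measurable borel" "g' \<in> borel_measurable borel"
    using f g by (auto intro: borel_solution.f'_measurable)
  let ?I = "\<lambda>h z. jw a (snd z) * (\<integral>\<^sup>+s\<in>{0..T}. ennreal \<bar>h (s, fst z + s *\<^sub>R snd z, snd z)\<bar> \<partial>lborel)"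
  have "L2norm (\<lambda>z. jw a (snd z) * (\<integral>\<^sup>+s\<in>{0..T}. bnet f' g' (s, fst z + s *\<^sub>R snd z, snd z) \<partial>lborel))
    \<le> L2norm (\<lambda>z. (?I (bgain f') z + ?I (bloss f') z) + (?I (bgain g') z + ?I (bloss g') z))"
  proof (rule L2norm_mono)
    fix z :: "R2 \<times> R2"
    have "bnet f' g' p \<le> (ennreal \<bar>bgain f' p\<bar> + ennreal \<bar>bloss f' p\<bar>) + (ennreal \<bar>bgain g' p\<bar> + ennreal \<bar>bloss g' p\<bar>)" for p
      unfolding bnet_def by (simp add: ennreal_leI flip: ennreal_plus)
    then have "(\<integral>\<^sup>+s\<in>{0..T}. bnet f' g' (s, fst z + s *\<^sub>R snd z, snd z) \<partial>lborel)
      \<le> (\<integral>\<^sup>+s\<in>{0..T}. (ennreal \<bar>bgain f' (s, fst z + s *\<^sub>R snd z, snd z)\<bar> + ennreal \<bar>bloss f' (s, fst z + s *\<^sub>R snd z, snd z)\<bar>)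
        + (ennreal \<bar>bgain g' (s, fst z + s *\<^sub>R snd z, snd z)\<bar> + ennreal \<bar>bloss g' (s, fst z + s *\<^sub>R snd z, snd z)\<bar>) \<partial>lborel)"
      by (intro nn_integral_mono mult_right_mono) auto
    then have "jw a (snd z) * (\<integral>\<^sup>+s\<in>{0..T}. bnet f' g' (s, fst z + s *\<^sub>R snd z, snd z) \<partial>lborel)
      \<le> jw a (snd z) * (\<integral>\<^sup>+s\<in>{0..T}. (ennreal \<bar>bgain f' (s, fst z + s *\<^sub>R snd z, snd z)\<bar> + ennreal \<bar>bloss f' (s, fst z + s *\<^sub>R snd z, snd z)\<bar>)
        + (ennreal \<bar>bgain g' (s, fst z + s *\<^sub>R snd z, snd z)\<bar> + ennreal \<bar>bloss g' (s, fst z + s *\<^sub>R snd z, snd z)\<bar>) \<partial>lborel)"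
      by (rule mult_left_mono) simp
    also have "\<dots> = (?I (bgain f') z + ?I (bloss f') z) + (?I (bgain g') z + ?I (bloss g') z)"
      by (simp add: distrib_right distrib_left nn_integral_add)
    finally show "jw a (snd z) * (\<integral>\<^sup>+s\<in>{0..T}. bnet f' g' (s, fst z + s *\<^sub>R snd z, snd z) \<partial>lborel)
      \<le> (?I (bgain f') z + ?I (bloss f') z) + (?I (bgain g') z + ?I (bloss g') z)" .
  qed
  also have "\<dots> < top"
    by (intro L2norm_add_finite borel_solution.net_L1L2[OF f T] borel_solution.net_L1L2[OF g T]) measurable
  finally show ?thesis .
qed

lemma borel_solutions_net_zero:
  assumes a: "1/2 < a" "a \<le> 1" and T: "0 < T"
    and f: "mild_solution T f0 f" "borel_solution a T C f f' n" and g: "mild_solution T f0 g" "borel_solution a T C' g g' n'"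
  shows "AE z in lborel. (\<integral>\<^sup>+s\<in>{0..T}. bnet f' g' (s, fst z + s *\<^sub>R snd z, snd z) \<partial>lborel) = 0"
proof -
  interpret f: borel_solution a T C f f' n by fact
  interpret g: borel_solution a T C' g g' n' by fact
  note [measurable] = f.f'_measurable g.f'_measurable f.n_measurable
  define w where "w p = ennreal \<bar>f' p - g' p\<bar>" for p
  define k where "k p = ennreal \<bar>f' p\<bar> + ennreal \<bar>g' p\<bar>" for p
  have [measurable]: "w \<in> borel_measurable borel" "k \<in> borel_measurable borel"
    unfolding w_def k_def by measurable
  \<comment> \<open>The bound that \<open>L42_add\<close> yields for the weighted norm of k = |f'| +
    |g'|.\<close>
  define D where "D = ennpowr (8 * (ennpowr (ennreal C) 4 + ennpowr (ennreal C') 4)) (1/4)"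
  show ?thesis
  proof (rule iteration_vanishes[where k = k and w = w and \<rho> = "\<lambda>y. ennreal \<bar>bdens f' y\<bar>" and n = n and C = D, OF _ _ _ _ _ a T])
    show "AE t in lborel. t \<in> {0..T} \<longrightarrow> (AE x in lborel. AE v in lborel. bnet f' g' (t, x, v)
        \<le> nQ (\<lambda>v. w (t, x, v)) (\<lambda>v. k (t, x, v)) v + ennreal (2 * pi) * (w (t, x, v) * ennreal \<bar>bdens f' (t, x)\<bar>)
          + ennreal (2 * pi) * (k (t, x, v) * (\<integral>\<^sup>+u. w (t, x, u) \<partial>lborel)))"
      using AE_slices(2)[OF f.gain_integrable] AE_slices(2)[OF g.gain_integrable]
        AE_lborel_pair[OF f.density_integrable] AE_lborel_pair[OF g.density_integrable]
    proof eventually_elim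
      case (elim t)
      show ?case
      proof
        assume t: "t \<in> {0..T}"
        show "AE x in lborel. AE v in lborel. bnet f' g' (t, x, v)
          \<le> nQ (\<lambda>v. w (t, x, v)) (\<lambda>v. k (t, x, v)) v + ennreal (2 * pi) * (w (t, x, v) * ennreal \<bar>bdens f' (t, x)\<bar>)
            + ennreal (2 * pi) * (k (t, x, v) * (\<integral>\<^sup>+u. w (t, x, u) \<partial>lborel))"
          using elim
        proof eventually_elim
          case (elim x)
          show ?case
            using elim(1,2)
          proof eventually_elim
            case (elim v)
            then show ?case
              unfolding w_def k_def using t \<open>fst (t, x) \<in> {0..T} \<longrightarrow> integrable lborel (\<lambda>v. f' (fst (t, x), snd (t, x), v))\<close>
                \<open>fst (t, x) \<in> {0..T} \<longrightarrow> integrable lborel (\<lambda>v. g' (fst (t, x), snd (t, x), v))\<close>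
              by (intro bnet_pointwise) auto
          qed
        qed
      qed
    qed
    show "AE t in lborel. t \<in> {0..T} \<longrightarrow> (AE x in lborel. AE v in lborel.
        w (t, x, v) \<le> (\<integral>\<^sup>+s\<in>{0..t}. bnet f' g' (s, x - (t - s) *\<^sub>R v, v) \<partial>lborel))"
      using AE_slices(1)[OF f.representative] AE_slices(1)[OF g.representative]
    proof eventually_elim
      case (elim t)
      show ?case
      proof
        assume t: "t \<in> {0..T}"
        have "AE z in lborel. w (t, z) \<le> (\<integral>\<^sup>+s\<in>{0..t}. bnet f' g' (s, fst z - (t - s) *\<^sub>R snd z, snd z) \<partial>lborel)"
          using elim duhamel_difference[OF f g t]
          by eventually_elim (use t in \<open>simp add: w_def\<close>)
        from AE_lborel_pair[OF this]
        show "AE x in lborel. AE v in lborel. w (t, x, v) \<le> (\<integral>\<^sup>+s\<in>{0..t}. bnet f' g' (s, x - (t - s) *\<^sub>R v, v) \<partial>lborel)"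
          by simp
      qed
    qed
    show "AE t in lborel. t \<in> {0..T} \<longrightarrow> L42 (\<lambda>p. jw a (snd (snd p)) * k p) t \<le> D"
      using f.L42_bound g.L42_bound
    proof eventually_elim
      case (elim t)
      show ?case
      proof
        assume t: "t \<in> {0..T}"
        have "L42 (\<lambda>p. jw a (snd (snd p)) * k p) t
          = L42 (\<lambda>p. jw a (snd (snd p)) * ennreal \<bar>f' p\<bar> + jw a (snd (snd p)) * ennreal \<bar>g' p\<bar>) t"
          by (simp add: k_def distrib_left)
        also have "\<dots> \<le> ennpowr (8 * (ennpowr (L42 (\<lambda>p. jw a (snd (snd p)) * ennreal \<bar>f' p\<bar>) t) 4
            + ennpowr (L42 (\<lambda>p. jw a (snd (snd p)) * ennreal \<bar>g' p\<bar>) t) 4)) (1/4)"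
          by (rule L42_add) measurable
        also have "\<dots> \<le> D"
          unfolding D_def using elim t by (intro ennpowr_mono mult_left_mono add_mono) auto
        finally show "L42 (\<lambda>p. jw a (snd (snd p)) * k p) t \<le> D" .
      qed
    qed
    show "D < top"
      by (simp add: D_def ennpowr_less_top_iff ennreal_mult_less_top)
    show "AE t in lborel. t \<in> {0..T} \<longrightarrow> (AE x in lborel. ennreal \<bar>bdens f' (t, x)\<bar> \<le> n t)"
      by (rule f.density_bound)
    show "(\<integral>\<^sup>+t\<in>{0..T}. (n t)\<^sup>2 \<partial>lborel) < top" by (rule f.density_L2)
    show "L2norm (\<lambda>z. jw a (snd z) * (\<integral>\<^sup>+s\<in>{0..T}. bnet f' g' (s, fst z + s *\<^sub>R snd z, snd z) \<partial>lborel)) < top"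
      using bnet_finite[OF f(2) g(2)] T by simp
  qed auto
qed

text \<open>The dominating integral over [0, T] vanishes for almost every starting point. Transport
  by t preserves null sets, so Duhamel's formula at this particular t gives equality for almost
  every (x, v); no exceptional set of times arises.\<close>

theorem theorem7p1:
  fixes \<delta> a T :: real
    and f0 :: "R2 \<Rightarrow> R2 \<Rightarrow> real"
    and f g :: "real \<Rightarrow> R2 \<Rightarrow> R2 \<Rightarrow> real"
  assumes "0 < \<delta>" and "\<delta> < 1 / 2" and "a = 1 / 2 + \<delta>" and "0 < T"
    and "mild_solution T f0 f" and "Qplus_bound a T f"
    and "density_bounds T f" and "solution_bounds a T f"
    and "mild_solution T f0 g" and "Qplus_bound a T g"
    and "density_bounds T g" and "solution_bounds a T g"
  shows "\<forall>t\<in>{0..T}. AE (x, v) in lebesgue. f t x v = g t x v"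
proof
  fix t
  assume t: "t \<in> {0..T}"
  \<comment> \<open>The lower bound makes the weights integrable, since 4a > 2 and 2a > 1; the upper
    bound gives the subadditivity of the power a used to distribute the weight in a
    collision.\<close>
  have a: "1/2 < a" "a \<le> 1" using assms(1-3) by auto
  obtain f' n C where f: "borel_solution a T C f f' n"
    using borel_solution_exists[OF assms(5-8)] .
  obtain g' n' C' where g: "borel_solution a T C' g g' n'"
    using borel_solution_exists[OF assms(9-12)] .
  have [measurable]: "f' \<in> borel_measurable borel" "g' \<in> borel_measurable borel"
    using f g by (auto intro: borel_solution.f'_measurable)
  let ?I = "\<lambda>z. \<integral>\<^sup>+s\<in>{0..T}. bnet f' g' (s, fst z + s *\<^sub>R snd z, snd z) \<partial>lborel"
  have "AE z in lborel. ?I z = 0"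
    by (rule borel_solutions_net_zero[OF a assms(4) assms(5) f assms(9) g])
  then have "(\<integral>\<^sup>+z. ?I z \<partial>lborel) = 0"
    by (subst nn_integral_0_iff_AE) auto
  then have "(\<integral>\<^sup>+z. ?I (fst z + (-t) *\<^sub>R snd z, snd z) \<partial>lborel) = 0"
    by (subst nn_integral_transport_pair) auto
  then have "AE z in lborel. ?I (fst z + (-t) *\<^sub>R snd z, snd z) = 0"
    by (subst (asm) nn_integral_0_iff_AE) auto
  then have "AE z in lborel. f t (fst z) (snd z) = g t (fst z) (snd z)"
    using duhamel_difference[OF assms(5) f assms(9) g t]
  proof eventually_elim
    case (elim z)
    note elim(2)
    also have "(\<integral>\<^sup>+s\<in>{0..t}. bnet f' g' (s, fst z - (t - s) *\<^sub>R snd z, snd z) \<partial>lborel)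
      = (\<integral>\<^sup>+s\<in>{0..t}. bnet f' g' (s, fst z + (-t) *\<^sub>R snd z + s *\<^sub>R snd z, snd z) \<partial>lborel)"
      by (simp add: algebra_simps)
    also have "\<dots> \<le> (\<integral>\<^sup>+s\<in>{0..T}. bnet f' g' (s, fst z + (-t) *\<^sub>R snd z + s *\<^sub>R snd z, snd z) \<partial>lborel)"
      using t by (intro nn_integral_mono mult_left_mono) (auto split: split_indicator)
    also have "\<dots> = 0" using elim(1) by simp
    finally have "ennreal \<bar>f t (fst z) (snd z) - g t (fst z) (snd z)\<bar> \<le> 0" .
    then show ?case by simp
  qed
  then show "AE (x, v) in lebesgue. f t x v = g t x v"
    by (simp add: AE_completion_iff case_prod_unfold)
qed

end
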